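(* Let $X,Y,Z,P$ be Asplund spaces, $K\subset Z$ a closed convex pointed cone with $\operatorname{int}K\ne\emptyset$, $g:X\times P\to Z$ a map, $H:X\times P\rightrightarrows Y$ a set-valued map, $H_p(\cdot)=H(\cdot,p)$, and $S(p)=\{x\in X\mid 0\in H(x,p)\}$. Let $M\subset P$ be nonempty, $\overline{x}\in X$, $L>0$. Suppose: (1) $g$ is $L$-strictly Lipschitz at $\overline{x}$ with respect to $M$: for every $p\in M$ the map $g(\cdot,p)$ is strictly Lipschitz at $\overline{x}$ and there is a neighborhood $U_p$ of $\overline{x}$ with $\|g(x,p)-g(u,p)\|\le L\|x-u\|$ for all $x,u\in U_p$; (2) $\overline{x}$ is a weak solution of "minimize $g(x,p)$ subject to $0\in H(x,p)$" with respect to $M$: $\overline{x}\in\bigcap_{p\in M}S(p)$ and for every $p\in M$ there is $\varepsilon_p>0$ such that $g(x,p)-g(\overline{x},p)\notin-\operatorname{int}K$ for all $x\in B(\overline{x},\varepsilon_p)\cap S(p)$; (3) there exist $r>0$ and a neighborhood $V$ of $\overline{x}$ such that $d(x,S(p))\le r\,d(0,H(x,p))$ for all $p\in M$ and all $x\in V$; (4) for every $p\in M$, $H_p$ has closed graph and $H$ is Lipschitz-like around $((\overline{x},p),0)$. Then for every $e\in\operatorname{int}K$ and every $p\in M$ there exist $z^*\in K^*$ with $z^*(e)=1$ and $y^*\in Y^*$ such that \[ 0\in\partial(z^*\circ g(\cdot,p))(\overline{x})+D_N^*H_p(\overline{x},0)(y^* ). \]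
   Context: $K^*=\{z^*\in Z^*\mid z^*(z)\ge0\ \forall z\in K\}$. A function $h:X\to Z$ is strictly Lipschitz at $\overline{x}$ if it is Lipschitz around $\overline{x}$ and there is a neighborhood $V_0$ of $0$ in $X$ such that the sequence $(t_k^{-1}(h(x_k+t_kv)-h(x_k)))_k$ has a norm convergent subsequence whenever $v\in V_0$, $x_k\to\overline{x}$, $t_k\downarrow0$. A multifunction $F:W\rightrightarrows Y$ is Lipschitz-like around $(\overline{w},\overline{y})\in\operatorname{Gr}F$ if there exist $L'>0$ and neighborhoods $U$ of $\overline{w}$, $V$ of $\overline{y}$ with $F(w)\cap V\subset F(u)+L'\|w-u\|\mathbb{D}_Y$ for all $w,u\in U$ ($\mathbb{D}_Y$ the closed unit ball; $X\times P$ carries the sum norm). $d(x,A)=\inf_{a\in A}\|x-a\|$, $d(x,\emptyset)=\infty$. For $\Omega$ in an Asplund space and $\overline{x}\in\Omega$: Fréchet normal cone $\widehat N(\Omega,x)=\{x^*\mid\limsup_{u\to x,u\in\Omega}\frac{x^*(u-x)}{\|u-x\|}\le0\}$; limiting normal cone $N(\Omega,\overline{x})$ is the set of $w^*$-limits of $x_n^*\in\widehat N(\Omega,x_n)$ with $x_n\to\overline{x}$, $x_n\in\Omega$. The limiting subdifferential of $\varphi$ at $\overline{x}$ is $\partial\varphi(\overline{x})=\{x^*\mid(x^*,-1)\in N(\operatorname{epi}\varphi,(\overline{x},\varphi(\overline{x})))\}$. The normal coderivative is $D_N^*F(x,y)(y^* )=\{x^*\mid(x^*,-y^* )\in N(\operatorname{Gr}F,(x,y))\}$.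 *)

theory Defs
  imports "HOL-Analysis.Analysis"
begin

definition bdd_lin_on :: "'a::real_normed_vector set \<Rightarrow> ('a \<Rightarrow> real) \<Rightarrow> bool" where
  "bdd_lin_on Y f \<longleftrightarrow>
     (\<forall>x\<in>Y. \<forall>y\<in>Y. \<forall>a b. f (a *\<^sub>R x + b *\<^sub>R y) = a * f x + b * f y) \<and>
     (\<exists>C. \<forall>y\<in>Y. \<bar>f y\<bar> \<le> C * norm y)"

definition separable_set :: "'a::metric_space set \<Rightarrow> bool" where
  "separable_set Y \<longleftrightarrow> (\<exists>D. countable D \<and> D \<subseteq> Y \<and> Y \<subseteq> closure D)"

definition separable_dual :: "'a::real_normed_vector set \<Rightarrow> bool" where
  "separable_dual Y \<longleftrightarrow>
     (\<exists>D. countable D \<and> (\<forall>d\<in>D. bdd_lin_on Y d) \<and>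
        (\<forall>f. bdd_lin_on Y f \<longrightarrow> (\<forall>\<epsilon>>0. \<exists>d\<in>D. \<forall>y\<in>Y. \<bar>f y - d y\<bar> \<le> \<epsilon> * norm y)))"

definition asplund :: "'a::banach itself \<Rightarrow> bool" where
  "asplund _ \<longleftrightarrow>
     (\<forall>Y::'a set. subspace Y \<and> closed Y \<and> separable_set Y \<longrightarrow> separable_dual Y)"

definition edist_set :: "'a::metric_space \<Rightarrow> 'a set \<Rightarrow> ereal" where
  "edist_set x A = (if A = {} then \<infinity> else ereal (infdist x A))"

definition lipschitz_around :: "('a::real_normed_vector \<Rightarrow> 'b::real_normed_vector) \<Rightarrow> 'a \<Rightarrow> bool" where
  "lipschitz_around h xb \<longleftrightarrow>
     (\<exists>L' U. open U \<and> xb \<in> U \<and> (\<forall>x\<in>U. \<forall>u\<in>U. norm (h x - h u) \<le> L' * norm (x - u)))"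

definition strictly_lipschitz_at :: "('a::real_normed_vector \<Rightarrow> 'b::real_normed_vector) \<Rightarrow> 'a \<Rightarrow> bool" where
  "strictly_lipschitz_at h xb \<longleftrightarrow> lipschitz_around h xb \<and>
     (\<exists>V0. open V0 \<and> 0 \<in> V0 \<and>
        (\<forall>v\<in>V0. \<forall>xs ts. xs \<longlonglongrightarrow> xb \<and> (\<forall>k. ts k > 0) \<and> ts \<longlonglongrightarrow> 0 \<longrightarrow>
           (\<exists>r l. strict_mono r \<and>
              ((\<lambda>k. (1 / ts (r k)) *\<^sub>R (h (xs (r k) + ts (r k) *\<^sub>R v) - h (xs (r k)))) \<longlonglongrightarrow> l))))"

definition lipschitz_like ::
  "('x::real_normed_vector \<times> 'p::real_normed_vector \<Rightarrow> 'y::real_normed_vector set) \<Rightarrow> 'x \<times> 'p \<Rightarrow> 'y \<Rightarrow> bool" where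
  "lipschitz_like F wb yb \<longleftrightarrow>
     (\<exists>L'>0. \<exists>U V. open U \<and> wb \<in> U \<and> open V \<and> yb \<in> V \<and>
        (\<forall>w\<in>U. \<forall>u\<in>U. \<forall>y\<in>F w \<inter> V. \<exists>y'\<in>F u.
           norm (y - y') \<le> L' * (norm (fst w - fst u) + norm (snd w - snd u))))"

text \<open>Frechet normal cone, with the limsup written out.\<close>
definition frechet_normal :: "'a::real_normed_vector set \<Rightarrow> 'a \<Rightarrow> ('a \<Rightarrow>\<^sub>L real) set" where
  "frechet_normal \<Omega> x = {xs. \<forall>\<epsilon>>0. \<exists>\<delta>>0. \<forall>u\<in>\<Omega>. norm (u - x) < \<delta> \<longrightarrow>
                              blinfun_apply xs (u - x) \<le> \<epsilon> * norm (u - x)}"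

definition limiting_normal :: "'a::real_normed_vector set \<Rightarrow> 'a \<Rightarrow> ('a \<Rightarrow>\<^sub>L real) set" where
  "limiting_normal \<Omega> x = {w. \<exists>xn wn. (\<forall>n. xn n \<in> \<Omega>) \<and> xn \<longlonglongrightarrow> x \<and>
        (\<forall>n. wn n \<in> frechet_normal \<Omega> (xn n)) \<and>
        (\<forall>v. (\<lambda>n. blinfun_apply (wn n) v) \<longlonglongrightarrow> blinfun_apply w v)}"

definition epigraph :: "('a \<Rightarrow> real) \<Rightarrow> ('a \<times> real) set" where
  "epigraph \<phi> = {(x, t). \<phi> x \<le> t}"

definition limiting_subdiff :: "('a::real_normed_vector \<Rightarrow> real) \<Rightarrow> 'a \<Rightarrow> ('a \<Rightarrow>\<^sub>L real) set" where
  "limiting_subdiff \<phi> x = {xs. \<exists>w \<in> limiting_normal (epigraph \<phi>) (x, \<phi> x).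
        \<forall>u s. blinfun_apply w (u, s) = blinfun_apply xs u - s}"

definition graph_of :: "('a \<Rightarrow> 'b set) \<Rightarrow> ('a \<times> 'b) set" where
  "graph_of F = {(x, y). y \<in> F x}"

definition normal_coderiv ::
  "('a::real_normed_vector \<Rightarrow> 'b::real_normed_vector set) \<Rightarrow> 'a \<Rightarrow> 'b \<Rightarrow> ('b \<Rightarrow>\<^sub>L real) \<Rightarrow> ('a \<Rightarrow>\<^sub>L real) set" where
  "normal_coderiv F x y ys = {xs. \<exists>w \<in> limiting_normal (graph_of F) (x, y).
        \<forall>u v. blinfun_apply w (u, v) = blinfun_apply xs u - blinfun_apply ys v}"

definition dual_cone :: "'a::real_normed_vector set \<Rightarrow> ('a \<Rightarrow>\<^sub>L real) set" where
  "dual_cone K = {zs. \<forall>z\<in>K. blinfun_apply zs z \<ge> 0}"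

end

theory Submission
  imports Defs "HOL-Library.Diagonal_Subsequence"
begin

text \<open>
  Let \<open>s\<close> be the sublinear functional \<open>s z = inf {t. t e - z \<in> K}\<close>. Weak minimality and the metric
  subregularity estimate make \<open>(xb, 0)\<close> a local minimiser of \<open>s (h x - h xb) + c \<bar>y\<bar>\<close> over the graph of
  \<open>F = H(\<cdot>, p)\<close>, where \<open>h = g(\<cdot>, p)\<close>. The variables are decoupled: \<open>s z + ls \<bar>z' - h x\<bar> + c \<bar>y'\<bar>\<close>
  with \<open>(u, y)\<close> in the graph is minimised subject to the linear constraint \<open>u = x, y = y', z = z'\<close>.
  A fuzzy multiplier rule in Asplund spaces yields Frechet subgradients at nearby points whose sum is small on the
  kernel of the constraint; the term \<open>\<bar>z' - h x\<bar>\<close> turns into a Frechet subgradient of a scalarization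
  \<open>\<zeta>\<^sub>n \<circ> h\<close>. Weak* sequential compactness of dual balls gives limits, and strict Lipschitzness
  permits replacing \<open>\<zeta>\<^sub>n\<close> by its limit.

  In a separable subspace with separable dual, a Frechet smooth bump supplies both a smooth variational
  principle and a smooth penalty for the constraint, hence the fuzzy rule. Separable reduction lifts it to the whole space: the existence of the subgradients is equivalent, by Hahn-Banach, to inequalities for finite
  convex combinations, and the subspace is closed under choosing violations of these inequalities.
\<close>

section \<open>Hahn-Banach\<close>

text \<open>Frechet subdifferentials obey no exact sum rule, which dictates the decoupling: when
  every term owns its variables, one functional on the product splits into components, and smallness
  on the kernel of the constraint is precisely what ties these components together. Two facts keep
  the limit from degenerating. A functional below \<open>s\<close> automatically lies in
  \<open>dual_cone K\<close> and takes the value 1 at \<open>e\<close>, and being below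
  \<open>s\<close> is a pointwise condition that weak* limits inherit. The components are bounded by
  the Lipschitz constant of the decoupled function up to the accuracy, so weak* compactness applies
  to them.

  The Asplund property speaks of separable subspaces, so smoothness is obtained only there. A
  subgradient does not lift from a subspace by mere extension; its existence is therefore restated
  through finite families of points, a form that a countable closure process can control. The
  penalty constant is \<open>ls * L * r\<close>: \<open>ls\<close> from the bound on
  \<open>s\<close>, \<open>L\<close> from \<open>h\<close>, and \<open>r\<close> from the distance
  estimate.\<close>

definition sublinear :: "('a::real_vector \<Rightarrow> real) \<Rightarrow> bool" where
  "sublinear p \<longleftrightarrow> (\<forall>x y. p (x + y) \<le> p x + p y) \<and> (\<forall>t\<ge>0. \<forall>x. p (t *\<^sub>R x) = t * p x)"

lemma sublinear_add: "sublinear p \<Longrightarrow> p (x + y) \<le> p x + p y"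
  and sublinear_scale: "sublinear p \<Longrightarrow> t \<ge> 0 \<Longrightarrow> p (t *\<^sub>R x) = t * p x"
  by (auto simp: sublinear_def)

lemma sublinear_zero: "sublinear p \<Longrightarrow> p 0 = 0"
  using sublinear_scale[of p 0 0] by simp

lemma sublinear_minus: "sublinear p \<Longrightarrow> - p (- x) \<le> p x"
  using sublinear_add[of p x "- x"] sublinear_zero[of p] by simp

text \<open>The one-sided inequality applied with factor \<open>inverse t\<close> to
  \<open>t *\<^sub>R x\<close> is the reverse inequality, so later homogeneity proofs treat one
  direction only.\<close>

lemma sublinear_scaleI:
  fixes p :: "'a::real_vector \<Rightarrow> real"
  assumes "\<And>t x. t > 0 \<Longrightarrow> p (t *\<^sub>R x) \<le> t * p x" "p 0 = 0" "t \<ge> 0"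
  shows "p (t *\<^sub>R x) = t * p x"
proof (cases "t = 0")
  case False
  with assms(3) have t: "t > 0" by simp
  have "p (inverse t *\<^sub>R (t *\<^sub>R x)) \<le> inverse t * p (t *\<^sub>R x)"
    using t by (intro assms(1)) simp
  then have "t * p x \<le> p (t *\<^sub>R x)"
    using t by (simp add: field_simps)
  with assms(1)[OF t, of x] show ?thesis by simp
qed (use assms in simp)

text \<open>Every member is at least \<open>- p (- x)\<close> at \<open>x\<close>, so the infimum is
  finite. Subadditivity is where the chain condition enters: of two members, the smaller one can
  replace both.\<close>

lemma sublinear_Inf_chain:
  fixes p :: "'a::real_vector \<Rightarrow> real"
  assumes ne: "C \<noteq> {}" and C: "\<And>q. q \<in> C \<Longrightarrow> sublinear q \<and> q \<le> p"
    and tot: "\<And>q1 q2. q1 \<in> C \<Longrightarrow> q2 \<in> C \<Longrightarrow> q1 \<le> q2 \<or> q2 \<le> q1"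
  shows "sublinear (\<lambda>x. INF q\<in>C. q x)" "\<And>q. q \<in> C \<Longrightarrow> (\<lambda>x. INF q\<in>C. q x) \<le> q"
proof -
  have lb: "- p (- x) \<le> q x" if "q \<in> C" for q x
    using sublinear_minus[of q x] C[OF that] by (smt (verit) le_fun_def)
  then have bdd: "bdd_below ((\<lambda>q. q x) ` C)" for x
    by (intro bdd_belowI2[of _ "- p (- x)"]) auto
  have low: "(INF q\<in>C. q x) \<le> q x" if "q \<in> C" for q x
    using that by (intro cINF_lower bdd)
  then show "\<And>q. q \<in> C \<Longrightarrow> (\<lambda>x. INF q\<in>C. q x) \<le> q" by (auto simp: le_fun_def)
  have sub: "(INF q\<in>C. q (x + y)) \<le> (INF q\<in>C. q x) + (INF q\<in>C. q y)" for x y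
  proof -
    have 1: "(INF q\<in>C. q (x + y)) \<le> q1 x + q2 y" if q: "q1 \<in> C" "q2 \<in> C" for q1 q2
    proof -
      obtain q where "q \<in> C" "q \<le> q1" "q \<le> q2" using tot q by blast
      then have "q (x + y) \<le> q1 x + q2 y"
        using C sublinear_add[of q x y] by (smt (verit) le_fun_def)
      then show ?thesis using low[OF \<open>q \<in> C\<close>, of "x + y"] by linarith
    qed
    have "(INF q\<in>C. q (x + y)) - q2 y \<le> (INF q\<in>C. q x)" if "q2 \<in> C" for q2
      using 1[OF _ that] by (intro cINF_greatest ne) (smt (verit))
    then have "(INF q\<in>C. q (x + y)) - (INF q\<in>C. q x) \<le> (INF q\<in>C. q y)"
      by (intro cINF_greatest ne) (smt (verit))
    then show ?thesis by linarith
  qed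
  have "(INF q\<in>C. q (t *\<^sub>R x)) = t * (INF q\<in>C. q x)" if "t \<ge> 0" for t x
  proof (rule sublinear_scaleI[OF _ _ that])
    fix t :: real and x assume t: "t > 0"
    have "(INF q\<in>C. q (t *\<^sub>R x)) / t \<le> (INF q\<in>C. q x)"
    proof (intro cINF_greatest ne)
      fix q assume q: "q \<in> C"
      have "(INF q\<in>C. q (t *\<^sub>R x)) \<le> t * q x"
        using low[OF q, of "t *\<^sub>R x"] C[OF q] sublinear_scale[of q t x] t by simp
      then show "(INF q\<in>C. q (t *\<^sub>R x)) / t \<le> q x" using t by (simp add: field_simps)
    qed
    then show "(INF q\<in>C. q (t *\<^sub>R x)) \<le> t * (INF q\<in>C. q x)" using t by (simp add: field_simps)
  next
    have "(\<lambda>q. q 0) ` C = {0}" using ne C sublinear_zero by force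
    then show "(INF q\<in>C. q 0) = 0" by simp
  qed
  with sub show "sublinear (\<lambda>x. INF q\<in>C. q x)" by (auto simp: sublinear_def)
qed

text \<open>A minimal sublinear functional \<open>q\<close> is linear: \<open>x \<mapsto> inf\<^sub>t q (x + t x\<^sub>0) - t q x\<^sub>0\<close>
  is sublinear and lies below \<open>q\<close>, so minimality gives \<open>q (- x\<^sub>0) \<le> - q x\<^sub>0\<close>.\<close>

theorem hahn_banach_sublinear:
  fixes p :: "'a::real_vector \<Rightarrow> real"
  assumes p: "sublinear p"
  obtains q where "linear q" "\<And>x. q x \<le> p x"
proof -
  define A where "A = {q. sublinear q \<and> q \<le> p}"
  \<comment> \<open>The order is reversed, so that the maximal element delivered by Zorn's lemma is
    a minimal sublinear functional.\<close>
  define P where "P = (\<lambda>q1 q2 :: 'a \<Rightarrow> real. q2 \<le> q1)"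
  have "\<exists>m\<in>A. \<forall>a\<in>A. P m a \<longrightarrow> a = m"
  proof (rule predicate_Zorn)
    show "partial_order_on A (relation_of P A)"
      by (rule partial_order_on_relation_ofI) (auto simp: P_def)
  next
    fix C assume "C \<in> Chains (relation_of P A)"
    then have C: "C \<subseteq> A" "\<And>a b. a \<in> C \<Longrightarrow> b \<in> C \<Longrightarrow> P a b \<or> P b a"
      by (auto simp: Chains_def relation_of_def)
    show "\<exists>u\<in>A. \<forall>a\<in>C. P a u"
    proof (cases "C = {}")
      case True then show ?thesis using p by (auto simp: A_def)
    next
      case False
      note S = sublinear_Inf_chain[of C p, OF False]
      have 1: "\<And>q. q \<in> C \<Longrightarrow> sublinear q \<and> q \<le> p" using C(1) by (auto simp: A_def)
      have 2: "\<And>q1 q2. q1 \<in> C \<Longrightarrow> q2 \<in> C \<Longrightarrow> q1 \<le> q2 \<or> q2 \<le> q1" using C(2) by (auto simp: P_def)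
      have "sublinear (\<lambda>x. INF q\<in>C. q x)" and le: "\<And>q. q \<in> C \<Longrightarrow> (\<lambda>x. INF q\<in>C. q x) \<le> q"
        using S[OF 1 2] by blast+
      moreover obtain q where "q \<in> C" using False by blast
      ultimately have "(\<lambda>x. INF q\<in>C. q x) \<in> A" using 1 by (auto simp: A_def intro: order_trans)
      then show ?thesis using le by (auto simp: P_def)
    qed
  qed
  then obtain q where q: "sublinear q" "q \<le> p" and min: "\<And>a. sublinear a \<Longrightarrow> a \<le> q \<Longrightarrow> a = q"
    by (auto simp: A_def P_def intro: order_trans)
  have neg: "q (- z) \<le> - q z" for z
  proof -
    define k where "k = (\<lambda>x. INF t\<in>{0..}. q (x + t *\<^sub>R z) - t * q z)"
    have lb: "- q (- x) \<le> q (x + t *\<^sub>R z) - t * q z" if "t \<ge> 0" for x t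
      using sublinear_add[OF q(1), of "x + t *\<^sub>R z" "- x"] sublinear_scale[OF q(1) that, of z] by simp
    have bdd: "bdd_below ((\<lambda>t. q (x + t *\<^sub>R z) - t * q z) ` {0..})" for x
      using lb by (intro bdd_belowI2[of _ "- q (- x)"]) auto
    have low: "k x \<le> q (x + t *\<^sub>R z) - t * q z" if "t \<ge> 0" for x t
      unfolding k_def using that by (intro cINF_lower bdd) auto
    have kq: "k \<le> q" using low[of 0] by (auto simp: le_fun_def)
    have ksub: "k (x + y) \<le> k x + k y" for x y
    proof -
      have 1: "k (x + y) \<le> (q (x + t *\<^sub>R z) - t * q z) + (q (y + s *\<^sub>R z) - s * q z)"
        if "t \<ge> 0" "s \<ge> 0" for t s
        using low[of "t + s" "x + y"] that sublinear_add[OF q(1), of "x + t *\<^sub>R z" "y + s *\<^sub>R z"]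
        by (simp add: algebra_simps)
      have "k (x + y) - (q (y + s *\<^sub>R z) - s * q z) \<le> k x" if "s \<ge> 0" for s
        unfolding k_def[of ] using 1[OF _ that] unfolding k_def by (intro cINF_greatest) (auto simp: algebra_simps)
      then have "k (x + y) - k x \<le> k y"
        unfolding k_def[THEN fun_cong, of y] by (intro cINF_greatest) (auto simp: algebra_simps)
      then show ?thesis by linarith
    qed
    have "k (t *\<^sub>R x) = t * k x" if "t \<ge> 0" for t x
    proof (rule sublinear_scaleI[OF _ _ that])
      fix t :: real and x assume t: "t > 0"
      have "k (t *\<^sub>R x) / t \<le> k x"
        unfolding k_def[THEN fun_cong, of x]
      proof (rule cINF_greatest)
        fix s :: real assume "s \<in> {0..}"
        then have "k (t *\<^sub>R x) \<le> q (t *\<^sub>R (x + s *\<^sub>R z)) - (t * s) * q z"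
          using low[of "t * s" "t *\<^sub>R x"] t by (simp add: algebra_simps)
        also have "\<dots> = t * (q (x + s *\<^sub>R z) - s * q z)"
          using t sublinear_scale[OF q(1), of t "x + s *\<^sub>R z"] by (simp add: right_diff_distrib)
        finally show "k (t *\<^sub>R x) / t \<le> q (x + s *\<^sub>R z) - s * q z"
          using t by (simp add: field_simps)
      qed auto
      then show "k (t *\<^sub>R x) \<le> t * k x" using t by (simp add: field_simps)
    next
      have "k 0 \<le> 0" using low[of 0 0] sublinear_zero[OF q(1)] by simp
      moreover have "0 \<le> k 0" unfolding k_def using lb[of _ 0] sublinear_zero[OF q(1)]
        by (intro cINF_greatest) auto
      ultimately show "k 0 = 0" by simp
    qed
    with ksub have "sublinear k" by (auto simp: sublinear_def)
    with min kq have "k = q" by blast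
    with low[of 1 "- z"] sublinear_zero[OF q(1)] show ?thesis by simp
  qed
  have odd: "q (- z) = - q z" for z using neg[of z] sublinear_minus[OF q(1), of z] by linarith
  have "linear q"
  proof (rule linearI)
    fix x y
    have "q (- (x + y)) \<le> q (- x) + q (- y)" using sublinear_add[OF q(1), of "- x" "- y"] by simp
    then show "q (x + y) = q x + q y" using sublinear_add[OF q(1), of x y] odd[of "x + y"] odd[of x] odd[of y]
      by linarith
  next
    fix t :: real and x
    show "q (t *\<^sub>R x) = t *\<^sub>R q x"
    proof (cases "t \<ge> 0")
      case True then show ?thesis using sublinear_scale[OF q(1)] by simp
    next
      case False
      then have "q ((- t) *\<^sub>R x) = (- t) * q x" using sublinear_scale[OF q(1), of "- t" x] by simp
      then show ?thesis using odd[of "t *\<^sub>R x"] by simp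
    qed
  qed
  with q(2) that show ?thesis by (auto simp: le_fun_def)
qed

text \<open>A pair \<open>(v, c)\<close> in \<open>A\<close> encodes the demand
  \<open>l v <= c\<close>. The infimum over \<open>t >= 0\<close> and hull points
  \<open>(v, c)\<close> of \<open>t * c + C * norm (x - t v)\<close> is sublinear, at most
  \<open>C * norm x\<close>, and at most \<open>c\<close> at each atom; the hypothesis is what keeps
  it from being minus infinity. The hypothesis is also necessary, so existence of \<open>l\<close>
  becomes a statement about finite convex combinations.\<close>

lemma functional_below_atoms:
  fixes A :: "('a::real_normed_vector \<times> real) set"
  assumes C: "C \<ge> 0" and A: "\<And>v c. (v, c) \<in> convex hull A \<Longrightarrow> 0 \<le> c + C * norm v"
  obtains l :: "'a \<Rightarrow>\<^sub>L real" where "norm l \<le> C" "\<And>v c. (v, c) \<in> A \<Longrightarrow> blinfun_apply l v \<le> c"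
proof (cases "A = {}")
  case True
  then show ?thesis using that[of 0] C by simp
next
  case False
  define I where "I = {0::real..} \<times> (convex hull A)"
  define \<phi> where "\<phi> = (\<lambda>(x::'a) (t, a). t * snd a + C * norm (x - t *\<^sub>R fst a))"
  define p where "p = (\<lambda>x. INF i\<in>I. \<phi> x i)"
  have Ine: "I \<noteq> {}" using False by (auto simp: I_def)
  have lb: "- C * norm x \<le> \<phi> x (t, a)" if "(t, a) \<in> I" for x t a
  proof -
    obtain v c where a: "a = (v, c)" by (cases a)
    have t: "t \<ge> 0" and "0 \<le> c + C * norm v" using that A a by (auto simp: I_def)
    then have 1: "0 \<le> t * (c + C * norm v)" by simp
    have "norm (t *\<^sub>R v) - norm x \<le> norm (x - t *\<^sub>R v)" by (metis norm_minus_commute norm_triangle_ineq2)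
    then have "C * (t * norm v - norm x) \<le> C * norm (x - t *\<^sub>R v)"
      using C t by (intro mult_left_mono) auto
    with 1 show ?thesis by (simp add: \<phi>_def a algebra_simps)
  qed
  have bdd: "bdd_below (\<phi> x ` I)" for x
    using lb by (intro bdd_belowI2[of _ "- C * norm x"]) auto
  have low: "p x \<le> t * snd a + C * norm (x - t *\<^sub>R fst a)" if "t \<ge> 0" "a \<in> convex hull A" for x t a
    using cINF_lower[OF bdd, of "(t, a)" x] that by (auto simp: p_def I_def \<phi>_def)
  have psub: "p (x + y) \<le> p x + p y" for x y
  proof -
    have 1: "p (x + y) \<le> \<phi> x i + \<phi> y j" if ij: "i \<in> I" "j \<in> I" for i j
    proof -
      obtain t a s b where i: "i = (t, a)" and j: "j = (s, b)" by (cases i, cases j)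
      have ts: "t \<ge> 0" "s \<ge> 0" "a \<in> convex hull A" "b \<in> convex hull A" using ij by (auto simp: I_def i j)
      show ?thesis
      proof (cases "t + s = 0")
        case True
        then have "t = 0" "s = 0" using ts by auto
        then show ?thesis
          using low[of 0 a "x + y"] ts C mult_left_mono[OF norm_triangle_ineq[of x y], of C]
          by (simp add: \<phi>_def i j algebra_simps)
      next
        case False
        with ts have pos: "t + s > 0" by simp
        \<comment> \<open>The cone over a convex set is closed under addition: the two multiples
          combine into \<open>t + s\<close> times one hull point.\<close>
        define c where "c = (t / (t + s)) *\<^sub>R a + (s / (t + s)) *\<^sub>R b"
        have "c \<in> convex hull A" unfolding c_def
          using ts pos by (intro convexD[OF convex_convex_hull]) (auto simp: add_divide_distrib[symmetric])
        moreover have c: "(t + s) *\<^sub>R c = t *\<^sub>R a + s *\<^sub>R b" using pos by (simp add: c_def scaleR_add_right)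
        have "(t + s) *\<^sub>R fst c = t *\<^sub>R fst a + s *\<^sub>R fst b" "(t + s) * snd c = t * snd a + s * snd b"
          using arg_cong[OF c, of fst] arg_cong[OF c, of snd] by simp_all
        ultimately have "p (x + y) \<le> t * snd a + s * snd b + C * norm (x + y - (t *\<^sub>R fst a + s *\<^sub>R fst b))"
          using low[of "t + s" c "x + y"] pos by simp
        also have "x + y - (t *\<^sub>R fst a + s *\<^sub>R fst b) = (x - t *\<^sub>R fst a) + (y - s *\<^sub>R fst b)" by simp
        also have "C * norm \<dots> \<le> C * (norm (x - t *\<^sub>R fst a) + norm (y - s *\<^sub>R fst b))"
          using C by (intro mult_left_mono norm_triangle_ineq)
        finally show ?thesis by (simp add: \<phi>_def i j algebra_simps)
      qed
    qed
    have "p (x + y) - \<phi> y j \<le> p x" if "j \<in> I" for j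
      unfolding p_def[THEN fun_cong, of x] using 1[OF _ that] by (intro cINF_greatest Ine) (smt (verit))
    then have "p (x + y) - p x \<le> p y"
      unfolding p_def[THEN fun_cong, of y] by (intro cINF_greatest Ine) (smt (verit))
    then show ?thesis by linarith
  qed
  obtain a0 where a0: "a0 \<in> convex hull A" using False hull_inc[of _ A convex] by fastforce
  have pC: "p x \<le> C * norm x" for x using low[of 0 a0 x] a0 by simp
  have pC': "- C * norm x \<le> p x" for x unfolding p_def using lb by (intro cINF_greatest Ine) auto
  have "p (t *\<^sub>R x) = t * p x" if "t \<ge> 0" for t x
  proof (rule sublinear_scaleI[OF _ _ that])
    fix t :: real and x assume t: "t > 0"
    have "p (t *\<^sub>R x) / t \<le> p x"
      unfolding p_def[THEN fun_cong, of x]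
    proof (rule cINF_greatest[OF Ine])
      fix i assume "i \<in> I"
      then obtain s a where i: "i = (s, a)" "s \<ge> 0" "a \<in> convex hull A" by (auto simp: I_def)
      have "p (t *\<^sub>R x) \<le> (t * s) * snd a + C * norm (t *\<^sub>R (x - s *\<^sub>R fst a))"
        using low[of "t * s" a "t *\<^sub>R x"] t i by (simp add: algebra_simps)
      also have "\<dots> = t * \<phi> x i" using t by (simp add: \<phi>_def i distrib_left mult.left_commute)
      finally show "p (t *\<^sub>R x) / t \<le> \<phi> x i" using t by (simp add: field_simps)
    qed
    then show "p (t *\<^sub>R x) \<le> t * p x" using t by (simp add: field_simps)
  next
    show "p 0 = 0" using pC[of 0] pC'[of 0] by simp
  qed
  with psub have "sublinear p" by (auto simp: sublinear_def)
  then obtain q where q: "linear q" "\<And>x. q x \<le> p x" by (rule hahn_banach_sublinear) blast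
  have qC: "\<bar>q x\<bar> \<le> C * norm x" for x
  proof -
    have "q x \<le> C * norm x" "q (- x) \<le> C * norm (- x)" using q(2) pC order_trans by blast+
    then show ?thesis using linear_neg[OF q(1), of x] by simp
  qed
  have bl: "bounded_linear q"
    using q(1) qC by (intro bounded_linear_intro[of _ C]) (auto simp: linear_add linear_scale mult.commute)
  show ?thesis
  proof (rule that[of "Blinfun q"])
    show "norm (Blinfun q) \<le> C"
      using C qC by (intro norm_blinfun_bound) (auto simp: bounded_linear_Blinfun_apply[OF bl])
    fix v c assume "(v, c) \<in> A"
    then have "p v \<le> c" using low[of 1 "(v, c)" v] hull_inc[of "(v, c)" A] by simp
    then show "blinfun_apply (Blinfun q) v \<le> c"
      using q(2)[of v] by (simp add: bounded_linear_Blinfun_apply[OF bl])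
  qed
qed

section \<open>Separable subspaces and products of Asplund spaces\<close>

text \<open>The graph of \<open>f\<close> over \<open>Y\<close> is convex and can serve as the set
  of atoms. Since \<open>Y\<close> contains the negatives of its points, the upper bounds are
  equalities.\<close>

lemma bdd_lin_on_extend:
  fixes Y :: "'a::real_normed_vector set"
  assumes Y: "subspace Y" and f: "bdd_lin_on Y f"
  obtains l :: "'a \<Rightarrow>\<^sub>L real" where "\<And>y. y \<in> Y \<Longrightarrow> blinfun_apply l y = f y"
proof -
  have lin: "f (a *\<^sub>R x + b *\<^sub>R y) = a * f x + b * f y" if "x \<in> Y" "y \<in> Y" for x y a b
    using f that by (auto simp: bdd_lin_on_def)
  obtain C' where C': "\<And>y. y \<in> Y \<Longrightarrow> \<bar>f y\<bar> \<le> C' * norm y" using f unfolding bdd_lin_on_def by blast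
  \<comment> \<open>On a trivial \<open>Y\<close> the constant \<open>C'\<close> may be
    negative.\<close>
  define C where "C = max 0 C'"
  have C: "C \<ge> 0" "\<bar>f y\<bar> \<le> C * norm y" if "y \<in> Y" for y
    using C'[OF that] mult_right_mono[of C' C "norm y"] by (auto simp: C_def)
  define A where "A = {(y, f y) | y. y \<in> Y}"
  have "convex A"
    unfolding convex_def using lin Y by (auto simp: A_def subspace_add subspace_scale)
  then have hull: "convex hull A = A" by (rule hull_same)
  have C0: "C \<ge> 0" by (simp add: C_def)
  have pos: "0 \<le> c + C * norm v" if "(v, c) \<in> convex hull A" for v c
    using that C(2)[of v] unfolding hull by (auto simp: A_def abs_le_iff)
  obtain l :: "'a \<Rightarrow>\<^sub>L real" where l: "\<And>v c. (v, c) \<in> A \<Longrightarrow> blinfun_apply l v \<le> c"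
    using functional_below_atoms[OF C0 pos] by blast
  have "blinfun_apply l y = f y" if y: "y \<in> Y" for y
  proof -
    have "blinfun_apply l y \<le> f y" using l y by (auto simp: A_def)
    moreover have "blinfun_apply l (- y) \<le> f (- y)" using l y Y by (auto simp: A_def subspace_neg)
    moreover have "f (- y) = - f y" using lin[OF y y, of "-1" 0] by simp
    ultimately show ?thesis by (simp add: blinfun.minus_right)
  qed
  then show ?thesis by (rule that)
qed

lemma countable_closed_hull:
  fixes f :: "'i::countable \<Rightarrow> 'a \<Rightarrow> 'a \<Rightarrow> 'a"
  assumes S: "countable S"
  obtains C where "countable C" "S \<subseteq> C" "\<And>i x y. x \<in> C \<Longrightarrow> y \<in> C \<Longrightarrow> f i x y \<in> C"
proof -
  define step where "step = (\<lambda>A. A \<union> (\<lambda>(i, x, y). f i x y) ` (UNIV \<times> A \<times> A))"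
  define C where "C = (\<Union>n. (step ^^ n) S)"
  have cnt: "countable ((step ^^ n) S)" for n
    by (induction n) (auto simp: step_def S)
  have mono: "(step ^^ m) S \<subseteq> (step ^^ n) S" if "m \<le> n" for m n
    using that by (induction rule: dec_induct) (auto simp: step_def)
  show ?thesis
  proof
    show "countable C" unfolding C_def using cnt by blast
    have "(step ^^ 0) S \<subseteq> C" unfolding C_def by blast
    then show "S \<subseteq> C" by simp
    fix i x y assume "x \<in> C" "y \<in> C"
    then obtain m n where "x \<in> (step ^^ m) S" "y \<in> (step ^^ n) S" by (auto simp: C_def)
    then have "x \<in> (step ^^ max m n) S" "y \<in> (step ^^ max m n) S"
      using mono[of m "max m n"] mono[of n "max m n"] by auto
    then have "f i x y \<in> (step ^^ Suc (max m n)) S" by (force simp: step_def)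
    then show "f i x y \<in> C" unfolding C_def by blast
  qed
qed

lemma rat_seq_tendsto: "\<exists>q :: nat \<Rightarrow> rat. (\<lambda>n. real_of_rat (q n)) \<longlonglongrightarrow> a"
proof -
  have "\<exists>q :: rat. a < real_of_rat q \<and> real_of_rat q < a + inverse (real (Suc n))" for n
    by (rule of_rat_dense) simp
  then obtain q :: "nat \<Rightarrow> rat" where q: "\<And>n. a < real_of_rat (q n)" "\<And>n. real_of_rat (q n) < a + inverse (real (Suc n))"
    by metis
  have "(\<lambda>n. real_of_rat (q n)) \<longlonglongrightarrow> a"
  proof (rule tendsto_sandwich[OF _ _ tendsto_const])
    show "(\<lambda>n. a + inverse (real (Suc n))) \<longlonglongrightarrow> a"
      using tendsto_add[OF tendsto_const[of a] LIMSEQ_inverse_real_of_nat] by simp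
  qed (use q in \<open>auto intro!: always_eventually less_imp_le simp del: of_nat_Suc\<close>)
  then show ?thesis by blast
qed

lemma subspace_closure_rational:
  fixes C :: "'a::real_normed_vector set"
  assumes "0 \<in> C" and comb: "\<And>a b :: rat. \<And>x y. x \<in> C \<Longrightarrow> y \<in> C \<Longrightarrow> real_of_rat a *\<^sub>R x + real_of_rat b *\<^sub>R y \<in> C"
  shows "subspace (closure C)"
proof (rule subspaceI)
  show "0 \<in> closure C" using assms(1) closure_subset by blast
next
  fix x y assume "x \<in> closure C" "y \<in> closure C"
  then obtain f g where fg: "\<And>n::nat. f n \<in> C" "f \<longlonglongrightarrow> x" "\<And>n::nat. g n \<in> C" "g \<longlonglongrightarrow> y"
    by (auto simp: closure_sequential)
  have "f n + g n \<in> C" for n using comb[of "f n" "g n" 1 1] fg by simp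
  then show "x + y \<in> closure C" unfolding closure_sequential using tendsto_add[OF fg(2,4)] by (intro exI[of _ "\<lambda>n. f n + g n"]) auto
next
  fix a and x assume "x \<in> closure C"
  then obtain f where f: "\<And>n::nat. f n \<in> C" "f \<longlonglongrightarrow> x" by (auto simp: closure_sequential)
  obtain q :: "nat \<Rightarrow> rat" where q: "(\<lambda>n. real_of_rat (q n)) \<longlonglongrightarrow> a" using rat_seq_tendsto by blast
  have "real_of_rat (q n) *\<^sub>R f n \<in> C" for n using comb[of "f n" "f n" "q n" 0] f by simp
  then show "a *\<^sub>R x \<in> closure C" unfolding closure_sequential using tendsto_scaleR[OF q f(2)] by (intro exI[of _ "\<lambda>n. real_of_rat (q n) *\<^sub>R f n"]) auto
qed

text \<open>Rational linear combinations are added to the operations, so one countable set serves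
  both purposes. The operations \<open>f\<close> may be discontinuous choices; hence only
  \<open>C\<close>, and not its closure, is claimed to be closed under them.\<close>

lemma separable_closed_hull:
  fixes f :: "'i::countable \<Rightarrow> 'a \<Rightarrow> 'a \<Rightarrow> 'a::real_normed_vector"
  assumes S: "countable S"
  obtains C where "countable C" "S \<subseteq> C" "\<And>i x y. x \<in> C \<Longrightarrow> y \<in> C \<Longrightarrow> f i x y \<in> C"
    "subspace (closure C)" "separable_set (closure C)"
proof -
  define g :: "rat \<times> rat + 'i \<Rightarrow> 'a \<Rightarrow> 'a \<Rightarrow> 'a" where
    "g = case_sum (\<lambda>(a, b) x y. real_of_rat a *\<^sub>R x + real_of_rat b *\<^sub>R y) f"
  obtain C where C: "countable C" "insert 0 S \<subseteq> C" "\<And>i x y. x \<in> C \<Longrightarrow> y \<in> C \<Longrightarrow> g i x y \<in> C"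
    using countable_closed_hull[of "insert 0 S" g] S by auto
  have "real_of_rat a *\<^sub>R x + real_of_rat b *\<^sub>R y \<in> C" if "x \<in> C" "y \<in> C" for a b x y
    using C(3)[OF that, of "Inl (a, b)"] by (simp add: g_def)
  moreover have "f i x y \<in> C" if "x \<in> C" "y \<in> C" for i x y
    using C(3)[OF that, of "Inr i"] by (simp add: g_def)
  ultimately show ?thesis
    using C(1,2) closure_subset[of C] by (intro that[of C] subspace_closure_rational) (auto simp: separable_set_def)
qed

lemma separable_closed_subspace:
  fixes S :: "'a::real_normed_vector set"
  assumes "countable S"
  obtains V where "subspace V" "closed V" "separable_set V" "S \<subseteq> V"
proof -
  obtain C where "countable C" "S \<subseteq> C" "subspace (closure C)" "separable_set (closure C)"
    by (rule separable_closed_hull[OF assms, of "\<lambda>(_::unit) x y. x"])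
  then show ?thesis using that[of "closure C"] closure_subset by blast
qed

lemma separable_dualE:
  assumes "separable_dual V"
  obtains D where "countable D" "\<forall>d\<in>D. bdd_lin_on V d"
    "\<forall>f. bdd_lin_on V f \<longrightarrow> (\<forall>\<epsilon>>0. \<exists>d\<in>D. \<forall>y\<in>V. \<bar>f y - d y\<bar> \<le> \<epsilon> * norm y)"
proof -
  obtain D where "countable D \<and> (\<forall>d\<in>D. bdd_lin_on V d) \<and>
      (\<forall>f. bdd_lin_on V f \<longrightarrow> (\<forall>\<epsilon>>0. \<exists>d\<in>D. \<forall>y\<in>V. \<bar>f y - d y\<bar> \<le> \<epsilon> * norm y))"
    using assms unfolding separable_dual_def by (elim exE)
  then show ?thesis by (intro that[of D]) simp_all
qed

text \<open>A separable \<open>V\<close> sits inside a product of separable closed subspaces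
  generated by the coordinates of a dense sequence. A functional on the product is the sum of its
  two partial functionals, and each is approximated in its own factor.\<close>

lemma asplund_prod:
  assumes a: "asplund TYPE('a::banach)" and b: "asplund TYPE('b::banach)"
  shows "asplund TYPE('a \<times> 'b)"
  unfolding asplund_def
proof (intro allI impI, elim conjE)
  fix V :: "('a \<times> 'b) set" assume V: "subspace V" "closed V" "separable_set V"
  then obtain E where E: "countable E" "V \<subseteq> closure E" by (auto simp: separable_set_def)
  obtain V1 where V1: "subspace V1" "closed V1" "separable_set V1" "fst ` E \<subseteq> V1"
    by (rule separable_closed_subspace[OF countable_image[OF E(1), of fst]])
  obtain V2 where V2: "subspace V2" "closed V2" "separable_set V2" "snd ` E \<subseteq> V2"
    by (rule separable_closed_subspace[OF countable_image[OF E(1), of snd]])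
  have "closed (V1 \<times> V2)" "E \<subseteq> V1 \<times> V2" using V1 V2 by (auto intro: closed_Times)
  then have V12: "V \<subseteq> V1 \<times> V2" using E(2) closure_minimal by blast
  have sd1: "separable_dual V1" using a V1(1-3) unfolding asplund_def by blast
  obtain D1 where D1: "countable D1" "\<forall>d\<in>D1. bdd_lin_on V1 d"
    "\<forall>f. bdd_lin_on V1 f \<longrightarrow> (\<forall>\<epsilon>>0. \<exists>d\<in>D1. \<forall>y\<in>V1. \<bar>f y - d y\<bar> \<le> \<epsilon> * norm y)"
    by (rule separable_dualE[OF sd1])
  have sd2: "separable_dual V2" using b V2(1-3) unfolding asplund_def by blast
  obtain D2 where D2: "countable D2" "\<forall>d\<in>D2. bdd_lin_on V2 d"
    "\<forall>f. bdd_lin_on V2 f \<longrightarrow> (\<forall>\<epsilon>>0. \<exists>d\<in>D2. \<forall>y\<in>V2. \<bar>f y - d y\<bar> \<le> \<epsilon> * norm y)"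
    by (rule separable_dualE[OF sd2])
  define D where "D = (\<lambda>(d1, d2) v. d1 (fst v) + d2 (snd v) :: real) ` (D1 \<times> D2)"
  show "separable_dual V" unfolding separable_dual_def
  proof (intro exI[of _ D] conjI ballI allI impI)
    show "countable D" using D1(1) D2(1) by (auto simp: D_def)
  next
    fix d assume "d \<in> D"
    then obtain d1 d2 where d: "d = (\<lambda>v. d1 (fst v) + d2 (snd v))" "d1 \<in> D1" "d2 \<in> D2" by (auto simp: D_def)
    have l1: "\<forall>x\<in>V1. \<forall>y\<in>V1. \<forall>a b. d1 (a *\<^sub>R x + b *\<^sub>R y) = a * d1 x + b * d1 y"
      and l2: "\<forall>x\<in>V2. \<forall>y\<in>V2. \<forall>a b. d2 (a *\<^sub>R x + b *\<^sub>R y) = a * d2 x + b * d2 y"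
      using D1(2)[rule_format, OF d(2)] D2(2)[rule_format, OF d(3)] by (auto simp: bdd_lin_on_def)
    obtain C1 where C1: "\<And>y. y \<in> V1 \<Longrightarrow> \<bar>d1 y\<bar> \<le> C1 * norm y" using D1(2)[rule_format, OF d(2)] unfolding bdd_lin_on_def by blast
    obtain C2 where C2: "\<And>y. y \<in> V2 \<Longrightarrow> \<bar>d2 y\<bar> \<le> C2 * norm y" using D2(2)[rule_format, OF d(3)] unfolding bdd_lin_on_def by blast
    have "\<bar>d v\<bar> \<le> (\<bar>C1\<bar> + \<bar>C2\<bar>) * norm v" if v: "v \<in> V" for v
    proof -
      have m: "fst v \<in> V1" "snd v \<in> V2" using V12 v by auto
      have "\<bar>d v\<bar> \<le> C1 * norm (fst v) + C2 * norm (snd v)" using C1[OF m(1)] C2[OF m(2)] by (simp add: d(1))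
      also have "\<dots> \<le> \<bar>C1\<bar> * norm (fst v) + \<bar>C2\<bar> * norm (snd v)" by (intro add_mono mult_right_mono) auto
      also have "\<dots> \<le> \<bar>C1\<bar> * norm v + \<bar>C2\<bar> * norm v"
        using norm_fst_le[of "fst v" "snd v"] norm_snd_le[of "snd v" "fst v"] by (intro add_mono mult_left_mono) auto
      finally show ?thesis by (simp add: algebra_simps)
    qed
    moreover have "d (a *\<^sub>R x + b *\<^sub>R y) = a * d x + b * d y" if "x \<in> V" "y \<in> V" for x y a b
    proof -
      have "fst x \<in> V1" "snd x \<in> V2" "fst y \<in> V1" "snd y \<in> V2" using V12 that by auto
      then show ?thesis using l1 l2 by (simp add: d(1) algebra_simps)
    qed
    ultimately show "bdd_lin_on V d" unfolding bdd_lin_on_def by blast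
  next
    fix f and \<epsilon> :: real assume f: "bdd_lin_on V f" and \<epsilon>: "\<epsilon> > 0"
    \<comment> \<open>\<open>V\<close> need not contain \<open>(x, 0)\<close> along with
      \<open>(x, y)\<close>, so \<open>f\<close> must first be extended before partial functionals
      make sense.\<close>
    obtain l :: "('a \<times> 'b) \<Rightarrow>\<^sub>L real" where l: "\<And>y. y \<in> V \<Longrightarrow> blinfun_apply l y = f y"
      using bdd_lin_on_extend[OF V(1) f] by blast
    have nb: "\<bar>blinfun_apply l y\<bar> \<le> norm l * norm y" for y using norm_blinfun[of l y] by simp
    have 1: "bdd_lin_on V1 (\<lambda>x. l (x, 0))" unfolding bdd_lin_on_def
    proof (intro conjI ballI allI exI)
      fix x y a b
      show "l (a *\<^sub>R x + b *\<^sub>R y, 0) = a * l (x, 0) + b * l (y, 0)"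
        using blinfun.add_right[of l "a *\<^sub>R (x, 0)" "b *\<^sub>R (y, 0)"]
          blinfun.scaleR_right[of l a "(x, 0)"] blinfun.scaleR_right[of l b "(y, 0)"] by simp
    next
      fix y show "\<bar>l (y, 0)\<bar> \<le> norm l * norm y" using nb[of "(y, 0)"] by (simp add: norm_Pair)
    qed
    have 2: "bdd_lin_on V2 (\<lambda>x. l (0, x))" unfolding bdd_lin_on_def
    proof (intro conjI ballI allI exI)
      fix x y a b
      show "l (0, a *\<^sub>R x + b *\<^sub>R y) = a * l (0, x) + b * l (0, y)"
        using blinfun.add_right[of l "a *\<^sub>R (0, x)" "b *\<^sub>R (0, y)"]
          blinfun.scaleR_right[of l a "(0, x)"] blinfun.scaleR_right[of l b "(0, y)"] by simp
    next
      fix y show "\<bar>l (0, y)\<bar> \<le> norm l * norm y" using nb[of "(0, y)"] by (simp add: norm_Pair)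
    qed
    obtain d1 where d1: "d1 \<in> D1" "\<And>y. y \<in> V1 \<Longrightarrow> \<bar>l (y, 0) - d1 y\<bar> \<le> (\<epsilon>/2) * norm y"
      using D1(3)[rule_format, OF 1, of "\<epsilon>/2"] \<epsilon> by auto
    obtain d2 where d2: "d2 \<in> D2" "\<And>y. y \<in> V2 \<Longrightarrow> \<bar>l (0, y) - d2 y\<bar> \<le> (\<epsilon>/2) * norm y"
      using D2(3)[rule_format, OF 2, of "\<epsilon>/2"] \<epsilon> by auto
    show "\<exists>d\<in>D. \<forall>y\<in>V. \<bar>f y - d y\<bar> \<le> \<epsilon> * norm y"
    proof (intro bexI[of _ "\<lambda>v. d1 (fst v) + d2 (snd v)"] ballI)
      fix v assume v: "v \<in> V"
      have m: "fst v \<in> V1" "snd v \<in> V2" using V12 v by auto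
      have "f v = l (fst v, 0) + l (0, snd v)"
        using l[OF v] blinfun.add_right[of l "(fst v, 0)" "(0, snd v)"] by simp
      then have "\<bar>f v - (d1 (fst v) + d2 (snd v))\<bar> \<le> (\<epsilon>/2) * norm (fst v) + (\<epsilon>/2) * norm (snd v)"
        using d1(2)[OF m(1)] d2(2)[OF m(2)] by linarith
      also have "\<dots> \<le> (\<epsilon>/2) * norm v + (\<epsilon>/2) * norm v"
        using norm_fst_le[of "fst v" "snd v"] norm_snd_le[of "snd v" "fst v"] \<epsilon> by (intro add_mono mult_left_mono) auto
      finally show "\<bar>f v - (d1 (fst v) + d2 (snd v))\<bar> \<le> \<epsilon> * norm v" by simp
    qed (use d1 d2 in \<open>auto simp: D_def\<close>)
  qed
qed

section \<open>Weak* sequential compactness\<close>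

lemma blinfun_pointwise_limit:
  fixes f :: "nat \<Rightarrow> 'a::real_normed_vector \<Rightarrow>\<^sub>L real"
  assumes B: "\<And>n. norm (f n) \<le> B" and conv: "\<And>v. convergent (\<lambda>n. blinfun_apply (f n) v)"
  obtains l :: "'a \<Rightarrow>\<^sub>L real" where "norm l \<le> B" "\<And>v. (\<lambda>n. blinfun_apply (f n) v) \<longlonglongrightarrow> blinfun_apply l v"
proof -
  obtain g where g: "\<And>v. (\<lambda>n. blinfun_apply (f n) v) \<longlonglongrightarrow> g v"
    using conv unfolding convergent_def by metis
  have B0: "B \<ge> 0" using B[of 0] norm_ge_zero[of "f 0"] by linarith
  have bd: "norm (g v) \<le> norm v * B" for v
  proof (rule LIMSEQ_le_const2[OF tendsto_norm[OF g]], intro exI allI impI)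
    fix n show "norm (blinfun_apply (f n) v) \<le> norm v * B"
      using norm_blinfun[of "f n" v] mult_left_mono[OF B[of n], of "norm v"] by (simp add: mult.commute)
  qed
  have bl: "bounded_linear g"
  proof (rule bounded_linear_intro[OF _ _ bd])
    fix x y
    show "g (x + y) = g x + g y"
      using LIMSEQ_unique[OF g[of "x + y"]] tendsto_add[OF g[of x] g[of y]] by (simp add: blinfun.add_right)
  next
    fix t x
    show "g (t *\<^sub>R x) = t *\<^sub>R g x"
      using LIMSEQ_unique[OF g[of "t *\<^sub>R x"]] tendsto_scaleR[OF tendsto_const[of t] g[of x]]
      by (simp add: blinfun.scaleR_right)
  qed
  show ?thesis
  proof (rule that[of "Blinfun g"])
    show "norm (Blinfun g) \<le> B"
      using bd B0 by (intro norm_blinfun_bound) (auto simp: bounded_linear_Blinfun_apply[OF bl] mult.commute)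
  qed (use g in \<open>simp add: bounded_linear_Blinfun_apply[OF bl]\<close>)
qed

lemma uncountable_nat_bool: "uncountable (UNIV :: (nat \<Rightarrow> bool) set)"
proof
  assume "countable (UNIV :: (nat \<Rightarrow> bool) set)"
  then obtain h :: "nat \<Rightarrow> nat \<Rightarrow> bool" where h: "range h = UNIV"
    by (metis UNIV_not_empty uncountable_def)
  then obtain n where "h n = (\<lambda>k. \<not> h k k)" by (metis UNIV_I imageE)
  then have "h n n = (\<not> h n n)" by (rule fun_cong)
  then show False by simp
qed

context
  fixes f :: "nat \<Rightarrow> 'a::banach \<Rightarrow>\<^sub>L real"
begin

section \<open>Oscillation of a sequence of functionals on the unit ball\<close>

text \<open>Non-convergence at \<open>x\<close> made quantitative: a strip of width
  \<open>\<epsilon>\<close> is jumped infinitely often. Excluding it for all \<open>x\<close> and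
  \<open>c\<close> at once at a fixed scale is what can be achieved by passing to a subset of the
  indices.\<close>

definition oscillates :: "nat set \<Rightarrow> real \<Rightarrow> 'a \<Rightarrow> real \<Rightarrow> bool" where
  "oscillates A \<epsilon> x c \<longleftrightarrow> norm x \<le> 1 \<and>
     infinite {n\<in>A. blinfun_apply (f n) x > c + \<epsilon>} \<and> infinite {n\<in>A. blinfun_apply (f n) x < c}"

lemma oscillates_mono: "oscillates A \<epsilon> x c \<Longrightarrow> A \<subseteq> A' \<Longrightarrow> \<epsilon>' \<le> \<epsilon> \<Longrightarrow> oscillates A' \<epsilon>' x c"
  unfolding oscillates_def
  by (smt (verit) Collect_mono_iff infinite_super subsetD)

lemma convergent_if_not_oscillates:
  assumes B: "\<And>n. norm (f n) \<le> B" and r: "strict_mono r"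
    and no: "\<And>\<epsilon> x c. \<epsilon> > 0 \<Longrightarrow> \<exists>k. \<not> oscillates (r ` {k..}) \<epsilon> x c"
    and x: "norm x \<le> 1"
  shows "convergent (\<lambda>n. blinfun_apply (f (r n)) x)"
proof -
  define a where "a = (\<lambda>n. blinfun_apply (f (r n)) x)"
  have aB: "\<bar>a n\<bar> \<le> B" for n
    using norm_blinfun[of "f (r n)" x] B[of "r n"] mult_mono[of "norm (f (r n))" B "norm x" 1] x
    by (simp add: a_def) (smt (verit) norm_ge_zero)
  \<comment> \<open>The infimum of the eventual upper bounds is the limit superior of
    \<open>a\<close>.\<close>
  define S where "S = {c. \<forall>\<^sub>F n in sequentially. a n \<le> c}"
  have "B \<in> S" using aB by (auto simp: S_def abs_le_iff intro!: always_eventually)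
  have lb: "- B \<le> c" if cS: "c \<in> S" for c
  proof -
    obtain n where "a n \<le> c" using cS unfolding S_def eventually_sequentially by blast
    with aB[of n] show ?thesis by linarith
  qed
  then have bdd: "bdd_below S" by (rule bdd_belowI)
  define l where "l = Inf S"
  have inf: "infinite {n \<in> r ` {k..}. P (blinfun_apply (f n) x)}" if "\<exists>\<^sub>F n in sequentially. P (a n)" for P k
  proof
    assume "finite {n \<in> r ` {k..}. P (blinfun_apply (f n) x)}"
    moreover have "r ` {n. n \<ge> k \<and> P (a n)} \<subseteq> {n \<in> r ` {k..}. P (blinfun_apply (f n) x)}"
      by (auto simp: a_def)
    ultimately have "finite (r ` {n. n \<ge> k \<and> P (a n)})" using finite_subset by blast
    then have "finite {n. n \<ge> k \<and> P (a n)}"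
      using strict_mono_imp_inj_on[OF r] by (metis finite_imageD inj_on_subset subset_UNIV)
    then obtain m where "\<And>n. n \<in> {n. n \<ge> k \<and> P (a n)} \<Longrightarrow> n < m" by (metis finite_nat_set_iff_bounded)
    then have "\<forall>\<^sub>F n in sequentially. \<not> P (a n)"
      unfolding eventually_sequentially by (intro exI[of _ "max k m"]) (auto, meson leD)
    with that show False by (simp add: frequently_def)
  qed
  have "a \<longlonglongrightarrow> l"
  proof (rule order_tendstoI)
    fix c assume "l < c"
    then obtain d where "d \<in> S" "d < c" using \<open>B \<in> S\<close> bdd cInf_lessD[of S c] by (auto simp: l_def)
    then show "\<forall>\<^sub>F n in sequentially. a n < c" by (auto simp: S_def elim!: eventually_mono)
  next
    fix c assume c: "c < l"
    \<comment> \<open>Thirds: \<open>a\<close> exceeds \<open>l - \<epsilon>\<close> infinitely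
      often, so non-oscillation with threshold \<open>l - 2 * \<epsilon>\<close> forbids dropping
      below this threshold infinitely often, and the threshold still exceeds
      \<open>c\<close>.\<close>
    define \<epsilon> where "\<epsilon> = (l - c) / 3"
    have e: "\<epsilon> > 0" using c by (simp add: \<epsilon>_def)
    have "l - \<epsilon> \<notin> S" using cInf_lower[OF _ bdd, of "l - \<epsilon>"] e by (auto simp: l_def)
    then have 1: "\<exists>\<^sub>F n in sequentially. a n > l - \<epsilon>"
      by (simp add: S_def frequently_def not_less)
    obtain k where k: "\<not> oscillates (r ` {k..}) \<epsilon> x (l - 2 * \<epsilon>)" using no[OF e] by blast
    have "\<not> (\<exists>\<^sub>F n in sequentially. a n < l - 2 * \<epsilon>)"
      using k inf[OF 1, of k] inf[of "\<lambda>t. t < l - 2 * \<epsilon>" k] x by (auto simp: oscillates_def)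
    then have "\<forall>\<^sub>F n in sequentially. a n \<ge> l - 2 * \<epsilon>" by (simp add: frequently_def not_less)
    moreover have "c < l - 2 * \<epsilon>" using c by (simp add: \<epsilon>_def field_simps)
    ultimately show "\<forall>\<^sub>F n in sequentially. c < a n" by (auto elim!: eventually_mono)
  qed
  then show ?thesis by (auto simp: convergent_def a_def)
qed

text \<open>If every infinite subset of \<open>A0\<close> oscillates, splitting repeatedly yields a dyadic tree of
  subsets; its branches give an uncountable \<open>\<epsilon>\<close>-separated family of functionals on one separable subspace.\<close>

lemma exists_not_oscillates:
  assumes asp: "asplund TYPE('a)" and B: "\<And>n. norm (f n) \<le> B" and A0: "infinite A0" and e: "\<epsilon> > 0"
  shows "\<exists>A\<subseteq>A0. infinite A \<and> (\<forall>x c. \<not> oscillates A \<epsilon> x c)"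
proof (rule ccontr)
  assume "\<not> ?thesis"
  then have "\<exists>x c. oscillates A \<epsilon> x c" if "A \<subseteq> A0" "infinite A" for A using that by blast
  then obtain X c where Xc: "\<And>A. A \<subseteq> A0 \<Longrightarrow> infinite A \<Longrightarrow> oscillates A \<epsilon> (X A) (c A)" by metis
  define half where "half = (\<lambda>b A. if b then {n\<in>A. blinfun_apply (f n) (X A) > c A + \<epsilon>}
                                   else {n\<in>A. blinfun_apply (f n) (X A) < c A})"
  define node where "node = (\<lambda>s. foldr half s A0)"
  have node: "node s \<subseteq> A0 \<and> infinite (node s)" for s
  proof (induction s)
    case (Cons b s)
    have "half b (node s) \<subseteq> node s" by (auto simp: half_def)
    moreover have "infinite (half b (node s))"
      using Xc[of "node s"] Cons by (cases b) (auto simp: half_def oscillates_def)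
    ultimately show ?case using Cons by (auto simp: node_def)
  qed (simp add: node_def A0)
  have X1: "norm (X (node s)) \<le> 1" for s using Xc node by (auto simp: oscillates_def)
  have "countable (range (\<lambda>s. X (node s)))" by simp
  then obtain V where V: "subspace V" "closed V" "separable_set V" "range (\<lambda>s. X (node s)) \<subseteq> V"
    by (rule separable_closed_subspace)
  then have "separable_dual V" using asp by (auto simp: asplund_def)
  then obtain D where D: "countable D" "\<forall>d\<in>D. bdd_lin_on V d"
    "\<forall>f. bdd_lin_on V f \<longrightarrow> (\<forall>\<epsilon>>0. \<exists>d\<in>D. \<forall>y\<in>V. \<bar>f y - d y\<bar> \<le> \<epsilon> * norm y)"
    by (rule separable_dualE)
  \<comment> \<open>\<open>foldr\<close> applies the head last, so the most recent decision must
    stand first; hence the reversal.\<close>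
  define path where "path = (\<lambda>(\<beta> :: nat \<Rightarrow> bool) k. rev (map \<beta> [0..<k]))"
  have path_Suc: "path \<beta> (Suc k) = \<beta> k # path \<beta> k" for \<beta> k by (simp add: path_def)
  have path_dec: "node (path \<beta> m) \<subseteq> node (path \<beta> k)" if "k \<le> m" for \<beta> k m
    using that by (induction rule: dec_induct) (auto simp: path_Suc node_def half_def split: if_splits)
  have "\<exists>g :: 'a \<Rightarrow>\<^sub>L real. \<forall>k. (\<beta> k \<longrightarrow> g (X (node (path \<beta> k))) \<ge> c (node (path \<beta> k)) + \<epsilon>) \<and>
                (\<not> \<beta> k \<longrightarrow> g (X (node (path \<beta> k))) \<le> c (node (path \<beta> k)))" for \<beta>
  proof -
    define N where "N = (\<lambda>k. node (path \<beta> k))"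
    \<comment> \<open>One atom per decision of the branch \<open>\<beta>\<close>; a lower bound on
      \<open>g\<close> is written as an upper bound at the negated vector.\<close>
    define atm where "atm = (\<lambda>k. if \<beta> k then (- X (N k), - (c (N k) + \<epsilon>)) else (X (N k), c (N k)))"
    \<comment> \<open>A hull point involves finitely many decisions. All of them are met by a single
      \<open>f n\<close> with \<open>n\<close> in a deep enough node, and this \<open>f n\<close>
      has norm at most \<open>B\<close>.\<close>
    have pos: "0 \<le> t + max 0 B * norm v" if vt: "(v, t) \<in> convex hull (range atm)" for v t
    proof -
      obtain S where S: "finite S" "S \<subseteq> range atm" "(v, t) \<in> convex hull S"
        using vt unfolding convex_hull_explicit by blast
      obtain I where I: "finite I" "S = atm ` I" using finite_subset_image[OF S(1,2)] by blast
      define m where "m = Suc (Max (insert 0 I))"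
      have m: "Suc k \<le> m" if "k \<in> I" for k using that I(1) by (simp add: m_def)
      have "node (path \<beta> m) \<noteq> {}" using node[of "path \<beta> m"] by auto
      then obtain n where n: "n \<in> node (path \<beta> m)" by blast
      have "blinfun_apply (f n) (fst (atm k)) \<le> snd (atm k)" if "k \<in> I" for k
      proof -
        have "n \<in> node (path \<beta> (Suc k))" using path_dec[OF m[OF that]] n by blast
        then have "n \<in> half (\<beta> k) (N k)" by (simp add: path_Suc node_def N_def)
        then show ?thesis by (auto simp: half_def atm_def blinfun.minus_right split: if_splits)
      qed
      then have "S \<subseteq> {a. blinfun_apply (f n) (fst a) \<le> snd a}" using I by auto
      moreover have "convex {a. blinfun_apply (f n) (fst a) \<le> snd a}"
        by (auto simp: convex_def blinfun.add_right blinfun.scaleR_right intro!: add_mono mult_left_mono)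
      ultimately have "blinfun_apply (f n) v \<le> t" using S(3) hull_minimal by fastforce
      moreover have "- (max 0 B * norm v) \<le> blinfun_apply (f n) v"
        using norm_blinfun[of "f n" v] mult_right_mono[of "norm (f n)" "max 0 B" "norm v"] B[of n]
        unfolding real_norm_def by (smt (verit) norm_ge_zero)
      ultimately show ?thesis by linarith
    qed
    obtain g :: "'a \<Rightarrow>\<^sub>L real" where g: "\<And>v t. (v, t) \<in> range atm \<Longrightarrow> blinfun_apply g v \<le> t"
      using functional_below_atoms[OF max.cobounded1 pos] by blast
    have "\<forall>k. blinfun_apply g (fst (atm k)) \<le> snd (atm k)" using g by simp
    then have "(\<beta> k \<longrightarrow> g (X (N k)) \<ge> c (N k) + \<epsilon>) \<and> (\<not> \<beta> k \<longrightarrow> g (X (N k)) \<le> c (N k))" for k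
      by (cases "\<beta> k") (auto simp: atm_def blinfun.minus_right dest: spec[of _ k])
    then show ?thesis unfolding N_def by blast
  qed
  then obtain g :: "(nat \<Rightarrow> bool) \<Rightarrow> 'a \<Rightarrow>\<^sub>L real" where
    g1: "\<And>\<beta> k. \<beta> k \<Longrightarrow> g \<beta> (X (node (path \<beta> k))) \<ge> c (node (path \<beta> k)) + \<epsilon>" and
    g2: "\<And>\<beta> k. \<not> \<beta> k \<Longrightarrow> g \<beta> (X (node (path \<beta> k))) \<le> c (node (path \<beta> k))" by metis
  have "bdd_lin_on V (g \<beta>)" for \<beta>
    unfolding bdd_lin_on_def using norm_blinfun[of "g \<beta>"]
    by (auto simp: blinfun.add_right blinfun.scaleR_right)
  \<comment> \<open>Two branches sharing an approximant within \<open>\<epsilon>/3\<close> could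
    differ by at most \<open>2 * \<epsilon>/3\<close> on the unit ball, less than the separation
    \<open>\<epsilon>\<close>.\<close>
  then have "\<exists>d\<in>D. \<forall>y\<in>V. \<bar>g \<beta> y - d y\<bar> \<le> (\<epsilon>/3) * norm y" for \<beta> using D(3) e by (meson divide_pos_pos zero_less_numeral)
  then obtain d where d: "\<And>\<beta>. d \<beta> \<in> D" "\<And>\<beta> y. y \<in> V \<Longrightarrow> \<bar>g \<beta> y - d \<beta> y\<bar> \<le> (\<epsilon>/3) * norm y" by metis
  have "inj d"
  proof (rule injI, rule ccontr)
    fix \<beta> \<gamma> assume dd: "d \<beta> = d \<gamma>" and ne: "\<beta> \<noteq> \<gamma>"
    \<comment> \<open>Up to the first disagreement the branches visit the same nodes, so there they
      use the same test vector and the same threshold, from opposite sides.\<close>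
    define k where "k = (LEAST k. \<beta> k \<noteq> \<gamma> k)"
    have k: "\<beta> k \<noteq> \<gamma> k" unfolding k_def by (rule LeastI_ex) (use ne in auto)
    have "\<beta> j = \<gamma> j" if "j < k" for j using not_less_Least[of j "\<lambda>k. \<beta> k \<noteq> \<gamma> k"] that by (auto simp: k_def)
    then have p: "path \<beta> k = path \<gamma> k" by (auto simp: path_def)
    define x where "x = X (node (path \<beta> k))"
    have "x \<in> V" "norm x \<le> 1" using V(4) X1 by (auto simp: x_def)
    then have "(\<epsilon>/3) * norm x \<le> \<epsilon>/3" using mult_left_mono[of "norm x" 1 "\<epsilon>/3"] e by simp
    then have "\<bar>g \<beta> x - d \<beta> x\<bar> \<le> \<epsilon>/3" "\<bar>g \<gamma> x - d \<gamma> x\<bar> \<le> \<epsilon>/3"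
      using d(2)[OF \<open>x \<in> V\<close>, of \<beta>] d(2)[OF \<open>x \<in> V\<close>, of \<gamma>] by linarith+
    then have "\<bar>g \<beta> x - g \<gamma> x\<bar> < \<epsilon>" using e unfolding dd by linarith
    moreover have "\<bar>g \<beta> x - g \<gamma> x\<bar> \<ge> \<epsilon>"
    proof (cases "\<beta> k")
      case True
      then show ?thesis using k g1[of \<beta> k] g2[of \<gamma> k] p by (simp add: x_def)
    next
      case False
      then show ?thesis using k g1[of \<gamma> k] g2[of \<beta> k] p by (simp add: x_def)
    qed
    ultimately show False by simp
  qed
  moreover have "countable (range d)" using d(1) D(1) by (metis countable_subset image_subsetI)
  ultimately show False using uncountable_nat_bool by (metis countable_image_inj_eq)
qed

end

text \<open>A diagonal extraction over the scales \<open>1 / (n + 1)\<close>: the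
  \<open>n\<close>-th refinement removes oscillation at its scale, the tails of the diagonal
  sequence inherit this, and so it converges at every vector of the unit ball.\<close>

theorem asplund_weak_star_sequentially_compact:
  fixes f :: "nat \<Rightarrow> 'a::banach \<Rightarrow>\<^sub>L real"
  assumes asp: "asplund TYPE('a)" and B: "\<And>n. norm (f n) \<le> B"
  obtains r :: "nat \<Rightarrow> nat" and l :: "'a \<Rightarrow>\<^sub>L real" where "strict_mono r" "norm l \<le> B"
    "\<forall>v. (\<lambda>n. blinfun_apply (f (r n)) v) \<longlonglongrightarrow> blinfun_apply l v"
proof -
  define P where "P = (\<lambda>n (s :: nat \<Rightarrow> nat). \<forall>x c. \<not> oscillates f (range s) (inverse (real (Suc n))) x c)"
  interpret subseqs P
  proof
    fix n and s :: "nat \<Rightarrow> nat" assume s: "strict_mono s"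
    then have "infinite (range s)" by (simp add: range_inj_infinite strict_mono_imp_inj_on)
    then obtain A where A: "A \<subseteq> range s" "infinite A" "\<And>x c. \<not> oscillates f A (inverse (real (Suc n))) x c"
      using exists_not_oscillates[of f B "range s" "inverse (real (Suc n))", OF asp B] by (auto simp del: of_nat_Suc)
    have "A = s ` (s -` A)" using A(1) by auto
    then have inf: "infinite (s -` A)" using A(2) by (metis finite_imageI)
    have "range (s \<circ> enumerate (s -` A)) = s ` (s -` A)"
      by (simp only: image_comp[symmetric] range_enumerate[OF inf])
    then have "range (s \<circ> enumerate (s -` A)) = A" using A(1) by auto
    then show "\<exists>r'. strict_mono r' \<and> P n (s \<circ> r')"
      using A(3) strict_mono_enumerate[OF inf] by (auto simp: P_def)
  qed
  have no: "\<exists>k. \<not> oscillates f (diagseq ` {k..}) \<epsilon> x c" if e: "\<epsilon> > 0" for \<epsilon> x c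
  proof -
    obtain k where k: "inverse (real (Suc k)) < \<epsilon>" using reals_Archimedean[OF e] by blast
    \<comment> \<open>Only the part of the diagonal from index \<open>Suc k\<close> on is a
      subsequence of the \<open>k\<close>-th refinement; this is why non-oscillation is asked of
      tails.\<close>
    have "P k (diagseq \<circ> ((+) (Suc k)))"
    proof (rule diagseq_holds)
      fix r s n assume "P n s"
      then show "P n (s \<circ> r)" unfolding P_def using oscillates_mono[of f "range (s \<circ> r)" _ _ _ "range s"] by fastforce
    qed
    moreover have "range (diagseq \<circ> ((+) (Suc k))) = diagseq ` {Suc k..}"
      by (force simp: le_iff_add)
    ultimately have "\<not> oscillates f (diagseq ` {Suc k..}) (inverse (real (Suc k))) x c" by (simp add: P_def)
    then show ?thesis using oscillates_mono[of f "diagseq ` {Suc k..}" \<epsilon> x c] k by (meson less_imp_le order_refl)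
  qed
  have conv1: "convergent (\<lambda>n. blinfun_apply (f (diagseq n)) x)" if "norm x \<le> 1" for x
    using convergent_if_not_oscillates[OF B subseq_diagseq no that] .
  have conv: "convergent (\<lambda>n. blinfun_apply (f (diagseq n)) x)" for x
  proof (cases "x = 0")
    case False
    have "convergent (\<lambda>n. norm x * blinfun_apply (f (diagseq n)) (x /\<^sub>R norm x))"
      using False by (intro convergent_mult convergent_const conv1) simp
    then show ?thesis using False by (simp add: blinfun.scaleR_right mult.assoc[symmetric])
  qed (simp add: convergent_const)
  obtain l :: "'a \<Rightarrow>\<^sub>L real" where "norm l \<le> B" "\<And>v. (\<lambda>n. blinfun_apply (f (diagseq n)) v) \<longlonglongrightarrow> l v"
    using blinfun_pointwise_limit[of "\<lambda>n. f (diagseq n)" B] B conv by blast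
  then show ?thesis using that subseq_diagseq by blast
qed

section \<open>A smooth bump on spaces with separable dual\<close>

abbreviation linear_on_set :: "'a::real_vector set \<Rightarrow> ('a \<Rightarrow> real) \<Rightarrow> bool" where
  "linear_on_set V f \<equiv> \<forall>x\<in>V. \<forall>y\<in>V. \<forall>a b. f (a *\<^sub>R x + b *\<^sub>R y) = a * f x + b * f y"

text \<open>Only the upper half of differentiability is recorded. If \<open>\<Phi> + g\<close> is
  minimal at \<open>w\<close>, an upper estimate of \<open>g\<close> already gives a lower estimate
  of \<open>\<Phi>\<close>, with subgradient \<open>- f\<close>.\<close>

abbreviation superdiff_on :: "'a::real_normed_vector set \<Rightarrow> ('a \<Rightarrow> real) \<Rightarrow> 'a \<Rightarrow> ('a \<Rightarrow> real) \<Rightarrow> bool" where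
  "superdiff_on V \<phi> v f \<equiv> \<forall>\<eta>>0. \<exists>\<delta>>0. \<forall>h\<in>V. norm h < \<delta> \<longrightarrow> \<phi> (v + h) \<le> \<phi> v + f h + \<eta> * norm h"

locale dense_dual =
  fixes V :: "'a::real_normed_vector set" and d :: "nat \<Rightarrow> 'a \<Rightarrow> real" and c :: "nat \<Rightarrow> real" and e :: "nat \<Rightarrow> 'a"
  assumes V: "subspace V"
    and d_lin: "\<And>n x y a b. x \<in> V \<Longrightarrow> y \<in> V \<Longrightarrow> d n (a *\<^sub>R x + b *\<^sub>R y) = a * d n x + b * d n y"
    and d_bdd: "\<And>n v. v \<in> V \<Longrightarrow> \<bar>d n v\<bar> \<le> c n * norm v"
    and c_nonneg: "\<And>n. c n \<ge> 0"
    and d_dense: "\<And>f \<epsilon>. bdd_lin_on V f \<Longrightarrow> \<epsilon> > 0 \<Longrightarrow> \<exists>n. \<forall>v\<in>V. \<bar>f v - d n v\<bar> \<le> \<epsilon> * norm v"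
    and e_V: "\<And>n. e n \<in> V" and e_dense: "V \<subseteq> closure (range e)"
begin

text \<open>This is the dual unit ball of \<open>V\<close>. Its elements are total functions on the
  type, but only their values on \<open>V\<close> matter.\<close>

definition F :: "('a \<Rightarrow> real) set" where
  "F = {f. linear_on_set V f \<and> (\<forall>v\<in>V. \<bar>f v\<bar> \<le> norm v)}"

lemma F_lin: "f \<in> F \<Longrightarrow> x \<in> V \<Longrightarrow> y \<in> V \<Longrightarrow> f (a *\<^sub>R x + b *\<^sub>R y) = a * f x + b * f y"
  and F_bdd: "f \<in> F \<Longrightarrow> v \<in> V \<Longrightarrow> \<bar>f v\<bar> \<le> norm v"
  by (auto simp: F_def)

lemma F_add: "f \<in> F \<Longrightarrow> x \<in> V \<Longrightarrow> y \<in> V \<Longrightarrow> f (x + y) = f x + f y"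
  using F_lin[of f x y 1 1] by simp

lemma F_diff: "f \<in> F \<Longrightarrow> x \<in> V \<Longrightarrow> y \<in> V \<Longrightarrow> f (x - y) = f x - f y"
  using F_lin[of f x y 1 "-1"] by simp

lemma F_bdd_lin: "f \<in> F \<Longrightarrow> bdd_lin_on V f"
  unfolding bdd_lin_on_def F_def by (auto intro!: exI[of _ 1])

lemma zero_F: "(\<lambda>_. 0) \<in> F" by (simp add: F_def)

lemma minus_F: "f \<in> F \<Longrightarrow> (\<lambda>v. - f v) \<in> F" by (auto simp: F_def)

lemma mid_F:
  assumes f: "f \<in> F" and g: "g \<in> F"
  shows "(\<lambda>v. (f v + g v) / 2) \<in> F"
  unfolding F_def
proof (intro CollectI conjI ballI allI)
  fix x y a b assume "x \<in> V" "y \<in> V"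
  then show "(f (a *\<^sub>R x + b *\<^sub>R y) + g (a *\<^sub>R x + b *\<^sub>R y)) / 2 = a * ((f x + g x) / 2) + b * ((f y + g y) / 2)"
    using F_lin[OF f, of x y a b] F_lin[OF g, of x y a b] by (simp add: field_simps)
next
  fix v assume v: "v \<in> V"
  show "\<bar>(f v + g v) / 2\<bar> \<le> norm v" using F_bdd[OF f v] F_bdd[OF g v] by (simp add: abs_le_iff)
qed

section \<open>Squared distances to the dense sequence and their midpoint deficit\<close>

definition U :: "'a set" where "U = {v\<in>V. norm v \<le> 1}"

text \<open>Only the signs \<open>s = 1\<close> and \<open>s = -1\<close> are used; taking both makes \<open>\<theta>\<close> below an even function.\<close>

definition q :: "real \<Rightarrow> nat \<Rightarrow> ('a \<Rightarrow> real) \<Rightarrow> real" where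
  "q s n f = (SUP v\<in>U. \<bar>f v - s * d n v\<bar>)"

lemma zero_U: "0 \<in> U" using V by (auto simp: U_def subspace_0)

lemma q_bound1:
  assumes "f \<in> F" "v \<in> U" "\<bar>s\<bar> = 1" shows "\<bar>f v - s * d n v\<bar> \<le> 1 + c n"
proof -
  have v: "v \<in> V" "norm v \<le> 1" using assms by (auto simp: U_def)
  have "\<bar>d n v\<bar> \<le> c n" using d_bdd[OF v(1), of n] mult_left_mono[OF v(2) c_nonneg, of n] by simp
  moreover have "\<bar>s * d n v\<bar> = \<bar>d n v\<bar>" using assms(3) by (simp add: abs_mult)
  ultimately show ?thesis using F_bdd[OF assms(1) v(1)] v(2) by linarith
qed

lemma q_upper: "f \<in> F \<Longrightarrow> v \<in> U \<Longrightarrow> \<bar>s\<bar> = 1 \<Longrightarrow> \<bar>f v - s * d n v\<bar> \<le> q s n f"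
  unfolding q_def using q_bound1 by (intro cSUP_upper bdd_aboveI2) auto

lemma q_least: "(\<And>v. v \<in> U \<Longrightarrow> \<bar>f v - s * d n v\<bar> \<le> a) \<Longrightarrow> q s n f \<le> a"
  unfolding q_def using zero_U by (intro cSUP_least) auto

lemma q_nonneg: "f \<in> F \<Longrightarrow> \<bar>s\<bar> = 1 \<Longrightarrow> 0 \<le> q s n f"
  using q_upper[OF _ zero_U, of f s n] abs_ge_zero order_trans by blast

lemma q_le: "f \<in> F \<Longrightarrow> \<bar>s\<bar> = 1 \<Longrightarrow> q s n f \<le> 1 + c n"
  using q_least q_bound1 by blast

lemma q_upper': assumes f: "f \<in> F" and v: "v \<in> V"
  shows "\<bar>f v - d n v\<bar> \<le> q 1 n f * norm v"
proof (cases "v = 0")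
  case True
  then show ?thesis using F_bdd[OF f v] d_bdd[OF v, of n] by simp
next
  case False
  define w where "w = (1 / norm v) *\<^sub>R v"
  have "w \<in> U" using v V False by (simp add: U_def w_def subspace_scale)
  then have "\<bar>f w - d n w\<bar> \<le> q 1 n f" using q_upper[OF f, of w 1 n] by simp
  moreover have "f w = f v / norm v" "d n w = d n v / norm v"
    using F_lin[OF f v v, of "1 / norm v" 0] d_lin[OF v v, of n "1 / norm v" 0] by (auto simp: w_def)
  ultimately have "\<bar>(f v - d n v) / norm v\<bar> \<le> q 1 n f" by (simp add: diff_divide_distrib)
  then show ?thesis using False by (simp add: abs_divide field_simps)
qed

lemma q_mid: assumes f: "f \<in> F" and g: "g \<in> F" and s: "\<bar>s\<bar> = 1"
  shows "q s n (\<lambda>v. (f v + g v) / 2) \<le> (q s n f + q s n g) / 2"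
proof (rule q_least)
  fix v assume "v \<in> U"
  then show "\<bar>(f v + g v) / 2 - s * d n v\<bar> \<le> (q s n f + q s n g) / 2"
    using q_upper[OF f _ s, of v n] q_upper[OF g _ s, of v n] by (simp add: abs_le_iff field_simps)
qed

lemma q_minus: assumes f: "f \<in> F" shows "q s n (\<lambda>v. - f v) = q (- s) n f"
proof -
  have "\<bar>- f v - s * d n v\<bar> = \<bar>f v - (- s) * d n v\<bar>" for v by simp
  then show ?thesis unfolding q_def by simp
qed

text \<open>Normalises \<open>\<tau> n\<close> to at most 1 on the dual ball, where both distances
  are at most \<open>1 + c n\<close> and the value at \<open>e n\<close> is at most
  \<open>norm (e n)\<close>; the final 1 avoids division by zero.\<close>

definition N :: "nat \<Rightarrow> real" where "N n = 2 * (1 + c n)\<^sup>2 + (norm (e n))\<^sup>2 + 1"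

text \<open>The distances will force norm closeness of near maximisers. The value at
  \<open>e n\<close> forces pointwise convergence of maximising sequences on a dense set.\<close>

definition \<tau> :: "nat \<Rightarrow> ('a \<Rightarrow> real) \<Rightarrow> real" where
  "\<tau> n f = ((q 1 n f)\<^sup>2 + (q (-1) n f)\<^sup>2 + (f (e n))\<^sup>2) / N n"

definition \<theta> :: "('a \<Rightarrow> real) \<Rightarrow> real" where "\<theta> f = (\<Sum>n. (1/2)^n * \<tau> n f)"

lemma N_pos: "N n > 0" by (simp add: N_def add_nonneg_pos)

lemma \<tau>_nonneg: "0 \<le> \<tau> n f" using N_pos[of n] by (simp add: \<tau>_def)

lemma \<tau>_le: assumes f: "f \<in> F" shows "\<tau> n f \<le> 1"
proof -
  have "(q 1 n f)\<^sup>2 \<le> (1 + c n)\<^sup>2" "(q (-1) n f)\<^sup>2 \<le> (1 + c n)\<^sup>2"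
    using q_le[OF f] q_nonneg[OF f] by (auto intro!: power_mono)
  moreover have "(f (e n))\<^sup>2 \<le> (norm (e n))\<^sup>2"
    using F_bdd[OF f e_V, of n] by (metis abs_norm_cancel abs_le_square_iff)
  ultimately show ?thesis using N_pos[of n] by (simp add: \<tau>_def N_def)
qed

text \<open>The amount by which the midpoint value must fall below the average: for a square, the
  deficit is a quarter of the squared difference.\<close>

definition gap :: "nat \<Rightarrow> ('a \<Rightarrow> real) \<Rightarrow> ('a \<Rightarrow> real) \<Rightarrow> real" where
  "gap n f g = ((q 1 n f - q 1 n g)\<^sup>2 + (q (-1) n f - q (-1) n g)\<^sup>2 + (f (e n) - g (e n))\<^sup>2) / (4 * N n)"

lemma gap_nonneg: "0 \<le> gap n f g" using N_pos[of n] by (simp add: gap_def)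

lemma \<tau>_mid: assumes f: "f \<in> F" and g: "g \<in> F"
  shows "\<tau> n (\<lambda>v. (f v + g v) / 2) \<le> \<tau> n f / 2 + \<tau> n g / 2 - gap n f g"
proof -
  have sq: "(q s n (\<lambda>v. (f v + g v) / 2))\<^sup>2 \<le> (q s n f)\<^sup>2 / 2 + (q s n g)\<^sup>2 / 2 - (q s n f - q s n g)\<^sup>2 / 4"
    if s: "\<bar>s\<bar> = 1" for s
  proof -
    have "(q s n (\<lambda>v. (f v + g v) / 2))\<^sup>2 \<le> ((q s n f + q s n g) / 2)\<^sup>2"
      using q_mid[OF f g s] q_nonneg[OF mid_F[OF f g] s] by (rule power_mono)
    also have "\<dots> = (q s n f)\<^sup>2 / 2 + (q s n g)\<^sup>2 / 2 - (q s n f - q s n g)\<^sup>2 / 4"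
      by (simp add: power2_eq_square field_simps)
    finally show ?thesis .
  qed
  have e: "((f (e n) + g (e n)) / 2)\<^sup>2 = (f (e n))\<^sup>2 / 2 + (g (e n))\<^sup>2 / 2 - (f (e n) - g (e n))\<^sup>2 / 4"
    by (simp add: power2_eq_square field_simps)
  have "\<tau> n (\<lambda>v. (f v + g v) / 2) \<le>
     ((q 1 n f)\<^sup>2 / 2 + (q 1 n g)\<^sup>2 / 2 - (q 1 n f - q 1 n g)\<^sup>2 / 4 +
     ((q (-1) n f)\<^sup>2 / 2 + (q (-1) n g)\<^sup>2 / 2 - (q (-1) n f - q (-1) n g)\<^sup>2 / 4) +
     ((f (e n))\<^sup>2 / 2 + (g (e n))\<^sup>2 / 2 - (f (e n) - g (e n))\<^sup>2 / 4)) / N n"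
    unfolding \<tau>_def using sq[of 1] sq[of "-1"] e N_pos[of n] by (intro divide_right_mono) auto
  also have "\<dots> = \<tau> n f / 2 + \<tau> n g / 2 - gap n f g"
    using N_pos[of n] by (simp add: \<tau>_def gap_def field_simps)
  finally show ?thesis .
qed

lemma \<theta>_summable: "f \<in> F \<Longrightarrow> summable (\<lambda>n. (1/2)^n * \<tau> n f)"
  by (rule summable_comparison_test'[OF summable_geometric[of "1/2::real"], of 0])
     (auto simp: \<tau>_nonneg \<tau>_le)

lemma \<theta>_nonneg: "f \<in> F \<Longrightarrow> 0 \<le> \<theta> f"
  unfolding \<theta>_def by (intro suminf_nonneg \<theta>_summable) (auto simp: \<tau>_nonneg)

lemma \<theta>_le: assumes f: "f \<in> F" shows "\<theta> f \<le> 2"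
proof -
  have "\<theta> f \<le> (\<Sum>n. (1/2::real)^n)"
    unfolding \<theta>_def by (intro suminf_le \<theta>_summable f summable_geometric) (auto simp: \<tau>_le f)
  also have "\<dots> = 2" using suminf_geometric[of "1/2::real"] by simp
  finally show ?thesis .
qed

text \<open>All terms of the series have a nonnegative midpoint deficit, so a single one can be kept
  and the others dropped.\<close>

lemma \<theta>_mid: assumes f: "f \<in> F" and g: "g \<in> F"
  shows "\<theta> (\<lambda>v. (f v + g v) / 2) + (1/2)^n * gap n f g \<le> (\<theta> f + \<theta> g) / 2"
proof -
  let ?m = "\<lambda>v. (f v + g v) / 2"
  let ?t = "\<lambda>k. (1/2)^k * (\<tau> k f / 2 + \<tau> k g / 2 - \<tau> k ?m)"
  have S: "?t sums (\<theta> f / 2 + \<theta> g / 2 - \<theta> ?m)"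
  proof -
    have "(\<lambda>k. ((1/2)^k * \<tau> k f) / 2 + ((1/2)^k * \<tau> k g) / 2 - (1/2)^k * \<tau> k ?m) sums (\<theta> f / 2 + \<theta> g / 2 - \<theta> ?m)"
      unfolding \<theta>_def
      by (intro sums_add sums_diff sums_divide summable_sums \<theta>_summable f g mid_F)
    then show ?thesis by (simp add: algebra_simps)
  qed
  have nn: "0 \<le> ?t k" for k using \<tau>_mid[OF f g, of k] gap_nonneg[of k f g] by simp
  have "(1/2)^n * gap n f g \<le> ?t n" using \<tau>_mid[OF f g, of n] by (intro mult_left_mono) auto
  also have "\<dots> = sum ?t {n}" by simp
  also have "\<dots> \<le> suminf ?t" using nn S by (intro sum_le_suminf) (auto simp: sums_iff)
  also have "\<dots> = \<theta> f / 2 + \<theta> g / 2 - \<theta> ?m" using S by (simp add: sums_iff)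
  finally show ?thesis by simp
qed

lemma \<theta>_minus: "f \<in> F \<Longrightarrow> \<theta> (\<lambda>v. - f v) = \<theta> f"
  unfolding \<theta>_def \<tau>_def by (simp add: q_minus add.commute)

text \<open>\<open>0\<close> is the midpoint of \<open>f\<close> and \<open>- f\<close>, where
  \<open>\<theta>\<close> takes equal values; this rests on the two signs in
  \<open>\<tau>\<close>.\<close>

lemma \<theta>_zero_le: assumes f: "f \<in> F" shows "\<theta> (\<lambda>_. 0) \<le> \<theta> f"
  using \<theta>_mid[OF f minus_F[OF f], of 0] gap_nonneg[of 0 f "\<lambda>v. - f v"] by (simp add: \<theta>_minus f)

section \<open>The conjugate function: attainment and one-sided differentiability\<close>

definition \<rho> :: "'a \<Rightarrow> real" where "\<rho> x = (SUP f\<in>F. f x - \<theta> f)"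

lemma \<rho>_bdd: assumes "x \<in> V" shows "bdd_above ((\<lambda>f. f x - \<theta> f) ` F)"
  using F_bdd[OF _ assms] \<theta>_nonneg by (intro bdd_aboveI2[of _ _ "norm x"]) (smt (verit))

lemma \<rho>_upper: "x \<in> V \<Longrightarrow> f \<in> F \<Longrightarrow> f x - \<theta> f \<le> \<rho> x"
  unfolding \<rho>_def by (intro cSUP_upper \<rho>_bdd)

lemma \<rho>_approx: assumes "x \<in> V" "\<epsilon> > 0" shows "\<exists>f\<in>F. \<rho> x - \<epsilon> < f x - \<theta> f"
  using assms less_cSUP_iff[OF _ \<rho>_bdd[OF assms(1)], of "\<rho> x - \<epsilon>"] zero_F by (auto simp: \<rho>_def)

lemma \<rho>_lipschitz: assumes x: "x \<in> V" and y: "y \<in> V" shows "\<rho> x \<le> \<rho> y + norm (x - y)"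
  unfolding \<rho>_def[of x]
proof (rule cSUP_least)
  fix f assume f: "f \<in> F"
  have "f x = f y + f (x - y)" using F_diff[OF f x y] by simp
  then show "f x - \<theta> f \<le> \<rho> y + norm (x - y)"
    using \<rho>_upper[OF y f] F_bdd[OF f subspace_diff[OF V x y]] by linarith
qed (use zero_F in auto)

text \<open>The midpoint of two near maximisers cannot beat the supremum, so its deficit is at most
  the tolerance.\<close>

lemma \<rho>_near_gap:
  assumes x: "x \<in> V" and f: "f \<in> F" "\<rho> x - \<epsilon> \<le> f x - \<theta> f" and g: "g \<in> F" "\<rho> x - \<epsilon> \<le> g x - \<theta> g"
  shows "(1/2)^n * gap n f g \<le> \<epsilon>"
proof -
  define t m where "t = (1/2)^n * gap n f g" and "m = \<theta> (\<lambda>v. (f v + g v) / 2)"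
  have "(f x + g x) / 2 - m \<le> \<rho> x" unfolding m_def by (rule \<rho>_upper[OF x mid_F[OF f(1) g(1)]])
  moreover have "m + t \<le> (\<theta> f + \<theta> g) / 2" unfolding t_def m_def by (rule \<theta>_mid[OF f(1) g(1)])
  ultimately have "t \<le> \<epsilon>" using f(2) g(2) by argo
  then show ?thesis by (simp add: t_def)
qed

text \<open>In the applications \<open>a\<close> is a difference of two distances or of two values
  at \<open>e n\<close>; one small gap controls all of them.\<close>

lemma gap_bounds:
  assumes "(1/2)^n * gap n f g \<le> \<epsilon>" and "a\<^sup>2 \<le> (q 1 n f - q 1 n g)\<^sup>2 + (q (-1) n f - q (-1) n g)\<^sup>2 + (f (e n) - g (e n))\<^sup>2"
  shows "\<bar>a\<bar> \<le> sqrt (\<epsilon> * (2^n * 4 * N n))"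
proof -
  have "gap n f g \<le> \<epsilon> * 2^n" using assms(1) by (simp add: power_one_over field_simps)
  then have "(q 1 n f - q 1 n g)\<^sup>2 + (q (-1) n f - q (-1) n g)\<^sup>2 + (f (e n) - g (e n))\<^sup>2 \<le> \<epsilon> * 2^n * (4 * N n)"
    unfolding gap_def using N_pos[of n] by (subst (asm) pos_divide_le_eq) auto
  then have "a\<^sup>2 \<le> \<epsilon> * (2^n * 4 * N n)" using assms(2) by (simp add: algebra_simps)
  then show ?thesis using real_sqrt_le_mono by fastforce
qed

text \<open>Along a maximising sequence every distance and every value at \<open>e n\<close> is
  Cauchy by \<open>\<rho>_near_gap\<close>. The pointwise limit is a maximiser, since
  \<open>\<theta>\<close> is lower semicontinuous along the sequence.\<close>

lemma \<rho>_attained: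
  assumes x: "x \<in> V"
  shows "\<exists>f\<in>F. \<rho> x \<le> f x - \<theta> f"
proof -
  have "\<exists>f\<in>F. \<rho> x - inverse (real (Suc k)) < f x - \<theta> f" for k
    using \<rho>_approx[OF x, of "inverse (real (Suc k))"] by simp
  then obtain g where g: "\<And>k. g k \<in> F" "\<And>k. \<rho> x - inverse (real (Suc k)) < g k x - \<theta> (g k)" by metis
  have near: "\<rho> x - inverse (real (Suc m)) \<le> g k x - \<theta> (g k)" if "m \<le> k" for m k
  proof -
    have "inverse (real (Suc k)) \<le> inverse (real (Suc m))" using that by (intro le_imp_inverse_le) auto
    then show ?thesis using g(2)[of k] by linarith
  qed
  have conv: "convergent (\<lambda>k. A (g k))"
    if A: "\<And>f h. (A f - A h)\<^sup>2 \<le> (q 1 n f - q 1 n h)\<^sup>2 + (q (-1) n f - q (-1) n h)\<^sup>2 + (f (e n) - h (e n))\<^sup>2" for A n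
  proof -
    have "Cauchy (\<lambda>k. A (g k))"
    proof (rule metric_CauchyI)
      fix \<eta> :: real assume \<eta>: "\<eta> > 0"
      have P: "2^n * 4 * N n > 0" using N_pos[of n] by simp
      obtain m where m: "inverse (real (Suc m)) < \<eta>\<^sup>2 / (2^n * 4 * N n)"
        using reals_Archimedean[of "\<eta>\<^sup>2 / (2^n * 4 * N n)"] P \<eta> by auto
      have "dist (A (g k)) (A (g j)) < \<eta>" if "k \<ge> m" "j \<ge> m" for k j
      proof -
        have "\<bar>A (g k) - A (g j)\<bar> \<le> sqrt (inverse (real (Suc m)) * (2^n * 4 * N n))"
          using near that by (intro gap_bounds[OF \<rho>_near_gap[OF x g(1) _ g(1)] A]) auto
        also have "\<dots> < sqrt (\<eta>\<^sup>2)"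
          using m P by (intro real_sqrt_less_mono) (simp add: pos_less_divide_eq)
        finally show ?thesis using \<eta> by (simp add: dist_real_def)
      qed
      then show "\<exists>M. \<forall>k\<ge>M. \<forall>j\<ge>M. dist (A (g k)) (A (g j)) < \<eta>" by blast
    qed
    then show ?thesis by (rule Cauchy_convergent)
  qed
  \<comment> \<open>Convergence spreads from the dense points \<open>e n\<close> to \<open>V\<close>
    because all functionals share the Lipschitz constant 1.\<close>
  have convV: "convergent (\<lambda>k. g k v)" if v: "v \<in> V" for v
  proof (rule Cauchy_convergent, rule metric_CauchyI)
    fix \<eta> :: real assume \<eta>: "\<eta> > 0"
    obtain n where n: "dist (e n) v < \<eta> / 4"
      using e_dense v \<eta> by (auto simp: closure_approachable subset_iff dest!: spec[of _ "\<eta> / 4"])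
    have "Cauchy (\<lambda>k. g k (e n))" using conv[of "\<lambda>f. f (e n)" n] convergent_Cauchy by auto
    then obtain M where M: "\<And>k j. k \<ge> M \<Longrightarrow> j \<ge> M \<Longrightarrow> dist (g k (e n)) (g j (e n)) < \<eta> / 2"
      using \<eta> metric_CauchyD[of _ "\<eta> / 2"] by (metis half_gt_zero)
    have "dist (g k v) (g j v) < \<eta>" if kj: "k \<ge> M" "j \<ge> M" for k j
    proof -
      have 1: "\<bar>g i v - g i (e n)\<bar> < \<eta> / 4" for i
        using F_diff[OF g(1) v e_V, of i n] F_bdd[OF g(1) subspace_diff[OF V v e_V], of i n] n
        by (simp add: dist_norm norm_minus_commute)
      show ?thesis using 1[of k] 1[of j] M[OF kj] unfolding dist_real_def by linarith
    qed
    then show "\<exists>M. \<forall>k\<ge>M. \<forall>j\<ge>M. dist (g k v) (g j v) < \<eta>" by blast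
  qed
  define f where "f = (\<lambda>v. lim (\<lambda>k. g k v))"
  have lim: "(\<lambda>k. g k v) \<longlonglongrightarrow> f v" if "v \<in> V" for v
    using convV[OF that] by (simp add: f_def convergent_LIMSEQ_iff)
  have fF: "f \<in> F" unfolding F_def
  proof (intro CollectI conjI ballI allI)
    fix v w a b assume vw: "v \<in> V" "w \<in> V"
    have "(\<lambda>k. g k (a *\<^sub>R v + b *\<^sub>R w)) \<longlonglongrightarrow> f (a *\<^sub>R v + b *\<^sub>R w)"
      using V vw by (intro lim) (simp add: subspace_add subspace_scale)
    moreover have "(\<lambda>k. g k (a *\<^sub>R v + b *\<^sub>R w)) \<longlonglongrightarrow> a * f v + b * f w"
      unfolding F_lin[OF g(1) vw] by (intro tendsto_intros lim vw)
    ultimately show "f (a *\<^sub>R v + b *\<^sub>R w) = a * f v + b * f w" by (rule LIMSEQ_unique)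
  next
    fix v assume v: "v \<in> V"
    show "\<bar>f v\<bar> \<le> norm v"
      using F_bdd[OF g(1) v] by (intro LIMSEQ_le_const2[OF tendsto_rabs[OF lim[OF v]]]) auto
  qed
  \<comment> \<open>A supremum can only drop in a pointwise limit. An inequality suffices, because
    \<open>\<theta>\<close> enters \<open>\<rho>\<close> with a minus sign.\<close>
  have qlim: "\<exists>Q. (\<lambda>k. q s n (g k)) \<longlonglongrightarrow> Q \<and> (q s n f)\<^sup>2 \<le> Q\<^sup>2" if s: "s = 1 \<or> s = -1" for s n
  proof -
    have s1: "\<bar>s\<bar> = 1" using s by auto
    have "convergent (\<lambda>k. q s n (g k))" using s by (intro conv[of "q s n" n]) auto
    then obtain Q where Q: "(\<lambda>k. q s n (g k)) \<longlonglongrightarrow> Q" by (auto simp: convergent_def)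
    have "q s n f \<le> Q"
    proof (rule q_least)
      fix v assume v: "v \<in> U"
      then have "(\<lambda>k. \<bar>g k v - s * d n v\<bar>) \<longlonglongrightarrow> \<bar>f v - s * d n v\<bar>"
        by (intro tendsto_intros lim) (simp add: U_def)
      then show "\<bar>f v - s * d n v\<bar> \<le> Q"
        using q_upper[OF g(1) v s1] by (intro LIMSEQ_le[OF _ Q]) auto
    qed
    then show ?thesis using Q q_nonneg[OF fF s1, of n] by (intro exI[of _ Q]) (auto intro: power_mono)
  qed
  have \<tau>lim: "\<exists>t. (\<lambda>k. \<tau> n (g k)) \<longlonglongrightarrow> t \<and> \<tau> n f \<le> t" for n
  proof -
    obtain Q1 Q2 where Q: "(\<lambda>k. q 1 n (g k)) \<longlonglongrightarrow> Q1" "(q 1 n f)\<^sup>2 \<le> Q1\<^sup>2"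
      "(\<lambda>k. q (-1) n (g k)) \<longlonglongrightarrow> Q2" "(q (-1) n f)\<^sup>2 \<le> Q2\<^sup>2" using qlim[of 1 n] qlim[of "-1" n] by auto
    have "(\<lambda>k. \<tau> n (g k)) \<longlonglongrightarrow> (Q1\<^sup>2 + Q2\<^sup>2 + (f (e n))\<^sup>2) / N n"
      unfolding \<tau>_def using N_pos[of n] by (intro tendsto_intros Q lim e_V) auto
    moreover have "\<tau> n f \<le> (Q1\<^sup>2 + Q2\<^sup>2 + (f (e n))\<^sup>2) / N n"
      unfolding \<tau>_def using Q N_pos[of n] by (intro divide_right_mono) auto
    ultimately show ?thesis by blast
  qed
  then obtain t where t: "\<And>n. (\<lambda>k. \<tau> n (g k)) \<longlonglongrightarrow> t n" "\<And>n. \<tau> n f \<le> t n" by metis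
  \<comment> \<open>Working with finite partial sums avoids interchanging the limit in
    \<open>k\<close> with the infinite series.\<close>
  have "(\<Sum>n<m. (1/2)^n * \<tau> n f) \<le> f x - \<rho> x" for m
  proof -
    have "(\<Sum>n<m. (1/2)^n * \<tau> n f) \<le> (\<Sum>n<m. (1/2)^n * t n)" using t(2) by (intro sum_mono) auto
    also have "\<dots> \<le> f x - \<rho> x"
    proof (rule LIMSEQ_le)
      show "(\<lambda>k. \<Sum>n<m. (1/2)^n * \<tau> n (g k)) \<longlonglongrightarrow> (\<Sum>n<m. (1/2)^n * t n)" by (intro tendsto_intros t)
      have "(\<lambda>k. g k x - \<rho> x + inverse (real (Suc k))) \<longlonglongrightarrow> f x - \<rho> x + 0"
        by (intro tendsto_intros lim x LIMSEQ_inverse_real_of_nat)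
      then show "(\<lambda>k. g k x - \<rho> x + inverse (real (Suc k))) \<longlonglongrightarrow> f x - \<rho> x" by simp
      have "(\<Sum>n<m. (1/2)^n * \<tau> n (g k)) \<le> g k x - \<rho> x + inverse (real (Suc k))" for k
      proof -
        have "(\<Sum>n<m. (1/2)^n * \<tau> n (g k)) \<le> \<theta> (g k)"
          unfolding \<theta>_def by (intro sum_le_suminf \<theta>_summable g) (auto simp: \<tau>_nonneg)
        then show ?thesis using g(2)[of k] by linarith
      qed
      then show "\<exists>k0. \<forall>k\<ge>k0. (\<Sum>n<m. (1/2)^n * \<tau> n (g k)) \<le> g k x - \<rho> x + inverse (real (Suc k))" by blast
    qed
    finally show ?thesis .
  qed
  then have "\<theta> f \<le> f x - \<rho> x" unfolding \<theta>_def using \<theta>_summable[OF fF] by (intro suminf_le_const)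
  then show ?thesis using fF by (intro bexI[of _ f]) auto
qed

text \<open>A near maximiser \<open>g\<close> at \<open>x + h\<close> is a near maximiser at
  \<open>x\<close>, hence norm-close to the maximiser \<open>f\<close>. Then
  \<open>g (x + h) - \<theta> g\<close> is at most \<open>\<rho> x + g h\<close>, and
  \<open>g h\<close> may be replaced by \<open>f h\<close> up to a small multiple of
  \<open>norm h\<close>.\<close>

lemma \<rho>_superdifferentiable:
  assumes x: "x \<in> V"
  shows "\<exists>f\<in>F. \<forall>\<eta>>0. \<exists>\<delta>>0. \<forall>h\<in>V. norm h < \<delta> \<longrightarrow> \<rho> (x + h) \<le> \<rho> x + f h + \<eta> * norm h"
proof -
  obtain f where f: "f \<in> F" "\<rho> x \<le> f x - \<theta> f" using \<rho>_attained[OF x] by blast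
  have strong: "\<exists>\<epsilon>>0. \<forall>g\<in>F. \<rho> x - \<epsilon> \<le> g x - \<theta> g \<longrightarrow> (\<forall>v\<in>V. \<bar>g v - f v\<bar> \<le> \<eta> * norm v)"
    if \<eta>: "\<eta> > 0" for \<eta>
  proof -
    \<comment> \<open>\<open>f\<close> is within \<open>\<eta>/3\<close> of \<open>d n\<close>. A
      small gap changes the distance to \<open>d n\<close> by at most \<open>\<eta>/3\<close>, so
      \<open>g\<close> is within \<open>2 * \<eta>/3\<close> of \<open>d n\<close> and within
      \<open>\<eta>\<close> of \<open>f\<close>.\<close>
    obtain n where n: "\<forall>v\<in>V. \<bar>f v - d n v\<bar> \<le> (\<eta>/3) * norm v"
      using d_dense[OF F_bdd_lin[OF f(1)], of "\<eta>/3"] \<eta> by auto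
    have qf: "q 1 n f \<le> \<eta>/3"
    proof (rule q_least)
      fix v assume "v \<in> U"
      then have v: "v \<in> V" "norm v \<le> 1" by (auto simp: U_def)
      have "\<bar>f v - d n v\<bar> \<le> (\<eta>/3) * norm v" using n v by blast
      also have "\<dots> \<le> \<eta>/3" using mult_left_mono[OF v(2), of "\<eta>/3"] \<eta> by simp
      finally show "\<bar>f v - 1 * d n v\<bar> \<le> \<eta>/3" by simp
    qed
    have P: "2^n * 4 * N n > 0" using N_pos[of n] by simp
    define \<epsilon> where "\<epsilon> = (\<eta>/3)\<^sup>2 / (2^n * 4 * N n)"
    have \<epsilon>: "\<epsilon> > 0" using P \<eta> by (simp add: \<epsilon>_def)
    have "\<bar>g v - f v\<bar> \<le> \<eta> * norm v" if g: "g \<in> F" "\<rho> x - \<epsilon> \<le> g x - \<theta> g" and v: "v \<in> V" for g v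
    proof -
      have "(1/2)^n * gap n f g \<le> \<epsilon>" using f g \<epsilon> by (intro \<rho>_near_gap[OF x]) auto
      then have "\<bar>q 1 n f - q 1 n g\<bar> \<le> sqrt (\<epsilon> * (2^n * 4 * N n))" by (rule gap_bounds) auto
      also have "\<epsilon> * (2^n * 4 * N n) = (\<eta>/3)\<^sup>2" using N_pos[of n] by (simp add: \<epsilon>_def)
      also have "sqrt ((\<eta>/3)\<^sup>2) = \<eta>/3" using \<eta> by simp
      finally have "q 1 n g \<le> 2 * \<eta>/3" using qf by linarith
      then have "\<bar>g v - d n v\<bar> \<le> (2 * \<eta>/3) * norm v"
        using q_upper'[OF g(1) v, of n] mult_right_mono[of "q 1 n g" "2 * \<eta>/3" "norm v"] by simp
      moreover have "\<bar>f v - d n v\<bar> \<le> (\<eta>/3) * norm v" using n v by blast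
      moreover have "(2 * \<eta>/3) * norm v + (\<eta>/3) * norm v = \<eta> * norm v" by (simp add: field_simps)
      ultimately show ?thesis by linarith
    qed
    then show ?thesis using \<epsilon> by blast
  qed
  show ?thesis
  proof (intro bexI[OF _ f(1)] allI impI)
    fix \<eta> :: real assume \<eta>: "\<eta> > 0"
    then obtain \<epsilon> where \<epsilon>: "\<epsilon> > 0" "\<And>g v. g \<in> F \<Longrightarrow> \<rho> x - \<epsilon> \<le> g x - \<theta> g \<Longrightarrow> v \<in> V \<Longrightarrow> \<bar>g v - f v\<bar> \<le> (\<eta>/2) * norm v"
      using strong[of "\<eta>/2"] by auto
    \<comment> \<open>Going from \<open>x + h\<close> back to \<open>x\<close> loses
      \<open>norm h\<close> twice and \<open>(norm h)\<^sup>2\<close> once, in all at most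
      \<open>3 * norm h\<close>. The bound \<open>\<eta>/2\<close> absorbs the quadratic error into
      the linear one.\<close>
    define \<delta> where "\<delta> = min 1 (min (\<epsilon>/3) (\<eta>/2))"
    show "\<exists>\<delta>>0. \<forall>h\<in>V. norm h < \<delta> \<longrightarrow> \<rho> (x + h) \<le> \<rho> x + f h + \<eta> * norm h"
    proof (intro exI[of _ \<delta>] conjI ballI impI)
      show "\<delta> > 0" using \<epsilon> \<eta> by (simp add: \<delta>_def)
      fix h assume h: "h \<in> V" "norm h < \<delta>"
      show "\<rho> (x + h) \<le> \<rho> x + f h + \<eta> * norm h"
      proof (cases "h = 0")
        case True
        then show ?thesis using F_bdd[OF f(1) h(1)] by simp
      next
        case False
        have xh: "x + h \<in> V" using V x h by (simp add: subspace_add)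
        obtain g where g: "g \<in> F" "\<rho> (x + h) - (norm h)\<^sup>2 < g (x + h) - \<theta> g"
          using \<rho>_approx[OF xh, of "(norm h)\<^sup>2"] False by auto
        have gx: "g (x + h) = g x + g h" by (rule F_add[OF g(1) x h(1)])
        have hd: "norm h < 1" "norm h < \<epsilon>/3" "norm h < \<eta>/2" using h by (auto simp: \<delta>_def)
        have sq: "(norm h)\<^sup>2 \<le> (\<eta>/2) * norm h" "(norm h)\<^sup>2 \<le> norm h"
          unfolding power2_eq_square using hd mult_right_mono[of "norm h" "\<eta>/2" "norm h"] mult_right_mono[of "norm h" 1 "norm h"] by auto
        have "\<rho> x \<le> \<rho> (x + h) + norm h" using \<rho>_lipschitz[OF x xh] by simp
        then have "\<rho> x - \<epsilon> \<le> g x - \<theta> g"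
          using g(2) gx F_bdd[OF g(1) h(1)] sq hd by linarith
        then have "\<bar>g h - f h\<bar> \<le> (\<eta>/2) * norm h" by (rule \<epsilon>(2)[OF g(1) _ h(1)])
        moreover have "(\<eta>/2) * norm h + (\<eta>/2) * norm h = \<eta> * norm h" by (simp add: field_simps)
        ultimately show ?thesis using \<rho>_upper[OF x g(1)] g(2) gx sq(1) by linarith
      qed
    qed
  qed
qed

lemma \<rho>_zero: "\<rho> 0 = - \<theta> (\<lambda>_. 0)"
proof (rule antisym)
  have 0: "(0::'a) \<in> V" by (rule subspace_0[OF V])
  show "\<rho> 0 \<le> - \<theta> (\<lambda>_. 0)" unfolding \<rho>_def
    using zero_F F_bdd[OF _ 0] \<theta>_zero_le by (intro cSUP_least) force+
  show "- \<theta> (\<lambda>_. 0) \<le> \<rho> 0" using \<rho>_upper[OF 0 zero_F] by simp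
qed

text \<open>A norming functional of \<open>x\<close> competes in the supremum, and
  \<open>\<theta>\<close> never exceeds 2. Hahn-Banach supplies it from the single demand
  \<open>l x >= norm x\<close>.\<close>

lemma \<rho>_ge_norm: assumes x: "x \<in> V" shows "norm x - 2 \<le> \<rho> x"
proof -
  define A where "A = {(- x, - norm x)}"
  have "0 \<le> t + 1 * norm v" if "(v, t) \<in> convex hull A" for v t
    using that by (simp add: A_def)
  then obtain l :: "'a \<Rightarrow>\<^sub>L real" where l: "norm l \<le> 1" "\<And>v t. (v, t) \<in> A \<Longrightarrow> blinfun_apply l v \<le> t"
    using functional_below_atoms[of 1 A] by (metis zero_le_one)
  have lF: "blinfun_apply l \<in> F" unfolding F_def
  proof (intro CollectI conjI ballI allI)
    fix v show "\<bar>blinfun_apply l v\<bar> \<le> norm v"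
      using norm_blinfun[of l v] mult_right_mono[OF l(1), of "norm v"] by simp
  qed (simp add: blinfun.add_right blinfun.scaleR_right)
  have "norm x \<le> blinfun_apply l x" using l(2)[of "- x" "- norm x"] by (simp add: A_def blinfun.minus_right)
  then show ?thesis using \<rho>_upper[OF x lF] \<theta>_le[OF lF] by linarith
qed

end

text \<open>The bump is a rescaled conjugate of a dual functional \<open>\<theta>\<close> built from the distances to a
  countable dense subset of the dual. Maximisers of \<open>f \<mapsto> f x - \<theta> f\<close> are strong maximisers in
  norm, because \<open>\<theta>\<close> controls the distance to an element of the dense set close to the maximiser; this makes the
  conjugate Frechet differentiable.\<close>

theorem smooth_bump:
  fixes V :: "'a::real_normed_vector set"
  assumes V: "subspace V" "separable_set V" "separable_dual V"
  obtains \<sigma> :: "'a \<Rightarrow> real" and A :: real where "A > 0" "\<sigma> 0 = 0" "\<forall>v\<in>V. 0 \<le> \<sigma> v"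
    "\<forall>v\<in>V. norm v \<ge> 1 \<longrightarrow> 1 \<le> \<sigma> v"
    "\<forall>u\<in>V. \<forall>v\<in>V. \<bar>\<sigma> u - \<sigma> v\<bar> \<le> A * norm (u - v)"
    "\<forall>v\<in>V. \<exists>f. linear_on_set V f \<and>
        (\<forall>h\<in>V. \<bar>f h\<bar> \<le> A * norm h) \<and>
        superdiff_on V \<sigma> v f"
proof -
  obtain E where E: "countable E" "E \<subseteq> V" "V \<subseteq> closure E" using V(2) by (auto simp: separable_set_def)
  have "E \<noteq> {}" using E(3) subspace_0[OF V(1)] by auto
  then have eE: "range (from_nat_into E) = E" using E(1) by (simp add: range_from_nat_into)
  obtain D where D: "countable D" "\<forall>d\<in>D. bdd_lin_on V d"
    "\<forall>f. bdd_lin_on V f \<longrightarrow> (\<forall>\<epsilon>>0. \<exists>d\<in>D. \<forall>y\<in>V. \<bar>f y - d y\<bar> \<le> \<epsilon> * norm y)"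
    by (rule separable_dualE[OF V(3)])
  have "bdd_lin_on V (\<lambda>_. 0)" by (auto simp: bdd_lin_on_def intro!: exI[of _ 0])
  then have "D \<noteq> {}" using D(3) zero_less_one by blast
  then have dD: "range (from_nat_into D) = D" using D(1) by (simp add: range_from_nat_into)
  have "\<exists>C\<ge>0. \<forall>y\<in>V. \<bar>from_nat_into D n y\<bar> \<le> C * norm y" for n
  proof -
    have "bdd_lin_on V (from_nat_into D n)" using D(2) dD by auto
    then obtain C where C: "\<forall>y\<in>V. \<bar>from_nat_into D n y\<bar> \<le> C * norm y" by (auto simp: bdd_lin_on_def)
    have "C * norm y \<le> \<bar>C\<bar> * norm y" for y :: 'a by (intro mult_right_mono) auto
    then show ?thesis using C by (intro exI[of _ "\<bar>C\<bar>"]) (auto intro: order_trans)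
  qed
  then obtain c where c: "\<And>n. c n \<ge> 0" "\<And>n. \<forall>y\<in>V. \<bar>from_nat_into D n y\<bar> \<le> c n * norm y" by metis
  interpret dense_dual V "from_nat_into D" c "from_nat_into E"
  proof
    fix n x y a b assume "x \<in> V" "y \<in> V"
    moreover have "bdd_lin_on V (from_nat_into D n)" using D(2) dD by auto
    ultimately show "from_nat_into D n (a *\<^sub>R x + b *\<^sub>R y) = a * from_nat_into D n x + b * from_nat_into D n y"
      by (auto simp: bdd_lin_on_def)
  next
    fix f and \<epsilon> :: real assume "bdd_lin_on V f" "\<epsilon> > 0"
    then obtain d where "d \<in> D" "\<forall>y\<in>V. \<bar>f y - d y\<bar> \<le> \<epsilon> * norm y" using D(3) by blast
    then show "\<exists>n. \<forall>v\<in>V. \<bar>f v - from_nat_into D n v\<bar> \<le> \<epsilon> * norm v" using dD by (metis imageE)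
  next
    show "from_nat_into E n \<in> V" for n using eE E(2) by blast
  qed (use V c E eE in auto)
  \<comment> \<open>The dilation by 3 outweighs the loss of 2 in \<open>\<rho>_ge_norm\<close>,
    leaving at least 1 outside the open unit ball; the Lipschitz constant becomes 3.\<close>
  define \<sigma> where "\<sigma> = (\<lambda>v. \<rho> (3 *\<^sub>R v) - \<rho> 0)"
  have sc: "3 *\<^sub>R v \<in> V" if "v \<in> V" for v using that V(1) by (simp add: subspace_scale)
  show ?thesis
  proof (rule that[of 3 \<sigma>]; (intro ballI impI)?)
    fix v assume v: "v \<in> V"
    show "0 \<le> \<sigma> v" using \<rho>_upper[OF sc[OF v] zero_F] \<rho>_zero by (simp add: \<sigma>_def)
  next
    fix v assume v: "v \<in> V"
    show "1 \<le> \<sigma> v" if "norm v \<ge> 1"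
      using \<rho>_ge_norm[OF sc[OF v]] that \<theta>_nonneg[OF zero_F] \<rho>_zero by (simp add: \<sigma>_def)
  next
    fix v assume v: "v \<in> V"
    show "\<exists>f. linear_on_set V f \<and>
        (\<forall>h\<in>V. \<bar>f h\<bar> \<le> 3 * norm h) \<and>
        superdiff_on V \<sigma> v f"
    proof -
      obtain f where f: "f \<in> F" "\<And>\<eta>. \<eta> > 0 \<Longrightarrow> \<exists>\<delta>>0. \<forall>h\<in>V. norm h < \<delta> \<longrightarrow> \<rho> (3 *\<^sub>R v + h) \<le> \<rho> (3 *\<^sub>R v) + f h + \<eta> * norm h"
        using \<rho>_superdifferentiable[OF sc[OF v]] by blast
      show ?thesis
      proof (intro exI[of _ "\<lambda>h. 3 * f h"] conjI ballI allI impI)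
        fix \<eta> :: real assume "\<eta> > 0"
        then obtain \<delta> where \<delta>: "\<delta> > 0" "\<forall>h\<in>V. norm h < \<delta> \<longrightarrow> \<rho> (3 *\<^sub>R v + h) \<le> \<rho> (3 *\<^sub>R v) + f h + (\<eta>/3) * norm h"
          using f(2)[of "\<eta>/3"] by auto
        show "\<exists>\<delta>>0. \<forall>h\<in>V. norm h < \<delta> \<longrightarrow> \<sigma> (v + h) \<le> \<sigma> v + 3 * f h + \<eta> * norm h"
        proof (intro exI[of _ "\<delta>/3"] conjI ballI impI)
          fix h assume h: "h \<in> V" "norm h < \<delta>/3"
          have "\<rho> (3 *\<^sub>R v + 3 *\<^sub>R h) \<le> \<rho> (3 *\<^sub>R v) + f (3 *\<^sub>R h) + (\<eta>/3) * norm (3 *\<^sub>R h)"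
            using \<delta>(2)[rule_format, OF sc[OF h(1)]] h(2) by simp
          then show "\<sigma> (v + h) \<le> \<sigma> v + 3 * f h + \<eta> * norm h"
            using F_lin[OF f(1) h(1) h(1), of 3 0] by (simp add: \<sigma>_def algebra_simps)
        qed (use \<delta> in simp)
      next
        fix x y a b assume "x \<in> V" "y \<in> V"
        then show "3 * f (a *\<^sub>R x + b *\<^sub>R y) = a * (3 * f x) + b * (3 * f y)"
          using F_lin[OF f(1), of x y a b] by (simp add: algebra_simps)
      next
        fix h assume "h \<in> V"
        then show "\<bar>3 * f h\<bar> \<le> 3 * norm h" using F_bdd[OF f(1), of h] by (simp add: abs_mult)
      qed
    qed
  next
    fix u v assume uv: "u \<in> V" "v \<in> V"
    show "\<bar>\<sigma> u - \<sigma> v\<bar> \<le> 3 * norm (u - v)"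
      using \<rho>_lipschitz[OF sc[OF uv(1)] sc[OF uv(2)]] \<rho>_lipschitz[OF sc[OF uv(2)] sc[OF uv(1)]]
      by (simp add: \<sigma>_def abs_le_iff norm_minus_commute flip: scaleR_diff_right)
  qed (simp_all add: \<sigma>_def)
qed

section \<open>Smooth variational principle\<close>

lemma summable_half: "summable (\<lambda>j. C * (1/2::real)^j)"
  by (intro summable_mult summable_geometric) simp

lemma suminf_half: "(\<Sum>j. C * (1/2::real)^j) = 2 * C"
  using summable_geometric[of "1/2::real"] suminf_geometric[of "1/2::real"] by (simp add: suminf_mult)

locale smooth_bump_space =
  fixes V :: "'a::banach set" and \<sigma> :: "'a \<Rightarrow> real" and A :: real
  assumes V: "subspace V" "closed V"
    and A: "A > 0" and \<sigma>_0: "\<sigma> 0 = 0" and \<sigma>_nonneg: "\<And>v. v \<in> V \<Longrightarrow> 0 \<le> \<sigma> v"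
    and \<sigma>_ge_1: "\<And>v. v \<in> V \<Longrightarrow> norm v \<ge> 1 \<Longrightarrow> 1 \<le> \<sigma> v"
    and \<sigma>_lipschitz: "\<And>u v. u \<in> V \<Longrightarrow> v \<in> V \<Longrightarrow> \<bar>\<sigma> u - \<sigma> v\<bar> \<le> A * norm (u - v)"
    and \<sigma>_super: "\<And>v. v \<in> V \<Longrightarrow> \<exists>f. linear_on_set V f \<and>
        (\<forall>h\<in>V. \<bar>f h\<bar> \<le> A * norm h) \<and>
        superdiff_on V \<sigma> v f"
begin

lemma superdiff_scaled:
  assumes x: "x \<in> V" and w: "w \<in> V" and \<epsilon>: "\<epsilon> > 0" and \<delta>: "\<delta> > 0"
  shows "\<exists>f. linear_on_set V f \<and>
        (\<forall>h\<in>V. \<bar>f h\<bar> \<le> \<epsilon> / \<delta> * A * norm h) \<and>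
        (\<forall>\<eta>>0. \<exists>t>0. \<forall>h\<in>V. norm h < t \<longrightarrow>
           \<epsilon> * \<sigma> ((1/\<delta>) *\<^sub>R (w + h - x)) \<le> \<epsilon> * \<sigma> ((1/\<delta>) *\<^sub>R (w - x)) + f h + \<eta> * norm h)"
proof -
  have m: "(1/\<delta>) *\<^sub>R (w - x) \<in> V" using x w V by (simp add: subspace_scale subspace_diff)
  obtain f where f: "\<And>x y a b. x \<in> V \<Longrightarrow> y \<in> V \<Longrightarrow> f (a *\<^sub>R x + b *\<^sub>R y) = a * f x + b * f y"
    "\<And>h. h \<in> V \<Longrightarrow> \<bar>f h\<bar> \<le> A * norm h"
    "\<And>\<eta>. \<eta> > 0 \<Longrightarrow> \<exists>t>0. \<forall>h\<in>V. norm h < t \<longrightarrow> \<sigma> ((1/\<delta>) *\<^sub>R (w - x) + h) \<le> \<sigma> ((1/\<delta>) *\<^sub>R (w - x)) + f h + \<eta> * norm h"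
    using \<sigma>_super[OF m] by metis
  show ?thesis
  proof (intro exI[of _ "\<lambda>h. \<epsilon> / \<delta> * f h"] conjI ballI allI impI)
    fix y z a b assume "y \<in> V" "z \<in> V"
    then show "\<epsilon> / \<delta> * f (a *\<^sub>R y + b *\<^sub>R z) = a * (\<epsilon> / \<delta> * f y) + b * (\<epsilon> / \<delta> * f z)"
      using f(1)[of y z a b] by (simp add: algebra_simps)
  next
    fix h assume "h \<in> V"
    then show "\<bar>\<epsilon> / \<delta> * f h\<bar> \<le> \<epsilon> / \<delta> * A * norm h"
      using mult_left_mono[OF f(2), of h "\<epsilon> / \<delta>"] \<epsilon> \<delta> by (simp add: abs_mult mult.assoc)
  next
    fix \<eta> :: real assume \<eta>: "\<eta> > 0"
    have "\<eta> * \<delta> / \<epsilon> > 0" using \<eta> \<epsilon> \<delta> by simp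
    from f(3)[OF this] obtain t where t: "t > 0" "\<And>h. h \<in> V \<Longrightarrow> norm h < t \<Longrightarrow>
       \<sigma> ((1/\<delta>) *\<^sub>R (w - x) + h) \<le> \<sigma> ((1/\<delta>) *\<^sub>R (w - x)) + f h + \<eta> * \<delta> / \<epsilon> * norm h"
      by blast
    show "\<exists>t>0. \<forall>h\<in>V. norm h < t \<longrightarrow>
           \<epsilon> * \<sigma> ((1/\<delta>) *\<^sub>R (w + h - x)) \<le> \<epsilon> * \<sigma> ((1/\<delta>) *\<^sub>R (w - x)) + \<epsilon> / \<delta> * f h + \<eta> * norm h"
    proof (intro exI[of _ "t * \<delta>"] conjI ballI impI)
      show "0 < t * \<delta>" using t \<delta> by simp
      fix h assume h: "h \<in> V" "norm h < t * \<delta>"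
      have "(1/\<delta>) *\<^sub>R h \<in> V" using h V by (simp add: subspace_scale)
      moreover have "norm ((1/\<delta>) *\<^sub>R h) < t" using h \<delta> by (simp add: field_simps)
      ultimately have "\<sigma> ((1/\<delta>) *\<^sub>R (w - x) + (1/\<delta>) *\<^sub>R h) \<le>
          \<sigma> ((1/\<delta>) *\<^sub>R (w - x)) + f ((1/\<delta>) *\<^sub>R h) + \<eta> * \<delta> / \<epsilon> * norm ((1/\<delta>) *\<^sub>R h)"
        by (rule t(2))
      also have "f ((1/\<delta>) *\<^sub>R h) = f h / \<delta>" using f(1)[OF h(1) h(1), of "1/\<delta>" 0] by simp
      also have "\<eta> * \<delta> / \<epsilon> * norm ((1/\<delta>) *\<^sub>R h) = \<eta> * norm h / \<epsilon>" using \<delta> by simp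
      also have "(1/\<delta>) *\<^sub>R (w - x) + (1/\<delta>) *\<^sub>R h = (1/\<delta>) *\<^sub>R (w + h - x)"
        by (simp add: scaleR_add_right scaleR_diff_right)
      finally have "\<epsilon> * \<sigma> ((1/\<delta>) *\<^sub>R (w + h - x)) \<le> \<epsilon> * (\<sigma> ((1/\<delta>) *\<^sub>R (w - x)) + f h / \<delta> + \<eta> * norm h / \<epsilon>)"
        using \<epsilon> by (intro mult_left_mono) auto
      also have "\<dots> = \<epsilon> * \<sigma> ((1/\<delta>) *\<^sub>R (w - x)) + \<epsilon> / \<delta> * f h + \<eta> * norm h" using \<epsilon> by (simp add: field_simps)
      finally show "\<epsilon> * \<sigma> ((1/\<delta>) *\<^sub>R (w + h - x)) \<le> \<epsilon> * \<sigma> ((1/\<delta>) *\<^sub>R (w - x)) + \<epsilon> / \<delta> * f h + \<eta> * norm h" .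
    qed
  qed
qed

lemma lipschitz_scaled:
  assumes "x \<in> V" "u \<in> V" "v \<in> V" and \<epsilon>: "\<epsilon> > 0" and \<delta>: "\<delta> > 0"
  shows "\<bar>\<epsilon> * \<sigma> ((1/\<delta>) *\<^sub>R (u - x)) - \<epsilon> * \<sigma> ((1/\<delta>) *\<^sub>R (v - x))\<bar> \<le> \<epsilon> / \<delta> * A * norm (u - v)"
proof -
  have "(1/\<delta>) *\<^sub>R (u - x) \<in> V" "(1/\<delta>) *\<^sub>R (v - x) \<in> V" using assms V by (simp_all add: subspace_scale subspace_diff)
  then have "\<bar>\<sigma> ((1/\<delta>) *\<^sub>R (u - x)) - \<sigma> ((1/\<delta>) *\<^sub>R (v - x))\<bar> \<le> A * norm ((1/\<delta>) *\<^sub>R (u - x) - (1/\<delta>) *\<^sub>R (v - x))"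
    by (rule \<sigma>_lipschitz)
  also have "(1/\<delta>) *\<^sub>R (u - x) - (1/\<delta>) *\<^sub>R (v - x) = (1/\<delta>) *\<^sub>R (u - v)"
    by (simp add: scaleR_diff_right)
  also have "A * norm ((1/\<delta>) *\<^sub>R (u - v)) = A * norm (u - v) / \<delta>" using \<delta> by simp
  finally have "\<epsilon> * \<bar>\<sigma> ((1/\<delta>) *\<^sub>R (u - x)) - \<sigma> ((1/\<delta>) *\<^sub>R (v - x))\<bar> \<le> \<epsilon> * (A * norm (u - v) / \<delta>)"
    using \<epsilon> by (intro mult_left_mono) auto
  moreover have "\<epsilon> * \<bar>\<sigma> ((1/\<delta>) *\<^sub>R (u - x)) - \<sigma> ((1/\<delta>) *\<^sub>R (v - x))\<bar> =
     \<bar>\<epsilon> * \<sigma> ((1/\<delta>) *\<^sub>R (u - x)) - \<epsilon> * \<sigma> ((1/\<delta>) *\<^sub>R (v - x))\<bar>"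
    using \<epsilon> by (simp add: abs_mult flip: right_diff_distrib)
  ultimately show ?thesis by simp
qed

text \<open>The tail of the series is controlled by summable Lipschitz constants uniformly in
  \<open>h\<close>; the head consists of finitely many terms, each with its own radius.\<close>

lemma suminf_superdifferentiable:
  assumes w: "w \<in> V"
    and lip: "\<And>j u v. u \<in> V \<Longrightarrow> v \<in> V \<Longrightarrow> \<bar>p j u - p j v\<bar> \<le> aa * (1/2)^j * norm (u - v)"
    and summ: "\<And>u. u \<in> V \<Longrightarrow> summable (\<lambda>j. p j u)"
    and fl: "\<And>j x y a b. x \<in> V \<Longrightarrow> y \<in> V \<Longrightarrow> f j (a *\<^sub>R x + b *\<^sub>R y) = a * f j x + b * f j y"
    and fb: "\<And>j h. h \<in> V \<Longrightarrow> \<bar>f j h\<bar> \<le> aa * (1/2)^j * norm h"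
    and fs: "\<And>j \<eta>. \<eta> > 0 \<Longrightarrow> \<exists>t>0. \<forall>h\<in>V. norm h < t \<longrightarrow> p j (w + h) \<le> p j w + f j h + \<eta> * norm h"
    and aa: "aa > 0"
  shows "(\<forall>x\<in>V. \<forall>y\<in>V. \<forall>a b. (\<Sum>j. f j (a *\<^sub>R x + b *\<^sub>R y)) = a * (\<Sum>j. f j x) + b * (\<Sum>j. f j y)) \<and>
        (\<forall>h\<in>V. \<bar>\<Sum>j. f j h\<bar> \<le> 2 * aa * norm h) \<and>
        (\<forall>\<eta>>0. \<exists>t>0. \<forall>h\<in>V. norm h < t \<longrightarrow> (\<Sum>j. p j (w + h)) \<le> (\<Sum>j. p j w) + (\<Sum>j. f j h) + \<eta> * norm h)"
proof -
  have fsum: "summable (\<lambda>j. f j h)" if "h \<in> V" for h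
    using fb[OF that] by (intro summable_comparison_test'[OF summable_half[of "aa * norm h"], of 0]) (simp add: mult_ac)
  show ?thesis
  proof (intro conjI ballI allI impI)
    fix x y a b assume xy: "x \<in> V" "y \<in> V"
    show "(\<Sum>j. f j (a *\<^sub>R x + b *\<^sub>R y)) = a * (\<Sum>j. f j x) + b * (\<Sum>j. f j y)"
      using fsum[OF xy(1)] fsum[OF xy(2)] by (simp add: fl xy suminf_add[symmetric] suminf_mult summable_mult)
  next
    fix h assume h: "h \<in> V"
    have "norm (\<Sum>j. f j h) \<le> (\<Sum>j. (aa * norm h) * (1/2)^j)"
      using fb[OF h] by (intro norm_suminf_le summable_half) (simp add: mult_ac)
    then show "\<bar>\<Sum>j. f j h\<bar> \<le> 2 * aa * norm h" unfolding suminf_half by simp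
  next
    fix \<eta> :: real assume \<eta>: "\<eta> > 0"
    \<comment> \<open>The tail error is at most \<open>4 * aa * (1/2)^n * norm h\<close>, thus at
      most half of \<open>\<eta> * norm h\<close>; the \<open>n\<close> head terms share the other
      half.\<close>
    obtain n where n: "(1/2)^n < \<eta> / (8 * aa)"
      using real_arch_pow_inv[of "\<eta> / (8 * aa)" "1/2"] \<eta> aa by auto
    define \<eta>' where "\<eta>' = \<eta> / (2 * real (Suc n))"
    have \<eta>': "\<eta>' > 0" "real n * \<eta>' \<le> \<eta> / 2" using \<eta> by (auto simp: \<eta>'_def field_simps)
    obtain t where t: "\<And>j. t j > 0" "\<And>j h. h \<in> V \<Longrightarrow> norm h < t j \<Longrightarrow> p j (w + h) \<le> p j w + f j h + \<eta>' * norm h"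
      using fs[OF \<eta>'(1)] by metis
    define \<delta> where "\<delta> = Min (insert 1 (t ` {..<n}))"
    have \<delta>: "\<delta> > 0" "\<And>j. j < n \<Longrightarrow> \<delta> \<le> t j" using t(1) by (auto simp: \<delta>_def)
    show "\<exists>t>0. \<forall>h\<in>V. norm h < t \<longrightarrow> (\<Sum>j. p j (w + h)) \<le> (\<Sum>j. p j w) + (\<Sum>j. f j h) + \<eta> * norm h"
    proof (intro exI[of _ \<delta>] conjI \<delta>(1) ballI impI)
      fix h assume h: "h \<in> V" "norm h < \<delta>"
      have wh: "w + h \<in> V" using w h V by (simp add: subspace_add)
      define u where "u = (\<lambda>j. p j (w + h) - p j w - f j h)"
      have us: "u sums ((\<Sum>j. p j (w + h)) - (\<Sum>j. p j w) - (\<Sum>j. f j h))"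
        unfolding u_def by (intro sums_diff summable_sums summ fsum wh w h)
      have ub: "\<bar>u j\<bar> \<le> (2 * aa * norm h) * (1/2)^j" for j
        using lip[OF wh w, of j] fb[OF h(1), of j] unfolding u_def by (simp add: mult_ac)
      have split: "suminf u = (\<Sum>j. u (j + n)) + sum u {..<n}"
        using us by (intro suminf_split_initial_segment) (simp add: sums_iff)
      have "norm (\<Sum>j. u (j + n)) \<le> (\<Sum>j. (2 * aa * norm h * (1/2)^n) * (1/2)^j)"
        using ub[of "_ + n"] by (intro norm_suminf_le summable_half) (simp add: power_add mult_ac)
      also have "\<dots> = 4 * aa * (1/2)^n * norm h" unfolding suminf_half by simp
      also have "\<dots> \<le> (\<eta> / 2) * norm h"
        using n aa by (intro mult_right_mono) (auto simp: field_simps)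
      finally have 1: "(\<Sum>j. u (j + n)) \<le> (\<eta> / 2) * norm h" by simp
      have "sum u {..<n} \<le> (\<Sum>j<n. \<eta>' * norm h)"
      proof (rule sum_mono)
        fix j assume "j \<in> {..<n}"
        then have "norm h < t j" using h(2) \<delta>(2)[of j] by simp
        then show "u j \<le> \<eta>' * norm h" using t(2)[OF h(1), of j] by (simp add: u_def)
      qed
      also have "\<dots> = (real n * \<eta>') * norm h" by simp
      also have "\<dots> \<le> (\<eta> / 2) * norm h" using \<eta>' by (intro mult_right_mono) auto
      finally have "sum u {..<n} \<le> (\<eta> / 2) * norm h" .
      with 1 split have "suminf u \<le> \<eta> * norm h" by (simp add: field_simps)
      then show "(\<Sum>j. p j (w + h)) \<le> (\<Sum>j. p j w) + (\<Sum>j. f j h) + \<eta> * norm h"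
        using us by (simp add: sums_iff)
    qed
  qed
qed

text \<open>A scheme in the style of Borwein and Preiss: each stage adds a bump centred at the
  current near minimiser, too high to be left profitably. The centres converge, and the sum of all
  bumps is the perturbation \<open>g\<close>.\<close>

theorem smooth_variational_principle:
  assumes D: "closed D" "D \<subseteq> V" and cont: "continuous_on D \<Phi>"
    and x0: "x0 \<in> D" and \<kappa>: "\<kappa> > 0" and r: "r > 0"
    and near: "\<And>\<xi>. \<xi> \<in> D \<Longrightarrow> \<Phi> x0 \<le> \<Phi> \<xi> + \<kappa>"
  obtains w g f where "w \<in> D" "norm (w - x0) \<le> 2 * r" "\<forall>\<xi>\<in>D. \<Phi> w + g w \<le> \<Phi> \<xi> + g \<xi>"
    "linear_on_set V f"
    "\<forall>h\<in>V. \<bar>f h\<bar> \<le> 4 * \<kappa> * A / r * norm h"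
    "superdiff_on V g w f"
proof -
  \<comment> \<open>Heights shrink like \<open>(1/4)^k\<close> and widths like
    \<open>(1/2)^k\<close>, so the slopes and the steps are both summable. The factor 2 makes
    \<open>\<epsilon> 0 / 2\<close> equal to the given \<open>\<kappa>\<close>.\<close>
  define \<epsilon> where "\<epsilon> = (\<lambda>k::nat. 2 * \<kappa> * (1/4)^k)"
  define \<delta> where "\<delta> = (\<lambda>k::nat. r * (1/2)^k)"
  have \<epsilon>: "\<epsilon> k > 0" for k using \<kappa> by (simp add: \<epsilon>_def)
  have \<delta>: "\<delta> k > 0" for k using r by (simp add: \<delta>_def)
  define aa where "aa = 2 * \<kappa> / r * A"
  have aa: "aa > 0" using \<kappa> r A by (simp add: aa_def)
  have \<epsilon>\<delta>: "\<epsilon> k / \<delta> k * A = aa * (1/2)^k" for k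
  proof -
    have "(1/4::real)^k = (1/2)^k * (1/2)^k" by (simp flip: power_mult_distrib)
    then show ?thesis using r by (simp add: \<epsilon>_def \<delta>_def aa_def)
  qed
  define pert where "pert = (\<lambda>k x \<xi>. \<epsilon> k * \<sigma> ((1 / \<delta> k) *\<^sub>R (\<xi> - x)))"
  have pert0: "pert k x x = 0" for k x by (simp add: pert_def \<sigma>_0)
  have pert_V: "(1 / \<delta> k) *\<^sub>R (\<xi> - x) \<in> V" if "x \<in> V" "\<xi> \<in> V" for k x \<xi>
    using that V by (simp add: subspace_scale subspace_diff)
  have pert_nn: "0 \<le> pert k x \<xi>" if "x \<in> V" "\<xi> \<in> V" for k x \<xi>
    using \<sigma>_nonneg[OF pert_V[OF that]] \<epsilon>[of k] by (simp add: pert_def)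
  have pert_ge: "\<epsilon> k \<le> pert k x \<xi>" if "x \<in> V" "\<xi> \<in> V" "norm (\<xi> - x) \<ge> \<delta> k" for k x \<xi>
  proof -
    have "norm ((1 / \<delta> k) *\<^sub>R (\<xi> - x)) \<ge> 1" using that(3) \<delta>[of k] by simp
    then have "1 \<le> \<sigma> ((1 / \<delta> k) *\<^sub>R (\<xi> - x))" using \<sigma>_ge_1 pert_V that by blast
    then show ?thesis using mult_left_mono[of 1 _ "\<epsilon> k"] \<epsilon>[of k] by (simp add: pert_def)
  qed
  have pert_lip: "\<bar>pert k x u - pert k x v\<bar> \<le> aa * (1/2)^k * norm (u - v)" if "x \<in> V" "u \<in> V" "v \<in> V" for k x u v
    using lipschitz_scaled[OF that \<epsilon> \<delta>, of k k] unfolding \<epsilon>\<delta> pert_def .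
  \<comment> \<open>The state is a point with the current perturbed function. \<open>P\<close> asks
    for minimality up to \<open>\<epsilon> k / 2\<close> and fixes the start; \<open>Q\<close> adds
    the bump at the old point without letting the value rise.\<close>
  define P where "P = (\<lambda>k (s :: 'a \<times> ('a \<Rightarrow> real)). fst s \<in> D \<and> (\<forall>\<xi>\<in>D. snd s (fst s) \<le> snd s \<xi> + \<epsilon> k / 2) \<and> (k = 0 \<longrightarrow> s = (x0, \<Phi>)))"
  define Q where "Q = (\<lambda>k (s :: 'a \<times> ('a \<Rightarrow> real)) s'. snd s' = (\<lambda>\<xi>. snd s \<xi> + pert k (fst s) \<xi>) \<and> snd s' (fst s') \<le> snd s' (fst s))"
  have "\<exists>s. \<forall>k. P k (s k) \<and> Q k (s k) (s (Suc k))"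
  proof (rule dependent_nat_choice)
    show "\<exists>s. P 0 s" using near x0 by (intro exI[of _ "(x0, \<Phi>)"]) (simp add: P_def \<epsilon>_def)
  next
    fix s k assume Ps: "P k s"
    obtain x \<Psi> where s: "s = (x, \<Psi>)" by (cases s)
    have x: "x \<in> D" and nr: "\<And>\<xi>. \<xi> \<in> D \<Longrightarrow> \<Psi> x \<le> \<Psi> \<xi> + \<epsilon> k / 2" using Ps by (auto simp: P_def s)
    define \<Psi>' where "\<Psi>' = (\<lambda>\<xi>. \<Psi> \<xi> + pert k x \<xi>)"
    have low: "\<Psi> x - \<epsilon> k / 2 \<le> \<Psi>' \<xi>" if "\<xi> \<in> D" for \<xi>
      using nr[OF that] pert_nn[OF subsetD[OF D(2) x] subsetD[OF D(2) that], of k] by (simp add: \<Psi>'_def)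
    then have bdd: "bdd_below (\<Psi>' ` D)" by (rule bdd_belowI2)
    have "(INF \<xi>\<in>D. \<Psi>' \<xi>) < (INF \<xi>\<in>D. \<Psi>' \<xi>) + \<epsilon> (Suc k) / 2" using \<epsilon>[of "Suc k"] by simp
    then obtain y where y: "y \<in> D" "\<Psi>' y < (INF \<xi>\<in>D. \<Psi>' \<xi>) + \<epsilon> (Suc k) / 2"
      using x by (subst (asm) cINF_less_iff[OF _ bdd]) auto
    have ymin: "\<Psi>' y \<le> \<Psi>' \<xi> + \<epsilon> (Suc k) / 2" if "\<xi> \<in> D" for \<xi>
      using y(2) cINF_lower[OF bdd that] by linarith
    \<comment> \<open>The old point is kept unless the new candidate is at least as good; both are
      near minimal in the first case.\<close>
    define z where "z = (if \<Psi>' y \<le> \<Psi>' x then y else x)"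
    have "z \<in> D" "\<Psi>' z \<le> \<Psi>' x" using x y by (auto simp: z_def)
    moreover have "\<Psi>' z \<le> \<Psi>' \<xi> + \<epsilon> (Suc k) / 2" if "\<xi> \<in> D" for \<xi> using ymin[OF that] by (auto simp: z_def)
    ultimately show "\<exists>s'. P (Suc k) s' \<and> Q k s s'"
      by (intro exI[of _ "(z, \<Psi>')"]) (auto simp: P_def Q_def s \<Psi>'_def)
  qed
  then obtain s where s: "\<And>k. P k (s k)" "\<And>k. Q k (s k) (s (Suc k))" by blast
  define x where "x = (\<lambda>k. fst (s k))"
  define \<Psi> where "\<Psi> = (\<lambda>k. snd (s k))"
  have s0: "x 0 = x0" "\<Psi> 0 = \<Phi>" using s(1)[of 0] by (auto simp: P_def x_def \<Psi>_def)
  have xD: "x k \<in> D" for k using s(1) by (auto simp: P_def x_def)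
  then have xV: "x k \<in> V" for k using D(2) by blast
  have nr: "\<Psi> k (x k) \<le> \<Psi> k \<xi> + \<epsilon> k / 2" if "\<xi> \<in> D" for k \<xi> using s(1)[of k] that by (auto simp: P_def x_def \<Psi>_def)
  have \<Psi>_Suc: "\<Psi> (Suc k) \<xi> = \<Psi> k \<xi> + pert k (x k) \<xi>" for k \<xi> using s(2)[of k] by (auto simp: Q_def x_def \<Psi>_def)
  have dec: "\<Psi> (Suc k) (x (Suc k)) \<le> \<Psi> k (x k)" for k
    using s(2)[of k] \<Psi>_Suc[of k "x k"] pert0 by (auto simp: Q_def x_def \<Psi>_def)
  have \<Psi>_sum: "\<Psi> k \<xi> = \<Phi> \<xi> + (\<Sum>j<k. pert j (x j) \<xi>)" for k \<xi>
    by (induction k) (auto simp: s0 \<Psi>_Suc)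
  \<comment> \<open>A move by at least \<open>\<delta> k\<close> would pay at least
    \<open>\<epsilon> k\<close> for the bump, while near minimality allows a gain of at most
    \<open>\<epsilon> k / 2\<close>.\<close>
  have step: "norm (x (Suc k) - x k) \<le> r * (1/2)^k" for k
  proof (rule ccontr)
    assume "\<not> ?thesis"
    then have "\<epsilon> k \<le> pert k (x k) (x (Suc k))" by (intro pert_ge xV) (simp add: \<delta>_def)
    then show False using dec[of k] nr[OF xD[of "Suc k"], of k] \<Psi>_Suc[of k "x (Suc k)"] \<epsilon>[of k] by linarith
  qed
  have "summable (\<lambda>k. x (Suc k) - x k)"
    using step by (intro summable_comparison_test'[OF summable_half[of r], of 0]) auto
  then have "(\<lambda>n. \<Sum>k<n. x (Suc k) - x k) \<longlonglongrightarrow> (\<Sum>k. x (Suc k) - x k)" by (rule summable_LIMSEQ)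
  then have "(\<lambda>n. x n - x0) \<longlonglongrightarrow> (\<Sum>k. x (Suc k) - x k)" by (simp add: sum_lessThan_telescope s0)
  then have "(\<lambda>n. x n - x0 + x0) \<longlonglongrightarrow> (\<Sum>k. x (Suc k) - x k) + x0" by (intro tendsto_intros)
  then have lim: "x \<longlonglongrightarrow> x0 + (\<Sum>k. x (Suc k) - x k)" by (simp add: add.commute)
  define w where "w = x0 + (\<Sum>k. x (Suc k) - x k)"
  have lim: "x \<longlonglongrightarrow> w" using lim by (simp add: w_def)
  have wD: "w \<in> D" using closed_sequentially[OF D(1) xD lim] .
  then have wV: "w \<in> V" using D(2) by blast
  have wx0: "norm (w - x0) \<le> 2 * r"
    using norm_suminf_le[OF step summable_half[of r]] unfolding suminf_half by (simp add: w_def)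
  obtain B where B: "\<And>k. norm (x k) \<le> B" using Bseq_def convergent_imp_Bseq[of x] lim by (metis convergent_def)
  define p where "p = (\<lambda>j. pert j (x j))"
  have plip: "\<bar>p j u - p j v\<bar> \<le> aa * (1/2)^j * norm (u - v)" if "u \<in> V" "v \<in> V" for j u v
    unfolding p_def using pert_lip xV that by blast
  have psum: "summable (\<lambda>j. p j u)" if u: "u \<in> V" for u
  proof (rule summable_comparison_test'[OF summable_half[of "aa * (norm u + B)"], of 0])
    fix j
    have "\<bar>p j u\<bar> \<le> aa * (1/2)^j * norm (u - x j)" using plip[OF u xV, of j j] pert0[of j "x j"] by (simp add: p_def)
    also have "\<dots> \<le> aa * (1/2)^j * (norm u + B)"
      using norm_triangle_ineq4[of u "x j"] B[of j] aa by (intro mult_left_mono) auto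
    finally show "norm (p j u) \<le> aa * (norm u + B) * (1/2)^j" by (simp add: mult_ac)
  qed
  have pnn: "0 \<le> p j u" if "u \<in> V" for j u unfolding p_def using pert_nn xV that by blast
  have min: "\<Phi> w + (\<Sum>j. p j w) \<le> \<Phi> \<xi> + (\<Sum>j. p j \<xi>)" if \<xi>: "\<xi> \<in> D" for \<xi>
  proof -
    have \<xi>V: "\<xi> \<in> V" using \<xi> D(2) by blast
    \<comment> \<open>With \<open>n\<close> fixed and \<open>m >= n\<close>, dropping nonnegative
      bumps gives \<open>\<Psi> n (x m) <= \<Psi> m (x m)\<close>, to which near minimality applies.
      First \<open>m\<close> and afterwards \<open>n\<close> tends to infinity.\<close>
    have 1: "\<Psi> n w \<le> \<Phi> \<xi> + (\<Sum>j. p j \<xi>)" for n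
    proof (rule LIMSEQ_le)
      have "(\<lambda>m. \<Phi> (x m)) \<longlonglongrightarrow> \<Phi> w"
        using continuous_on_tendsto_compose[OF cont lim wD] xD by simp
      moreover have "(\<lambda>m. p j (x m)) \<longlonglongrightarrow> p j w" for j
      proof (rule Lim_null_comparison[THEN LIM_zero_cancel])
        show "\<forall>\<^sub>F m in sequentially. norm (p j (x m) - p j w) \<le> aa * (1/2)^j * norm (x m - w)"
          using plip[OF xV wV, of j] by simp
        have "(\<lambda>m. aa * (1/2)^j * norm (x m - w)) \<longlonglongrightarrow> aa * (1/2)^j * norm (w - w)"
          by (intro tendsto_intros lim)
        then show "(\<lambda>m. aa * (1/2)^j * norm (x m - w)) \<longlonglongrightarrow> 0" by simp
      qed
      ultimately show "(\<lambda>m. \<Psi> n (x m)) \<longlonglongrightarrow> \<Psi> n w"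
        unfolding \<Psi>_sum p_def by (intro tendsto_intros)
      have "(\<lambda>m. \<Phi> \<xi> + (\<Sum>j. p j \<xi>) + 2 * \<kappa> * (1/4)^m / 2) \<longlonglongrightarrow> \<Phi> \<xi> + (\<Sum>j. p j \<xi>) + 2 * \<kappa> * 0 / 2"
        by (intro tendsto_intros LIMSEQ_realpow_zero) auto
      then show "(\<lambda>m. \<Phi> \<xi> + (\<Sum>j. p j \<xi>) + \<epsilon> m / 2) \<longlonglongrightarrow> \<Phi> \<xi> + (\<Sum>j. p j \<xi>)" by (simp add: \<epsilon>_def)
      have "\<Psi> n (x m) \<le> \<Phi> \<xi> + (\<Sum>j. p j \<xi>) + \<epsilon> m / 2" if "m \<ge> n" for m
      proof -
        have "\<Psi> n (x m) \<le> \<Psi> m (x m)"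
          unfolding \<Psi>_sum using that pnn[OF xV] by (intro add_left_mono sum_mono2) (auto simp: p_def)
        also have "\<dots> \<le> \<Psi> m \<xi> + \<epsilon> m / 2" by (rule nr[OF \<xi>])
        also have "\<Psi> m \<xi> \<le> \<Phi> \<xi> + (\<Sum>j. p j \<xi>)"
          unfolding \<Psi>_sum using pnn[OF \<xi>V] psum[OF \<xi>V] unfolding p_def by (intro add_left_mono sum_le_suminf) auto
        finally show ?thesis by simp
      qed
      then show "\<exists>N. \<forall>m\<ge>N. \<Psi> n (x m) \<le> \<Phi> \<xi> + (\<Sum>j. p j \<xi>) + \<epsilon> m / 2" by blast
    qed
    have "(\<lambda>n. \<Psi> n w) \<longlonglongrightarrow> \<Phi> w + (\<Sum>j. p j w)"
      unfolding \<Psi>_sum using summable_LIMSEQ[OF psum[OF wV]] unfolding p_def by (intro tendsto_intros)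
    then show ?thesis using 1 by (intro LIMSEQ_le_const2) auto
  qed
  have "\<forall>j. \<exists>f. linear_on_set V f \<and>
        (\<forall>h\<in>V. \<bar>f h\<bar> \<le> aa * (1/2)^j * norm h) \<and>
        superdiff_on V (p j) w f"
    using superdiff_scaled[OF xV wV \<epsilon> \<delta>] unfolding p_def pert_def \<epsilon>\<delta>[symmetric] by blast
  then obtain f where f: "\<And>j. linear_on_set V (f j)"
        "\<And>j. \<forall>h\<in>V. \<bar>f j h\<bar> \<le> aa * (1/2)^j * norm h"
        "\<And>j. superdiff_on V (p j) w (f j)"
    by metis
  have S: "(\<forall>x\<in>V. \<forall>y\<in>V. \<forall>a b. (\<Sum>j. f j (a *\<^sub>R x + b *\<^sub>R y)) = a * (\<Sum>j. f j x) + b * (\<Sum>j. f j y)) \<and>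
        (\<forall>h\<in>V. \<bar>\<Sum>j. f j h\<bar> \<le> 2 * aa * norm h) \<and>
        (\<forall>\<eta>>0. \<exists>t>0. \<forall>h\<in>V. norm h < t \<longrightarrow> (\<Sum>j. p j (w + h)) \<le> (\<Sum>j. p j w) + (\<Sum>j. f j h) + \<eta> * norm h)"
    using f by (intro suminf_superdifferentiable[OF wV plip psum _ _ _ aa]) blast+
  have "2 * aa = 4 * \<kappa> * A / r" by (simp add: aa_def)
  with S show ?thesis
    using wD wx0 min by (intro that[of w "\<lambda>u. \<Sum>j. p j u" "\<lambda>h. \<Sum>j. f j h"]) simp_all
qed

text \<open>The constraint \<open>T \<xi> = 0\<close> is penalised by the bump
  \<open>M \<sigma> (T \<xi> / \<delta>)\<close> with fixed height \<open>M\<close> and small width \<open>\<delta>\<close>.\<close>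

theorem fuzzy_rule_in_subspace:
  assumes T: "bounded_linear T" "\<And>v. v \<in> V \<Longrightarrow> T v \<in> V"
    and G: "\<And>u v. \<bar>G u - G v\<bar> \<le> lG * norm (u - v)" and D: "closed D"
    and wb: "wb \<in> D" "wb \<in> V" "T wb = 0" and l: "l \<ge> 0" and \<epsilon>: "\<epsilon> > 0"
    and min: "\<And>\<eta>. \<eta> > 0 \<Longrightarrow> \<exists>R>0. \<forall>\<xi>\<in>D. norm (\<xi> - wb) < R \<longrightarrow> G wb \<le> G \<xi> + l * norm (T \<xi>) + \<eta> * norm (\<xi> - wb)"
  obtains w \<Lambda> C where "w \<in> D" "w \<in> V" "norm (w - wb) < \<epsilon>"
    "linear_on_set V \<Lambda>" "\<forall>h\<in>V. \<bar>\<Lambda> h\<bar> \<le> C * norm h"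
    "\<forall>\<eta>>0. \<exists>t>0. \<forall>\<xi>\<in>D\<inter>V. norm (\<xi> - w) < t \<longrightarrow> \<Lambda> (\<xi> - w) \<le> G \<xi> - G w + \<eta> * norm (\<xi> - w)"
    "\<forall>h\<in>V. T h = 0 \<longrightarrow> \<bar>\<Lambda> h\<bar> \<le> \<epsilon> * norm h"
proof -
  \<comment> \<open>With tolerance \<open>2 * \<eta> * r\<close> and radius \<open>r / 4\<close> the
    variational principle gives slope \<open>32 * \<eta> * A\<close>, which is
    \<open>\<epsilon> / 2\<close>.\<close>
  define \<eta> where "\<eta> = \<epsilon> / (64 * A)"
  have \<eta>: "\<eta> > 0" using \<epsilon> A by (simp add: \<eta>_def)
  obtain R where R: "R > 0" "\<And>\<xi>. \<xi> \<in> D \<Longrightarrow> norm (\<xi> - wb) < R \<Longrightarrow> G wb \<le> G \<xi> + l * norm (T \<xi>) + \<eta> * norm (\<xi> - wb)"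
    using min[OF \<eta>] by blast
  define r where "r = min R \<epsilon> / 2"
  have r: "r > 0" "r < R" "r < \<epsilon>" using R(1) \<epsilon> by (auto simp: r_def)
  \<comment> \<open>More than \<open>G\<close> can decrease within distance \<open>r\<close>, so a
    point with \<open>norm (T \<xi>) >= \<delta>\<close> cannot do better than
    \<open>wb\<close>.\<close>
  define M where "M = \<bar>lG\<bar> * r + 1"
  have M: "M > 0" using r by (simp add: M_def add_nonneg_pos)
  \<comment> \<open>Where the penalty is not yet active, the term \<open>l * norm (T \<xi>)\<close>
    is at most \<open>\<eta> * r\<close>; together with \<open>\<eta> * norm (\<xi> - wb)\<close>
    the loss is at most \<open>2 * \<eta> * r\<close>.\<close>
  define \<delta> where "\<delta> = \<eta> * r / (l + 1)"
  have \<delta>: "\<delta> > 0" using \<eta> r l by (simp add: \<delta>_def)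
  have l\<delta>: "l * \<delta> \<le> \<eta> * r" using \<eta> r l by (simp add: \<delta>_def field_simps)
  define \<Phi> where "\<Phi> = (\<lambda>\<xi>. G \<xi> + M * \<sigma> ((1/\<delta>) *\<^sub>R (T \<xi> - 0)))"
  define D' where "D' = D \<inter> V \<inter> cball wb r"
  have D': "closed D'" "D' \<subseteq> V" "wb \<in> D'" using D V wb r by (auto simp: D'_def intro: closed_Int)
  have V0: "0 \<in> V" using V by (simp add: subspace_0)
  have T0: "T 0 = 0" and Tadd: "T (x + y) = T x + T y" and Tscale: "T (a *\<^sub>R x) = a *\<^sub>R T x" for x y a
    using T(1) by (auto simp: linear_simps)
  obtain K where K: "K > 0" "\<And>x. norm (T x) \<le> norm x * K" using bounded_linear.pos_bounded[OF T(1)] by blast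
  have Tdiff: "T (x - y) = T x - T y" for x y using T(1) by (simp add: linear_simps)
  have lipT: "\<bar>M * \<sigma> ((1/\<delta>) *\<^sub>R (T u - 0)) - M * \<sigma> ((1/\<delta>) *\<^sub>R (T v - 0))\<bar> \<le> M / \<delta> * A * K * norm (u - v)"
    if "u \<in> V" "v \<in> V" for u v
  proof -
    have "\<bar>M * \<sigma> ((1/\<delta>) *\<^sub>R (T u - 0)) - M * \<sigma> ((1/\<delta>) *\<^sub>R (T v - 0))\<bar> \<le> M / \<delta> * A * norm (T u - T v)"
      using that by (intro lipschitz_scaled V0 T(2) M \<delta>)
    also have "\<dots> \<le> M / \<delta> * A * (norm (u - v) * K)"
      using K(2)[of "u - v"] M \<delta> A by (intro mult_left_mono) (auto simp: Tdiff)
    finally show ?thesis by (simp add: mult_ac)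
  qed
  have cont: "continuous_on D' \<Phi>"
  proof -
    have 1: "\<bar>\<Phi> u - \<Phi> v\<bar> \<le> (\<bar>lG\<bar> + M / \<delta> * A * K) * norm (u - v)" if "u \<in> D'" "v \<in> D'" for u v
    proof -
      have "lG * norm (u - v) \<le> \<bar>lG\<bar> * norm (u - v)" by (intro mult_right_mono) auto
      then show ?thesis using lipT[OF subsetD[OF D'(2) that(1)] subsetD[OF D'(2) that(2)]] G[of u v]
        unfolding \<Phi>_def distrib_right by linarith
    qed
    have "(\<bar>lG\<bar> + M / \<delta> * A * K)-lipschitz_on D' \<Phi>"
      using 1 M \<delta> A K by (intro lipschitz_onI) (auto simp: dist_norm)
    then show ?thesis by (rule lipschitz_on_continuous_on)
  qed
  have near: "\<Phi> wb \<le> \<Phi> \<xi> + 2 * \<eta> * r" if "\<xi> \<in> D'" for \<xi>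
  proof -
    have \<xi>: "\<xi> \<in> D" "\<xi> \<in> V" "norm (\<xi> - wb) \<le> r" using that by (auto simp: D'_def dist_norm norm_minus_commute)
    have \<Phi>wb: "\<Phi> wb = G wb" by (simp add: \<Phi>_def wb \<sigma>_0)
    have TV: "(1/\<delta>) *\<^sub>R (T \<xi> - 0) \<in> V" using T(2)[OF \<xi>(2)] V by (simp add: subspace_scale)
    show ?thesis
    proof (cases "norm (T \<xi>) < \<delta>")
      case True
      have "l * norm (T \<xi>) \<le> l * \<delta>" using True l by (intro mult_left_mono) auto
      moreover have "\<eta> * norm (\<xi> - wb) \<le> \<eta> * r" using \<xi> \<eta> by (intro mult_left_mono) auto
      moreover have "G wb \<le> G \<xi> + l * norm (T \<xi>) + \<eta> * norm (\<xi> - wb)" using R(2)[OF \<xi>(1)] \<xi>(3) r by simp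
      ultimately have "G wb \<le> G \<xi> + 2 * \<eta> * r" using l\<delta> by linarith
      moreover have "0 \<le> M * \<sigma> ((1/\<delta>) *\<^sub>R (T \<xi> - 0))" using \<sigma>_nonneg[OF TV] M by simp
      moreover have "\<Phi> \<xi> = G \<xi> + M * \<sigma> ((1/\<delta>) *\<^sub>R (T \<xi> - 0))" by (simp add: \<Phi>_def)
      ultimately show ?thesis unfolding \<Phi>wb by linarith
    next
      case False
      then have "norm ((1/\<delta>) *\<^sub>R (T \<xi> - 0)) \<ge> 1" using \<delta> by simp
      then have "M \<le> M * \<sigma> ((1/\<delta>) *\<^sub>R (T \<xi> - 0))" using \<sigma>_ge_1[OF TV] M by simp
      moreover have "lG * norm (wb - \<xi>) \<le> \<bar>lG\<bar> * r" using \<xi>(3) by (intro mult_mono) (auto simp: norm_minus_commute)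
      then have "G wb - G \<xi> \<le> \<bar>lG\<bar> * r" using G[of wb \<xi>] by linarith
      moreover have "0 \<le> 2 * \<eta> * r" using \<eta> r by simp
      ultimately show ?thesis unfolding \<Phi>wb by (simp add: \<Phi>_def M_def)
    qed
  qed
  have pos: "2 * \<eta> * r > 0" "r / 4 > 0" using \<eta> r by auto
  \<comment> \<open>The radius \<open>r / 4\<close> places \<open>w\<close> within
    \<open>r / 2\<close> of \<open>wb\<close>, so near \<open>w\<close> the restriction to the ball
    of radius \<open>r\<close> is not felt.\<close>
  obtain w g f where w: "w \<in> D'" "norm (w - wb) \<le> 2 * (r / 4)" "\<forall>\<xi>\<in>D'. \<Phi> w + g w \<le> \<Phi> \<xi> + g \<xi>"
    and f: "linear_on_set V f"
    "\<forall>h\<in>V. \<bar>f h\<bar> \<le> 4 * (2 * \<eta> * r) * A / (r / 4) * norm h"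
    "superdiff_on V g w f"
    by (rule smooth_variational_principle[OF D'(1,2) cont D'(3) pos near])
  have "4 * (2 * \<eta> * r) * A / (r / 4) = \<epsilon> / 2" using r A by (simp add: \<eta>_def)
  then have f2: "\<bar>f h\<bar> \<le> \<epsilon> / 2 * norm h" if "h \<in> V" for h using f(2) that by metis
  have wD: "w \<in> D" "w \<in> V" using w by (auto simp: D'_def)
  obtain k where k: "linear_on_set V k"
     "\<forall>h\<in>V. \<bar>k h\<bar> \<le> M / \<delta> * A * norm h"
     "\<forall>\<eta>>0. \<exists>t>0. \<forall>h\<in>V. norm h < t \<longrightarrow>
           M * \<sigma> ((1/\<delta>) *\<^sub>R (T w + h - 0)) \<le> M * \<sigma> ((1/\<delta>) *\<^sub>R (T w - 0)) + k h + \<eta> * norm h"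
    using superdiff_scaled[OF V0 T(2)[OF wD(2)] M \<delta>] by metis
  \<comment> \<open>The negated superderivatives of penalty and perturbation. On the kernel of
    \<open>T\<close> the penalty part vanishes, however steep the penalty is, and only the small
    part \<open>f\<close> remains.\<close>
  define \<Lambda> where "\<Lambda> = (\<lambda>h. - k (T h) - f h)"
  show ?thesis
  proof (rule that[of w \<Lambda> "M / \<delta> * A * K + \<epsilon> / 2"])
    show "w \<in> D" "w \<in> V" by (fact wD)+
    show "norm (w - wb) < \<epsilon>" using w(2) r by simp
    show "linear_on_set V \<Lambda>"
      using f(1) k(1) T(2) by (simp add: \<Lambda>_def Tadd Tscale algebra_simps)
    show "\<forall>h\<in>V. \<bar>\<Lambda> h\<bar> \<le> (M / \<delta> * A * K + \<epsilon> / 2) * norm h"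
    proof
      fix h assume h: "h \<in> V"
      have "\<bar>k (T h)\<bar> \<le> M / \<delta> * A * norm (T h)" using k(2) T(2)[OF h] by blast
      also have "\<dots> \<le> M / \<delta> * A * (norm h * K)" using K(2)[of h] M \<delta> A by (intro mult_left_mono) auto
      also have "\<dots> = M / \<delta> * A * K * norm h" by simp
      finally show "\<bar>\<Lambda> h\<bar> \<le> (M / \<delta> * A * K + \<epsilon> / 2) * norm h"
        using f2[OF h] unfolding \<Lambda>_def distrib_right by linarith
    qed
    show "\<forall>h\<in>V. T h = 0 \<longrightarrow> \<bar>\<Lambda> h\<bar> \<le> \<epsilon> * norm h"
    proof (intro ballI impI)
      fix h assume h: "h \<in> V" "T h = 0"
      have "k 0 = 0" using k(2) V0 by fastforce
      then show "\<bar>\<Lambda> h\<bar> \<le> \<epsilon> * norm h"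
        using f2[OF h(1)] h(2) mult_right_mono[of "\<epsilon>/2" \<epsilon> "norm h"] \<epsilon> by (simp add: \<Lambda>_def)
    qed
    show "\<forall>\<eta>>0. \<exists>t>0. \<forall>\<xi>\<in>D\<inter>V. norm (\<xi> - w) < t \<longrightarrow> \<Lambda> (\<xi> - w) \<le> G \<xi> - G w + \<eta> * norm (\<xi> - w)"
    proof (intro allI impI)
      fix \<eta> :: real assume \<eta>: "\<eta> > 0"
      have pk: "\<eta> / (2 * K) > 0" "\<eta> / 2 > 0" using \<eta> K by auto
      obtain t1 where t1: "t1 > 0" "\<And>h. h \<in> V \<Longrightarrow> norm h < t1 \<Longrightarrow>
           M * \<sigma> ((1/\<delta>) *\<^sub>R (T w + h - 0)) \<le> M * \<sigma> ((1/\<delta>) *\<^sub>R (T w - 0)) + k h + \<eta> / (2 * K) * norm h"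
        using k(3) pk(1) by meson
      obtain t2 where t2: "t2 > 0" "\<And>h. h \<in> V \<Longrightarrow> norm h < t2 \<Longrightarrow> g (w + h) \<le> g w + f h + \<eta> / 2 * norm h"
        using f(3) pk(2) by meson
      define t where "t = Min {t1 / K, t2, r / 2}"
      show "\<exists>t>0. \<forall>\<xi>\<in>D\<inter>V. norm (\<xi> - w) < t \<longrightarrow> \<Lambda> (\<xi> - w) \<le> G \<xi> - G w + \<eta> * norm (\<xi> - w)"
      proof (intro exI[of _ t] conjI ballI impI)
        show "t > 0" using t1(1) t2(1) r K by (simp add: t_def)
        fix \<xi> assume \<xi>: "\<xi> \<in> D \<inter> V" "norm (\<xi> - w) < t"
        define h where "h = \<xi> - w"
        have h: "h \<in> V" "norm h < t1 / K" "norm h < t2" "norm h < r / 2"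
          using \<xi> wD V by (auto simp: h_def t_def subspace_diff)
        have "norm (\<xi> - wb) \<le> norm h + norm (w - wb)" using norm_triangle_ineq[of h "w - wb"] by (simp add: h_def)
        then have "\<xi> \<in> D'" using \<xi> h w(2) by (auto simp: D'_def dist_norm norm_minus_commute)
        from bspec[OF w(3) this] have 1: "\<Phi> w + g w \<le> \<Phi> \<xi> + g \<xi>" .
        have "norm (T h) < t1" using K(2)[of h] h(2) K(1) by (simp add: field_simps)
        then have "M * \<sigma> ((1/\<delta>) *\<^sub>R (T w + T h - 0)) \<le> M * \<sigma> ((1/\<delta>) *\<^sub>R (T w - 0)) + k (T h) + \<eta> / (2 * K) * norm (T h)"
          by (intro t1(2) T(2) h)
        moreover have "\<eta> / (2 * K) * norm (T h) \<le> \<eta> / (2 * K) * (norm h * K)" using K(2)[of h] pk by (intro mult_left_mono) auto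
        moreover have "\<eta> / (2 * K) * (norm h * K) = \<eta> / 2 * norm h" using K(1) by simp
        moreover have "T w + T h = T \<xi>" by (simp add: h_def Tdiff)
        moreover have "g \<xi> \<le> g w + f h + \<eta> / 2 * norm h" using t2(2)[OF h(1,3)] by (simp add: h_def)
        moreover have "\<eta> / 2 * norm h + \<eta> / 2 * norm h = \<eta> * norm h" by (simp add: field_simps)
        ultimately have "- k (T h) - f h \<le> G \<xi> - G w + \<eta> * norm h" using 1 unfolding \<Phi>_def by simp
        then show "\<Lambda> (\<xi> - w) \<le> G \<xi> - G w + \<eta> * norm (\<xi> - w)" by (simp add: \<Lambda>_def h_def)
      qed
    qed
  qed
qed

end

section \<open>Separable reduction\<close>

text \<open>These are the Frechet subgradients at \<open>w\<close> of \<open>G\<close> plus the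
  indicator function of \<open>D\<close>.\<close>

definition frechet_subgrad :: "'a::real_normed_vector set \<Rightarrow> ('a \<Rightarrow> real) \<Rightarrow> 'a \<Rightarrow> ('a \<Rightarrow>\<^sub>L real) set" where
  "frechet_subgrad D G w = {l. \<forall>\<eta>>0. \<exists>t>0. \<forall>\<xi>\<in>D. norm (\<xi> - w) < t \<longrightarrow>
     blinfun_apply l (\<xi> - w) \<le> G \<xi> - G w + \<eta> * norm (\<xi> - w)}"

locale separable_reduction =
  fixes G :: "'a::banach \<Rightarrow> real" and lG :: real and D :: "'a set" and T :: "'a \<Rightarrow> 'a" and \<epsilon> :: real
  assumes G_lip: "\<And>u v. \<bar>G u - G v\<bar> \<le> lG * norm (u - v)"
begin

text \<open>The atoms encode the inequalities that a functional must satisfy: those flagged \<open>True\<close> express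
  the Frechet inequality at \<open>w\<close> with tolerance \<open>1 / (i + 1)\<close>, those flagged \<open>False\<close> smallness on the kernel of \<open>T\<close>.\<close>

definition vec :: "'a \<Rightarrow> bool \<Rightarrow> 'a \<Rightarrow> 'a" where "vec w b x = (if b then x - w else x)"

definition cost :: "'a \<Rightarrow> bool \<Rightarrow> nat \<Rightarrow> 'a \<Rightarrow> real" where
  "cost w b i x = (if b then G x - G w + norm (x - w) / real (Suc i) else \<epsilon> * norm x)"

text \<open>The quantity whose nonnegativity \<open>functional_below_atoms\<close> demands, for one
  explicit convex combination of atoms.\<close>

definition total :: "real \<Rightarrow> 'a \<Rightarrow> nat \<Rightarrow> (nat \<Rightarrow> real) \<Rightarrow> (nat \<Rightarrow> nat) \<Rightarrow> (nat \<Rightarrow> 'a) \<Rightarrow> (nat \<Rightarrow> bool) \<Rightarrow> real" where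
  "total C w n u i x b = (\<Sum>j=1..n. u j * cost w (b j) (i j) (x j)) + C * norm (\<Sum>j=1..n. u j *\<^sub>R vec w (b j) (x j))"

text \<open>The admissible radii come from a finite list \<open>ms\<close>. A function assigning a
  radius to every tolerance would range over an uncountable set, and the closure process could not
  treat all of them.\<close>

definition violates :: "real \<Rightarrow> real \<Rightarrow> nat list \<Rightarrow> 'a \<Rightarrow> nat \<times> (nat \<Rightarrow> real) \<times> (nat \<Rightarrow> nat) \<times> (nat \<Rightarrow> 'a) \<times> (nat \<Rightarrow> bool) \<Rightarrow> bool" where
  "violates C \<kappa> ms w = (\<lambda>(n, u, i, x, b).
     (\<forall>j\<in>{1..n}. 0 \<le> u j) \<and> sum u {1..n} = 1 \<and>
     (\<forall>j\<in>{1..n}. if b j then x j \<in> D \<and> i j < length ms \<and> norm (x j - w) < 1 / (2 * real (Suc (ms ! i j))) else T (x j) = 0) \<and>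
     total C w n u i x b < - \<kappa>)"

text \<open>\<open>None\<close> closes the set under \<open>T\<close>. \<open>Some\<close> returns
  the \<open>j\<close>-th point of a violating family chosen for the base point \<open>w\<close>,
  and an arbitrary one if none exists. All indices are countable data; \<open>y\<close> is a dummy
  that fits the format of binary operations.\<close>

definition pick :: "(nat \<times> nat \<times> nat list \<times> nat) option \<Rightarrow> 'a \<Rightarrow> 'a \<Rightarrow> 'a" where
  "pick k w y = (case k of None \<Rightarrow> T w
     | Some (C, \<kappa>, ms, j) \<Rightarrow> (case SOME fam. violates (real C) (1 / real (Suc \<kappa>)) ms w fam of (n, u, i, x, b) \<Rightarrow> x j))"

text \<open>Allows the base point to move: the limit point \<open>w\<close> lies only in the closure
  of \<open>C0\<close>, whereas \<open>pick\<close> acts at points of \<open>C0\<close>. Since the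
  weights sum to 1, the constant does not depend on the family.\<close>

lemma total_lipschitz:
  assumes u: "\<forall>j\<in>{1..n}. 0 \<le> u j" "sum u {1..n} = 1" and C: "C \<ge> 0"
  shows "total C p n u i x b \<le> total C w n u i x b + (\<bar>lG\<bar> + 1 + C) * norm (p - w)"
proof -
  have c1: "cost p (b j) (i j) (x j) \<le> cost w (b j) (i j) (x j) + (\<bar>lG\<bar> + 1) * norm (p - w)" for j
  proof (cases "b j")
    case True
    have "G w - G p \<le> \<bar>lG\<bar> * norm (p - w)"
      using G_lip[of w p] mult_right_mono[OF abs_ge_self norm_ge_zero, of lG "w - p"]
      unfolding norm_minus_commute[of p w] by linarith
    moreover have "norm (x j - p) / real (Suc (i j)) \<le> norm (x j - w) / real (Suc (i j)) + norm (p - w)"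
    proof -
      have "norm (x j - p) \<le> norm (x j - w) + norm (p - w)"
        using norm_triangle_ineq4[of "x j - w" "p - w"] by simp
      then have "norm (x j - p) / real (Suc (i j)) \<le> (norm (x j - w) + norm (p - w)) / real (Suc (i j))"
        by (intro divide_right_mono) auto
      moreover have "norm (p - w) / real (Suc (i j)) \<le> norm (p - w)"
        using divide_left_mono[of 1 "real (Suc (i j))" "norm (p - w)"] by simp
      ultimately show ?thesis unfolding add_divide_distrib by linarith
    qed
    ultimately show ?thesis using True by (simp add: cost_def distrib_right)
  qed (simp add: cost_def)
  have "(\<Sum>j=1..n. u j * cost p (b j) (i j) (x j)) \<le> (\<Sum>j=1..n. u j * cost w (b j) (i j) (x j) + u j * ((\<bar>lG\<bar> + 1) * norm (p - w)))"
  proof (rule sum_mono)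
    fix j assume "j \<in> {1..n}"
    then have "u j * cost p (b j) (i j) (x j) \<le> u j * (cost w (b j) (i j) (x j) + (\<bar>lG\<bar> + 1) * norm (p - w))"
      using u c1 by (intro mult_left_mono) auto
    then show "u j * cost p (b j) (i j) (x j) \<le> u j * cost w (b j) (i j) (x j) + u j * ((\<bar>lG\<bar> + 1) * norm (p - w))"
      by (simp add: distrib_left)
  qed
  also have "\<dots> = (\<Sum>j=1..n. u j * cost w (b j) (i j) (x j)) + (\<bar>lG\<bar> + 1) * norm (p - w)"
    using u(2) by (simp only: sum.distrib flip: sum_distrib_right)
  finally have 1: "(\<Sum>j=1..n. u j * cost p (b j) (i j) (x j)) \<le> (\<Sum>j=1..n. u j * cost w (b j) (i j) (x j)) + (\<bar>lG\<bar> + 1) * norm (p - w)" .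
  have "norm ((\<Sum>j=1..n. u j *\<^sub>R vec p (b j) (x j)) - (\<Sum>j=1..n. u j *\<^sub>R vec w (b j) (x j)))
     \<le> (\<Sum>j=1..n. u j * norm (p - w))"
    unfolding sum_subtractf[symmetric]
  proof (rule sum_norm_le)
    fix j assume "j \<in> {1..n}"
    then have "0 \<le> u j" using u by blast
    then show "norm (u j *\<^sub>R vec p (b j) (x j) - u j *\<^sub>R vec w (b j) (x j)) \<le> u j * norm (p - w)"
      by (auto simp: vec_def norm_minus_commute simp flip: scaleR_diff_right)
  qed
  also have "\<dots> = norm (p - w)" using u(2) by (simp flip: sum_distrib_right)
  finally have "norm (\<Sum>j=1..n. u j *\<^sub>R vec p (b j) (x j)) \<le> norm (\<Sum>j=1..n. u j *\<^sub>R vec w (b j) (x j)) + norm (p - w)"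
    using norm_triangle_ineq2[of "\<Sum>j=1..n. u j *\<^sub>R vec p (b j) (x j)" "\<Sum>j=1..n. u j *\<^sub>R vec w (b j) (x j)"] by linarith
  then have "C * norm (\<Sum>j=1..n. u j *\<^sub>R vec p (b j) (x j)) \<le> C * norm (\<Sum>j=1..n. u j *\<^sub>R vec w (b j) (x j)) + C * norm (p - w)"
    using C mult_left_mono by (fastforce simp flip: distrib_left)
  with 1 show ?thesis unfolding total_def distrib_right by linarith
qed

text \<open>A violation at \<open>w\<close> by points of the whole space persists at a nearby
  \<open>p\<close> in \<open>C0\<close>; then \<open>pick\<close> provides a violation with all
  points in \<open>C0\<close>, and moving back to \<open>w\<close> contradicts the inequalities of
  \<open>l\<close> on \<open>V\<close>. The radii grow from a quarter through a half to the full
  one. The functional \<open>l'\<close> satisfies inequalities of the same kind as \<open>l\<close>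
  but need not extend it.\<close>

lemma no_violation_lifts:
  fixes C0 :: "'a set" and l :: "'a \<Rightarrow>\<^sub>L real" and C :: nat
  assumes closed_pick: "\<And>k x y. x \<in> C0 \<Longrightarrow> y \<in> C0 \<Longrightarrow> pick k x y \<in> C0"
    and V: "V = closure C0" "subspace V" and w: "w \<in> V"
    and lC: "\<And>h. h \<in> V \<Longrightarrow> \<bar>blinfun_apply l h\<bar> \<le> real C * norm h"
    and lF: "\<And>i \<xi>. \<xi> \<in> D \<Longrightarrow> \<xi> \<in> V \<Longrightarrow> norm (\<xi> - w) < 1 / real (Suc (m i)) \<Longrightarrow>
               blinfun_apply l (\<xi> - w) \<le> G \<xi> - G w + norm (\<xi> - w) / real (Suc i)"
    and lT: "\<And>h. h \<in> V \<Longrightarrow> T h = 0 \<Longrightarrow> blinfun_apply l h \<le> \<epsilon> * norm h"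
  obtains l' :: "'a \<Rightarrow>\<^sub>L real" where
    "\<And>i \<xi>. \<xi> \<in> D \<Longrightarrow> norm (\<xi> - w) < 1 / (4 * real (Suc (m i))) \<Longrightarrow>
               blinfun_apply l' (\<xi> - w) \<le> G \<xi> - G w + norm (\<xi> - w) / real (Suc i)"
    "\<And>h. T h = 0 \<Longrightarrow> blinfun_apply l' h \<le> \<epsilon> * norm h"
proof -
  define ok where "ok = (\<lambda>b i x. if b then x \<in> D \<and> norm (x - w) < 1 / (4 * real (Suc (m i))) else T x = 0)"
  define A where "A = {(vec w b x, cost w b i x) | b i x. ok b i x}"
  have C0V: "C0 \<subseteq> V" using V closure_subset by blast
  have pos: "0 \<le> c + real C * norm v" if vc: "(v, c) \<in> convex hull A" for v c
  proof (rule ccontr)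
    assume neg: "\<not> 0 \<le> c + real C * norm v"
    obtain n :: nat and u y where "(\<forall>j\<in>{1..n}. 0 \<le> u j \<and> y j \<in> A) \<and> sum u {1..n} = 1 \<and> (\<Sum>j=1..n. u j *\<^sub>R y j) = (v, c)"
      using vc unfolding convex_hull_indexed mem_Collect_eq by (elim exE)
    then have y: "\<forall>j\<in>{1..n}. 0 \<le> u j \<and> y j \<in> A" "sum u {1..n} = 1" "(\<Sum>j=1..n. u j *\<^sub>R y j) = (v, c)"
      by blast+
    have "\<forall>j. \<exists>b i x. j \<in> {1..n} \<longrightarrow> y j = (vec w b x, cost w b i x) \<and> ok b i x" using y(1) by (auto simp: A_def)
    then obtain b i x where bix: "\<And>j. j \<in> {1..n} \<Longrightarrow> y j = (vec w (b j) (x j), cost w (b j) (i j) (x j)) \<and> ok (b j) (i j) (x j)"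
      by metis
    have u: "\<forall>j\<in>{1..n}. 0 \<le> u j" using y by blast
    have "(\<Sum>j=1..n. u j *\<^sub>R vec w (b j) (x j)) = fst (\<Sum>j=1..n. u j *\<^sub>R y j)"
      unfolding fst_sum using bix by (intro sum.cong) auto
    then have v: "(\<Sum>j=1..n. u j *\<^sub>R vec w (b j) (x j)) = v" using y(3) by simp
    have "(\<Sum>j=1..n. u j * cost w (b j) (i j) (x j)) = snd (\<Sum>j=1..n. u j *\<^sub>R y j)"
      unfolding snd_sum using bix by (intro sum.cong) auto
    then have c: "(\<Sum>j=1..n. u j * cost w (b j) (i j) (x j)) = c" using y(3) by simp
    have tot: "total (real C) w n u i x b < 0" using neg v c by (simp add: total_def)
    then obtain k where k: "inverse (real (Suc k)) < - total (real C) w n u i x b / 3"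
      using reals_Archimedean[of "- total (real C) w n u i x b / 3"] by auto
    \<comment> \<open>The margin covers both moves: going to \<open>p\<close> costs at most
      \<open>\<kappa>\<close>, and a violation by \<open>\<kappa>\<close> there survives the way
      back.\<close>
    define \<kappa> where "\<kappa> = 1 / real (Suc k)"
    have \<kappa>: "\<kappa> > 0" "total (real C) w n u i x b < - 3 * \<kappa>" using k by (auto simp: \<kappa>_def field_simps)
    \<comment> \<open>A finite family uses finitely many tolerances, so recording the radii below
      \<open>N\<close> is enough.\<close>
    define N where "N = Suc (Max (insert 0 (i ` {1..n})))"
    have iN: "i j < N" if "j \<in> {1..n}" for j using that by (simp add: N_def less_Suc_eq_le)
    define ms where "ms = map m [0..<N]"
    define Lc where "Lc = \<bar>lG\<bar> + 1 + real C"
    have Lc: "Lc > 0" by (simp add: Lc_def add_pos_nonneg add_nonneg_pos)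
    \<comment> \<open>So small that changing the base point costs at most \<open>\<kappa>\<close> in
      \<open>total\<close> and at most a quarter of each recorded radius in distance.\<close>
    define \<eta> where "\<eta> = Min (insert (\<kappa> / Lc) ((\<lambda>i. 1 / (4 * real (Suc (m i)))) ` {..<N}))"
    have \<eta>: "\<eta> > 0" "\<eta> \<le> \<kappa> / Lc" "\<And>i. i < N \<Longrightarrow> \<eta> \<le> 1 / (4 * real (Suc (m i)))"
      using \<kappa> Lc by (auto simp: \<eta>_def)
    obtain p where p: "p \<in> C0" "norm (p - w) < \<eta>"
      using w \<eta>(1) unfolding V(1) closure_approachable dist_norm by blast
    have "Lc * norm (p - w) \<le> Lc * (\<kappa> / Lc)" using p(2) \<eta>(2) Lc by (intro mult_left_mono) auto
    then have Lp: "Lc * norm (p - w) \<le> \<kappa>" "Lc * norm (w - p) \<le> \<kappa>" using Lc by (simp_all add: norm_minus_commute)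
    have "total (real C) p n u i x b < - \<kappa>"
      using total_lipschitz[OF u y(2), of "real C" p i x b w] \<kappa> Lp(1) unfolding Lc_def by simp
    moreover have "if b j then x j \<in> D \<and> i j < length ms \<and> norm (x j - p) < 1 / (2 * real (Suc (ms ! i j))) else T (x j) = 0"
      if j: "j \<in> {1..n}" for j
    proof (cases "b j")
      case True
      have o: "x j \<in> D" "norm (x j - w) < 1 / (4 * real (Suc (m (i j))))" using bix[OF j] True by (auto simp: ok_def)
      have "norm (x j - p) \<le> norm (x j - w) + norm (p - w)" using norm_triangle_ineq4[of "x j - w" "p - w"] by simp
      also have "\<dots> < 1 / (4 * real (Suc (m (i j)))) + 1 / (4 * real (Suc (m (i j))))"
        using o p(2) \<eta>(3)[OF iN[OF j]] by linarith
      also have "\<dots> = 1 / (2 * real (Suc (m (i j))))" by (simp add: field_simps)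
      finally show ?thesis using True o iN[OF j] by (simp add: ms_def)
    next
      case False
      then show ?thesis using bix[OF j] by (auto simp: ok_def)
    qed
    ultimately have "violates (real C) \<kappa> ms p (n, u, i, x, b)" using u y(2) unfolding violates_def prod.case by blast
    \<comment> \<open>The violating family found at \<open>p\<close> only witnesses existence; the
      one that counts is the fixed choice made in \<open>pick\<close>, whose points lie in
      \<open>C0\<close>.\<close>
    then have viol: "violates (real C) \<kappa> ms p (SOME fam. violates (real C) \<kappa> ms p fam)" by (rule someI)
    obtain n' u' i' x' b' where fam: "(SOME fam. violates (real C) \<kappa> ms p fam) = (n', u', i', x', b')" by (metis surj_pair)
    have x'C: "x' j \<in> C0" for j
      using closed_pick[OF p(1) p(1), of "Some (C, k, ms, j)"] fam by (simp add: pick_def \<kappa>_def)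
    have v1: "\<forall>j\<in>{1..n'}. 0 \<le> u' j" "sum u' {1..n'} = 1" "total (real C) p n' u' i' x' b' < - \<kappa>"
      and v2: "\<And>j. j \<in> {1..n'} \<Longrightarrow> if b' j then x' j \<in> D \<and> i' j < length ms \<and> norm (x' j - p) < 1 / (2 * real (Suc (ms ! i' j))) else T (x' j) = 0"
      using viol[unfolded fam] unfolding violates_def prod.case by blast+
    have "total (real C) w n' u' i' x' b' < 0"
      using total_lipschitz[OF v1(1,2), of "real C" w i' x' b' p] v1(3) Lp(2) unfolding Lc_def by simp
    moreover have "total (real C) w n' u' i' x' b' \<ge> 0"
    proof -
      have vV: "vec w (b' j) (x' j) \<in> V" for j
        using subsetD[OF C0V x'C, of j] w V(2) by (simp add: vec_def subspace_diff)
      have lv: "blinfun_apply l (vec w (b' j) (x' j)) \<le> cost w (b' j) (i' j) (x' j)" if j: "j \<in> {1..n'}" for j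
      proof (cases "b' j")
        case True
        have o: "x' j \<in> D" "i' j < N" "norm (x' j - p) < 1 / (2 * real (Suc (m (i' j))))"
          using v2[OF j] True by (auto simp: ms_def)
        have "norm (x' j - w) \<le> norm (x' j - p) + norm (p - w)" using norm_triangle_ineq[of "x' j - p" "p - w"] by simp
        also have "\<dots> < 1 / (2 * real (Suc (m (i' j)))) + 1 / (4 * real (Suc (m (i' j))))"
          using o p(2) \<eta>(3)[OF o(2)] by linarith
        also have "\<dots> \<le> 1 / real (Suc (m (i' j)))" by (simp add: divide_simps del: of_nat_Suc)
        finally show ?thesis using True lF[OF o(1) subsetD[OF C0V x'C]] by (simp add: vec_def cost_def)
      next
        case False
        then show ?thesis using v2[OF j] lT[OF subsetD[OF C0V x'C]] by (simp add: vec_def cost_def)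
      qed
      define s where "s = (\<Sum>j=1..n'. u' j *\<^sub>R vec w (b' j) (x' j))"
      have sV: "s \<in> V" unfolding s_def using vV V(2) by (intro subspace_sum) (auto simp: subspace_scale)
      have "blinfun_apply l s = (\<Sum>j=1..n'. u' j * blinfun_apply l (vec w (b' j) (x' j)))"
        by (simp add: s_def blinfun.sum_right blinfun.scaleR_right)
      also have "\<dots> \<le> (\<Sum>j=1..n'. u' j * cost w (b' j) (i' j) (x' j))"
        using v1(1) lv by (intro sum_mono mult_left_mono) auto
      finally show ?thesis using lC[OF sV] unfolding total_def s_def[symmetric] by linarith
    qed
    ultimately show False by simp
  qed
  obtain l' :: "'a \<Rightarrow>\<^sub>L real" where l': "\<And>v c. (v, c) \<in> A \<Longrightarrow> blinfun_apply l' v \<le> c"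
    using functional_below_atoms[of "real C" A, OF _ pos] by (metis of_nat_0_le_iff)
  show ?thesis
  proof (rule that[of l'])
    fix i \<xi> assume "\<xi> \<in> D" "norm (\<xi> - w) < 1 / (4 * real (Suc (m i)))"
    then have "(vec w True \<xi>, cost w True i \<xi>) \<in> A" unfolding A_def ok_def by auto
    from l'[OF this] show "blinfun_apply l' (\<xi> - w) \<le> G \<xi> - G w + norm (\<xi> - w) / real (Suc i)"
      by (simp add: vec_def cost_def)
  next
    fix h assume "T h = 0"
    then have "(vec w False h, cost w False 0 h) \<in> A" unfolding A_def ok_def by auto
    from l'[OF this] show "blinfun_apply l' h \<le> \<epsilon> * norm h" by (simp add: vec_def cost_def)
  qed
qed

end

text \<open>The subspace is generated before \<open>w\<close>, the functional and its radii are
  known. It is closed under \<open>pick\<close> for all natural bounds and all lists of radii, so it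
  anticipates whatever the rule in the subspace returns.\<close>

theorem asplund_fuzzy_rule:
  fixes G :: "'a::banach \<Rightarrow> real" and T :: "'a \<Rightarrow> 'a"
  assumes asp: "asplund TYPE('a)" and T: "bounded_linear T"
    and G: "\<And>u v. \<bar>G u - G v\<bar> \<le> lG * norm (u - v)" and D: "closed D"
    and wb: "wb \<in> D" "T wb = 0" and l: "l \<ge> 0" and \<epsilon>: "\<epsilon> > 0"
    and min: "\<And>\<eta>. \<eta> > 0 \<Longrightarrow> \<exists>R>0. \<forall>\<xi>\<in>D. norm (\<xi> - wb) < R \<longrightarrow> G wb \<le> G \<xi> + l * norm (T \<xi>) + \<eta> * norm (\<xi> - wb)"
  obtains w \<Lambda> where "w \<in> D" "norm (w - wb) < \<epsilon>" "\<Lambda> \<in> frechet_subgrad D G w"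
    "\<forall>h. T h = 0 \<longrightarrow> \<bar>blinfun_apply \<Lambda> h\<bar> \<le> \<epsilon> * norm h"
proof -
  interpret separable_reduction G lG D T \<epsilon> by standard (rule G)
  obtain C0 where C0: "countable C0" "{wb} \<subseteq> C0" "\<And>k x y. x \<in> C0 \<Longrightarrow> y \<in> C0 \<Longrightarrow> pick k x y \<in> C0"
    "subspace (closure C0)" "separable_set (closure C0)"
    using separable_closed_hull[of "{wb}" pick] by auto
  define V where "V = closure C0"
  have V: "subspace V" "closed V" "separable_set V" using C0 by (auto simp: V_def)
  then have sd: "separable_dual V" using asp by (auto simp: asplund_def)
  obtain \<sigma> :: "'a \<Rightarrow> real" and A where \<sigma>: "A > 0" "\<sigma> 0 = 0" "\<forall>v\<in>V. 0 \<le> \<sigma> v"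
    "\<forall>v\<in>V. norm v \<ge> 1 \<longrightarrow> 1 \<le> \<sigma> v"
    "\<forall>u\<in>V. \<forall>v\<in>V. \<bar>\<sigma> u - \<sigma> v\<bar> \<le> A * norm (u - v)"
    "\<forall>v\<in>V. \<exists>f. linear_on_set V f \<and>
        (\<forall>h\<in>V. \<bar>f h\<bar> \<le> A * norm h) \<and>
        superdiff_on V \<sigma> v f"
    by (rule smooth_bump[OF V(1,3) sd])
  interpret smooth_bump_space V \<sigma> A
    by unfold_locales (use V \<sigma> in blast)+
  have "T x \<in> C0" if "x \<in> C0" for x using C0(3)[OF that that, of None] by (simp add: pick_def)
  then have "T ` V \<subseteq> V"
    unfolding V_def using closure_subset[of C0] bounded_linear.linear[OF T]
    by (intro image_closure_subset linear_continuous_on T) auto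
  then have TV: "\<And>v. v \<in> V \<Longrightarrow> T v \<in> V" by blast
  have wbV: "wb \<in> V" using C0(2) closure_subset by (auto simp: V_def)
  obtain w \<Lambda> C where w: "w \<in> D" "w \<in> V" "norm (w - wb) < \<epsilon>"
    and \<Lambda>: "linear_on_set V \<Lambda>" "\<forall>h\<in>V. \<bar>\<Lambda> h\<bar> \<le> C * norm h"
    "\<forall>\<eta>>0. \<exists>t>0. \<forall>\<xi>\<in>D\<inter>V. norm (\<xi> - w) < t \<longrightarrow> \<Lambda> (\<xi> - w) \<le> G \<xi> - G w + \<eta> * norm (\<xi> - w)"
    "\<forall>h\<in>V. T h = 0 \<longrightarrow> \<bar>\<Lambda> h\<bar> \<le> \<epsilon> * norm h"
    by (rule fuzzy_rule_in_subspace[OF T TV G D wb(1) wbV wb(2) l \<epsilon> min])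
  have "bdd_lin_on V \<Lambda>" using \<Lambda>(1,2) unfolding bdd_lin_on_def by blast
  \<comment> \<open>An auxiliary extension to the type of bounded functionals; only its values on
    \<open>V\<close> are used.\<close>
  then obtain \<mu> :: "'a \<Rightarrow>\<^sub>L real" where \<mu>: "\<And>h. h \<in> V \<Longrightarrow> blinfun_apply \<mu> h = \<Lambda> h"
    using bdd_lin_on_extend[OF V(1)] by blast
  \<comment> \<open>\<open>pick\<close> knows natural bounds only, so the norm bound is rounded
    up.\<close>
  obtain C' :: nat where C': "C \<le> real C'" using real_arch_simple by blast
  have \<mu>C: "\<bar>blinfun_apply \<mu> h\<bar> \<le> real C' * norm h" if "h \<in> V" for h
    using \<Lambda>(2) that C' mult_right_mono[OF C', of "norm h"] \<mu>[OF that] by fastforce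
  have "\<exists>m::nat. \<forall>\<xi>\<in>D\<inter>V. norm (\<xi> - w) < 1 / real (Suc m) \<longrightarrow> \<Lambda> (\<xi> - w) \<le> G \<xi> - G w + 1 / real (Suc i) * norm (\<xi> - w)" for i
  proof -
    have "1 / real (Suc i) > 0" by simp
    then obtain t where t: "t > 0" "\<forall>\<xi>\<in>D\<inter>V. norm (\<xi> - w) < t \<longrightarrow> \<Lambda> (\<xi> - w) \<le> G \<xi> - G w + 1 / real (Suc i) * norm (\<xi> - w)"
      using \<Lambda>(3) by blast
    obtain m where "inverse (real (Suc m)) < t" using reals_Archimedean[OF t(1)] by blast
    then show ?thesis using t(2) by (intro exI[of _ m]) (auto simp: inverse_eq_divide)
  qed
  then obtain m :: "nat \<Rightarrow> nat" where m: "\<And>i. \<forall>\<xi>\<in>D\<inter>V. norm (\<xi> - w) < 1 / real (Suc (m i)) \<longrightarrow> \<Lambda> (\<xi> - w) \<le> G \<xi> - G w + 1 / real (Suc i) * norm (\<xi> - w)"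
    by metis
  have \<mu>F: "blinfun_apply \<mu> (\<xi> - w) \<le> G \<xi> - G w + norm (\<xi> - w) / real (Suc i)"
    if "\<xi> \<in> D" "\<xi> \<in> V" "norm (\<xi> - w) < 1 / real (Suc (m i))" for i \<xi>
    using m[of i] that \<mu>[OF subspace_diff[OF V(1) that(2) w(2)]] by auto
  have \<mu>T: "blinfun_apply \<mu> h \<le> \<epsilon> * norm h" if "h \<in> V" "T h = 0" for h
    using \<Lambda>(4) that \<mu>[OF that(1)] by (auto simp: abs_le_iff)
  obtain l' :: "'a \<Rightarrow>\<^sub>L real" where l':
    "\<And>i \<xi>. \<xi> \<in> D \<Longrightarrow> norm (\<xi> - w) < 1 / (4 * real (Suc (m i))) \<Longrightarrow>
               blinfun_apply l' (\<xi> - w) \<le> G \<xi> - G w + norm (\<xi> - w) / real (Suc i)"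
    "\<And>h. T h = 0 \<Longrightarrow> blinfun_apply l' h \<le> \<epsilon> * norm h"
    using no_violation_lifts[OF C0(3) V_def V(1) w(2) \<mu>C \<mu>F \<mu>T] by blast
  show ?thesis
  proof (rule that[OF w(1) w(3), of l'])
    show "l' \<in> frechet_subgrad D G w" unfolding frechet_subgrad_def
    proof (intro CollectI allI impI)
      fix \<eta> :: real assume "\<eta> > 0"
      then obtain i where i: "inverse (real (Suc i)) < \<eta>" using reals_Archimedean by blast
      show "\<exists>t>0. \<forall>\<xi>\<in>D. norm (\<xi> - w) < t \<longrightarrow> blinfun_apply l' (\<xi> - w) \<le> G \<xi> - G w + \<eta> * norm (\<xi> - w)"
      proof (intro exI[of _ "1 / (4 * real (Suc (m i)))"] conjI ballI impI)
        fix \<xi> assume "\<xi> \<in> D" "norm (\<xi> - w) < 1 / (4 * real (Suc (m i)))"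
        from l'(1)[OF this] show "blinfun_apply l' (\<xi> - w) \<le> G \<xi> - G w + \<eta> * norm (\<xi> - w)"
          using mult_right_mono[of "inverse (real (Suc i))" \<eta> "norm (\<xi> - w)"] i
          by (simp add: divide_inverse mult.commute)
      qed simp
    qed
    show "\<forall>h. T h = 0 \<longrightarrow> \<bar>blinfun_apply l' h\<bar> \<le> \<epsilon> * norm h"
    proof (intro allI impI)
      fix h assume h: "T h = 0"
      have "T (- h) = 0" using h T by (simp add: linear_simps)
      then show "\<bar>blinfun_apply l' h\<bar> \<le> \<epsilon> * norm h"
        using l'(2)[OF h] l'(2)[of "- h"] by (simp add: blinfun.minus_right)
    qed
  qed
qed

section \<open>Fuzzy multipliers\<close>

text \<open>McShane's formula.\<close>

lemma lipschitz_extension: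
  fixes f :: "'a::real_normed_vector \<Rightarrow> real"
  assumes B: "B \<noteq> {}" and l: "l \<ge> 0" and f: "\<And>u v. u \<in> B \<Longrightarrow> v \<in> B \<Longrightarrow> \<bar>f u - f v\<bar> \<le> l * norm (u - v)"
  obtains g where "\<And>u v. \<bar>g u - g v\<bar> \<le> l * norm (u - v)" "\<And>x. x \<in> B \<Longrightarrow> g x = f x"
proof -
  define g where "g = (\<lambda>x. INF b\<in>B. f b + l * norm (x - b))"
  obtain b0 where b0: "b0 \<in> B" using B by blast
  have bdd: "bdd_below ((\<lambda>b. f b + l * norm (x - b)) ` B)" for x
  proof (rule bdd_belowI2)
    fix b assume b: "b \<in> B"
    have "norm (b0 - b) \<le> norm (x - b0) + norm (x - b)"
      using norm_triangle_ineq4[of "x - b" "x - b0"] by simp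
    then have "l * norm (b0 - b) \<le> l * norm (x - b0) + l * norm (x - b)"
      using l mult_left_mono by (fastforce simp flip: distrib_left)
    then show "f b0 - l * norm (x - b0) \<le> f b + l * norm (x - b)" using f[OF b0 b] by linarith
  qed
  have le: "g u \<le> g v + l * norm (u - v)" for u v
  proof -
    have "g u - l * norm (u - v) \<le> g v" unfolding g_def[THEN fun_cong, of v]
    proof (rule cINF_greatest[OF B])
      fix b assume b: "b \<in> B"
      have "g u \<le> f b + l * norm (u - b)" unfolding g_def by (rule cINF_lower[OF bdd b])
      also have "l * norm (u - b) \<le> l * norm (u - v) + l * norm (v - b)"
        using l mult_left_mono[OF norm_triangle_ineq[of "u - v" "v - b"], of l] by (simp add: distrib_left)
      finally show "g u - l * norm (u - v) \<le> f b + l * norm (v - b)" by simp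
    qed
    then show ?thesis by simp
  qed
  show ?thesis
  proof (rule that[of g])
    fix u v show "\<bar>g u - g v\<bar> \<le> l * norm (u - v)" using le[of u v] le[of v u] by (simp add: norm_minus_commute abs_le_iff)
  next
    fix x assume x: "x \<in> B"
    have "g x \<le> f x" using cINF_lower[OF bdd x, of x] by (simp add: g_def)
    moreover have "f x \<le> g x" unfolding g_def using f[OF x] B by (intro cINF_greatest) fastforce+
    ultimately show "g x = f x" by simp
  qed
qed

text \<open>Subgradients depend only on values near the point, so \<open>G\<close> may be replaced
  by a global Lipschitz extension, provided the accuracy also keeps \<open>w\<close> inside the
  ball.\<close>

theorem asplund_fuzzy_rule_local:
  fixes G :: "'a::banach \<Rightarrow> real" and T :: "'a \<Rightarrow> 'a"
  assumes asp: "asplund TYPE('a)" and T: "bounded_linear T"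
    and R0: "R0 > 0" and lG: "lG \<ge> 0"
    and G: "\<And>u v. u \<in> ball wb R0 \<Longrightarrow> v \<in> ball wb R0 \<Longrightarrow> \<bar>G u - G v\<bar> \<le> lG * norm (u - v)" and D: "closed D"
    and wb: "wb \<in> D" "T wb = 0" and l: "l \<ge> 0" and \<epsilon>: "\<epsilon> > 0"
    and min: "\<And>\<eta>. \<eta> > 0 \<Longrightarrow> \<exists>R>0. \<forall>\<xi>\<in>D. norm (\<xi> - wb) < R \<longrightarrow> G wb \<le> G \<xi> + l * norm (T \<xi>) + \<eta> * norm (\<xi> - wb)"
  obtains w \<Lambda> where "w \<in> D" "norm (w - wb) < \<epsilon>" "norm (w - wb) < R0" "\<Lambda> \<in> frechet_subgrad D G w"
    "\<forall>h. T h = 0 \<longrightarrow> \<bar>blinfun_apply \<Lambda> h\<bar> \<le> \<epsilon> * norm h"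
proof -
  have ne: "ball wb R0 \<noteq> {}" using R0 by simp
  obtain G' where G': "\<And>u v. \<bar>G' u - G' v\<bar> \<le> lG * norm (u - v)" "\<And>x. x \<in> ball wb R0 \<Longrightarrow> G' x = G x"
    using lipschitz_extension[OF ne lG G] by blast
  have min': "\<exists>R>0. \<forall>\<xi>\<in>D. norm (\<xi> - wb) < R \<longrightarrow> G' wb \<le> G' \<xi> + l * norm (T \<xi>) + \<eta> * norm (\<xi> - wb)" if "\<eta> > 0" for \<eta>
  proof -
    from min[OF \<open>\<eta> > 0\<close>] obtain R where R: "R > 0" "\<forall>\<xi>\<in>D. norm (\<xi> - wb) < R \<longrightarrow> G wb \<le> G \<xi> + l * norm (T \<xi>) + \<eta> * norm (\<xi> - wb)"
      by blast
    show ?thesis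
      using R R0 G'(2) by (intro exI[of _ "min R R0"]) (auto simp: dist_norm norm_minus_commute)
  qed
  have m: "min \<epsilon> R0 > 0" using \<epsilon> R0 by simp
  obtain w \<Lambda> where w: "w \<in> D" "norm (w - wb) < min \<epsilon> R0" "\<Lambda> \<in> frechet_subgrad D G' w"
    "\<forall>h. T h = 0 \<longrightarrow> \<bar>blinfun_apply \<Lambda> h\<bar> \<le> min \<epsilon> R0 * norm h"
    by (rule asplund_fuzzy_rule[OF asp T G'(1) D wb l m min'])
  have "\<Lambda> \<in> frechet_subgrad D G w" unfolding frechet_subgrad_def
  proof (intro CollectI allI impI)
    fix \<eta> :: real assume "\<eta> > 0"
    then obtain t where t: "t > 0" "\<forall>\<xi>\<in>D. norm (\<xi> - w) < t \<longrightarrow> blinfun_apply \<Lambda> (\<xi> - w) \<le> G' \<xi> - G' w + \<eta> * norm (\<xi> - w)"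
      using w(3) unfolding frechet_subgrad_def by blast
    show "\<exists>t>0. \<forall>\<xi>\<in>D. norm (\<xi> - w) < t \<longrightarrow> blinfun_apply \<Lambda> (\<xi> - w) \<le> G \<xi> - G w + \<eta> * norm (\<xi> - w)"
    proof (intro exI[of _ "min t (R0 - norm (w - wb))"] conjI ballI impI)
      show "0 < min t (R0 - norm (w - wb))" using t w by simp
      fix \<xi> assume \<xi>: "\<xi> \<in> D" "norm (\<xi> - w) < min t (R0 - norm (w - wb))"
      have "norm (\<xi> - wb) \<le> norm (\<xi> - w) + norm (w - wb)" using norm_triangle_ineq[of "\<xi> - w" "w - wb"] by simp
      then have "\<xi> \<in> ball wb R0" "w \<in> ball wb R0" using \<xi> w(2) by (auto simp: dist_norm norm_minus_commute)
      then show "blinfun_apply \<Lambda> (\<xi> - w) \<le> G \<xi> - G w + \<eta> * norm (\<xi> - w)" using t(2) \<xi> G'(2) by auto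
    qed
  qed
  moreover have "\<forall>h. T h = 0 \<longrightarrow> \<bar>blinfun_apply \<Lambda> h\<bar> \<le> \<epsilon> * norm h"
    using w(4) mult_right_mono[of "min \<epsilon> R0" \<epsilon>] by (meson min.cobounded1 norm_ge_zero order_trans)
  ultimately show ?thesis using w(1,2) by (intro that[of w \<Lambda>]) auto
qed

text \<open>The subgradient inequality on a short segment in direction \<open>h\<close>, divided by
  the step length, leaves \<open>c\<close> plus an arbitrarily small multiple of
  \<open>norm h\<close>.\<close>

lemma frechet_subgrad_directional:
  assumes \<Lambda>: "\<Lambda> \<in> frechet_subgrad D G w" and \<tau>: "\<tau> > 0"
    and dir: "\<And>t. 0 < t \<Longrightarrow> t < \<tau> \<Longrightarrow> w + t *\<^sub>R h \<in> D \<and> G (w + t *\<^sub>R h) - G w \<le> t * c"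
  shows "blinfun_apply \<Lambda> h \<le> c"
proof (rule field_le_epsilon)
  fix e :: real assume e: "e > 0"
  define \<eta> where "\<eta> = e / (norm h + 1)"
  have \<eta>: "\<eta> > 0" using e by (simp add: \<eta>_def add_nonneg_pos)
  have \<eta>h: "\<eta> * norm h \<le> e" using e by (simp add: \<eta>_def pos_divide_le_eq add_nonneg_pos distrib_left)
  obtain t where t: "t > 0" "\<And>\<xi>. \<xi> \<in> D \<Longrightarrow> norm (\<xi> - w) < t \<Longrightarrow> blinfun_apply \<Lambda> (\<xi> - w) \<le> G \<xi> - G w + \<eta> * norm (\<xi> - w)"
    using \<Lambda> \<eta> unfolding frechet_subgrad_def by blast
  define s where "s = min (\<tau> / 2) (t / (norm h + 1))"
  have s: "0 < s" "s < \<tau>" using \<tau> t by (auto simp: s_def add_nonneg_pos min_less_iff_disj)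
  have "s * (norm h + 1) \<le> t" using min.cobounded2[of "\<tau> / 2" "t / (norm h + 1)"] unfolding s_def[symmetric]
    by (simp add: pos_le_divide_eq add_nonneg_pos)
  then have "norm (w + s *\<^sub>R h - w) < t" using s by (simp add: distrib_left)
  then have "s * blinfun_apply \<Lambda> h \<le> s * c + \<eta> * (s * norm h)"
    using t(2)[of "w + s *\<^sub>R h"] dir[OF s] s by (simp add: blinfun.scaleR_right)
  then have "s * blinfun_apply \<Lambda> h \<le> s * (c + \<eta> * norm h)" by (simp add: algebra_simps)
  then have "blinfun_apply \<Lambda> h \<le> c + \<eta> * norm h" using s by simp
  then show "blinfun_apply \<Lambda> h \<le> c + e" using \<eta>h by simp
qed

lemma blinfun_compose_ex:
  fixes l :: "'b::real_normed_vector \<Rightarrow>\<^sub>L real" and f :: "'a::real_normed_vector \<Rightarrow> 'b"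
  assumes "bounded_linear f"
  obtains m :: "'a \<Rightarrow>\<^sub>L real" where "\<And>a. blinfun_apply m a = blinfun_apply l (f a)"
proof -
  have "bounded_linear (\<lambda>a. blinfun_apply l (f a))"
    by (rule bounded_linear_compose[OF blinfun.bounded_linear_right assms])
  then show ?thesis using that[of "Blinfun (\<lambda>a. blinfun_apply l (f a))"] by (simp add: bounded_linear_Blinfun_apply)
qed

lemma norm_pair_components:
  "norm a \<le> norm (((a, b), (c, d)), (e, f))" "norm b \<le> norm (((a, b), (c, d)), (e, f))"
  "norm c \<le> norm (((a, b), (c, d)), (e, f))" "norm d \<le> norm (((a, b), (c, d)), (e, f))"
  "norm e \<le> norm (((a, b), (c, d)), (e, f))" "norm f \<le> norm (((a, b), (c, d)), (e, f))"
  by (meson norm_fst_le norm_snd_le order_trans)+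

text \<open>The coordinates are \<open>(u, y)\<close> on the graph, \<open>(x, y2)\<close> for
  \<open>h\<close> and the penalty, and \<open>(z, z2)\<close> for \<open>s\<close> and the value of
  \<open>h\<close>. The hypothesis \<open>pen\<close> says that the coupled function is nonnegative;
  decoupling costs a multiple of the constraint violation.\<close>

lemma fuzzy_multipliers:
  fixes h :: "'x::banach \<Rightarrow> 'z::banach" and F :: "'x \<Rightarrow> 'y::banach set" and s :: "'z \<Rightarrow> real"
  assumes asp: "asplund TYPE('x)" "asplund TYPE('y)" "asplund TYPE('z)"
    and s: "sublinear s" "\<And>z. s z \<le> ls * norm z" and ls: "ls \<ge> 0"
    and R0: "R0 > 0" and L: "L \<ge> 0" and h: "\<And>x u. x \<in> ball xb R0 \<Longrightarrow> u \<in> ball xb R0 \<Longrightarrow> norm (h x - h u) \<le> L * norm (x - u)"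
    and hxb: "h xb = 0" and F: "closed (graph_of F)" "0 \<in> F xb" and c: "c \<ge> 0"
    and pen: "\<And>x y. y \<in> F x \<Longrightarrow> x \<in> ball xb R0 \<Longrightarrow> - c * norm y \<le> s (h x)" and \<epsilon>: "\<epsilon> > 0"
  obtains x u y zs zt xs us ys N where
    "norm (x - xb) < \<epsilon>" "x \<in> ball xb R0" "norm (u - xb) < \<epsilon>" "norm y < \<epsilon>" "y \<in> F u"
    "xs \<in> frechet_subgrad UNIV (\<lambda>x. blinfun_apply zs (h x)) x"
    "\<forall>z. blinfun_apply zt z \<le> s z" "norm (zs - zt) \<le> 2 * \<epsilon>"
    "norm (xs + us) \<le> 2 * \<epsilon>" "norm xs \<le> 2 * ls + ls * L + c" "norm ys \<le> 2 * ls + ls * L + c + 2 * \<epsilon>"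
    "N \<in> frechet_normal (graph_of F) (u, y)" "\<forall>a b. blinfun_apply N (a, b) = blinfun_apply us a + blinfun_apply ys b"
proof -
  \<comment> \<open>The fuzzy rule takes an endomorphism, so the three differences are padded with
    zeros.\<close>
  define T :: "(('x \<times> 'y) \<times> ('x \<times> 'y)) \<times> ('z \<times> 'z) \<Rightarrow> (('x \<times> 'y) \<times> ('x \<times> 'y)) \<times> ('z \<times> 'z)" where
    "T = (\<lambda>w. (((fst (fst (fst w)) - fst (snd (fst w)), snd (fst (fst w)) - snd (snd (fst w))), (0, 0)), (fst (snd w) - snd (snd w), 0)))"
  have T_apply: "T (((u, y), (x, y2)), (z, z2)) = (((u - x, y - y2), (0, 0)), (z - z2, 0))" for u y x y2 z z2
    by (simp add: T_def)
  have T: "bounded_linear T" unfolding T_def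
    by (intro bounded_linear_Pair bounded_linear_sub bounded_linear_zero
        bounded_linear_fst_comp bounded_linear_snd_comp bounded_linear_fst bounded_linear_snd bounded_linear_ident)
  define G :: "(('x \<times> 'y) \<times> ('x \<times> 'y)) \<times> ('z \<times> 'z) \<Rightarrow> real" where
    "G = (\<lambda>(((u, y), (x, y2)), (z, z2)). s z + ls * norm (z2 - h x) + c * norm y2)"
  define D :: "((('x \<times> 'y) \<times> ('x \<times> 'y)) \<times> ('z \<times> 'z)) set" where "D = {w. fst (fst w) \<in> graph_of F}"
  have D: "closed D"
  proof -
    have "D = (\<lambda>w. fst (fst w)) -` graph_of F" by (auto simp: D_def)
    then show ?thesis using F(1) by (simp add: continuous_closed_vimage continuous_intros)
  qed
  define wb :: "(('x \<times> 'y) \<times> ('x \<times> 'y)) \<times> ('z \<times> 'z)" where "wb = (((xb, 0), (xb, 0)), (0, 0))"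
  have wb: "wb \<in> D" "T wb = 0" using F(2) by (auto simp: wb_def D_def graph_of_def T_apply zero_prod_def)
  have slip: "s a \<le> s b + ls * norm (a - b)" for a b
    using sublinear_add[OF s(1), of b "a - b"] s(2)[of "a - b"] by simp
  define lG where "lG = 2 * ls + ls * L + c"
  have lG: "lG \<ge> 0" using ls L c by (simp add: lG_def)
  have Gle: "G a \<le> G b + lG * norm (a - b)" if ab: "a \<in> ball wb R0" "b \<in> ball wb R0" for a b
  proof -
    obtain u y x y2 z z2 where a: "a = (((u, y), (x, y2)), (z, z2))" by (metis surj_pair)
    obtain u' y' x' y2' z' z2' where b: "b = (((u', y'), (x', y2')), (z', z2'))" by (metis surj_pair)
    define n where "n = norm (a - b)"
    have ab': "a - b = (((u - u', y - y'), (x - x', y2 - y2')), (z - z', z2 - z2'))" by (simp add: a b)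
    have n: "norm (x - x') \<le> n" "norm (y2 - y2') \<le> n" "norm (z - z') \<le> n" "norm (z2 - z2') \<le> n"
      unfolding n_def ab' by (rule norm_pair_components)+
    have "norm (x - xb) \<le> norm (a - wb)" "norm (x' - xb) \<le> norm (b - wb)"
      unfolding a b wb_def by (simp_all add: norm_pair_components)
    then have xx: "x \<in> ball xb R0" "x' \<in> ball xb R0" using ab by (auto simp: dist_norm norm_minus_commute)
    have "s z \<le> s z' + ls * n" using slip[of z z'] mult_left_mono[OF n(3) ls] by linarith
    moreover have "ls * norm (z2 - h x) \<le> ls * norm (z2' - h x') + ls * n + ls * L * n"
    proof -
      have "norm (z2 - h x) \<le> norm (z2' - h x') + norm (z2 - z2') + norm (h x - h x')"
        using norm_triangle_ineq4[of "(z2' - h x') + (z2 - z2')" "h x - h x'"] norm_triangle_ineq[of "z2' - h x'" "z2 - z2'"]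
        by (simp add: algebra_simps)
      also have "\<dots> \<le> norm (z2' - h x') + n + L * n"
        using n(4) h[OF xx] mult_left_mono[OF n(1) L] by linarith
      finally show ?thesis using mult_left_mono[OF _ ls] by (fastforce simp: algebra_simps)
    qed
    moreover have "c * norm y2 \<le> c * norm y2' + c * n"
      using mult_left_mono[of "norm y2" "norm y2' + n" c] c n(2) norm_triangle_ineq2[of y2 y2'] by (simp add: distrib_left)
    ultimately show ?thesis unfolding n_def[symmetric] by (simp add: G_def a b lG_def algebra_simps)
  qed
  then have G: "\<bar>G a - G b\<bar> \<le> lG * norm (a - b)" if "a \<in> ball wb R0" "b \<in> ball wb R0" for a b
    using Gle[OF that] Gle[OF that(2,1)] by (simp add: abs_le_iff norm_minus_commute)
  \<comment> \<open>Passing from the coupled to the decoupled function exchanges \<open>z2\<close>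
    for \<open>z\<close> at cost \<open>ls\<close>, \<open>u\<close> for \<open>x\<close> at cost
    \<open>ls * L\<close>, and \<open>y\<close> for \<open>y2\<close> at cost \<open>c\<close>, each
    times \<open>norm (T \<xi>)\<close>.\<close>
  define l where "l = ls + ls * L + c"
  have l: "l \<ge> 0" using ls L c by (simp add: l_def)
  have Gwb: "G wb = 0" by (simp add: G_def wb_def hxb sublinear_zero[OF s(1)])
  have G0: "G wb \<le> G \<xi> + l * norm (T \<xi>)" if \<xi>: "\<xi> \<in> D" "norm (\<xi> - wb) < R0" for \<xi>
  proof -
    obtain u y x y2 z z2 where e: "\<xi> = (((u, y), (x, y2)), (z, z2))" by (metis surj_pair)
    have "norm (u - xb) \<le> norm (\<xi> - wb)" "norm (x - xb) \<le> norm (\<xi> - wb)"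
      unfolding e wb_def by (simp_all add: norm_pair_components)
    then have ux: "u \<in> ball xb R0" "x \<in> ball xb R0" using \<xi>(2) by (auto simp: dist_norm norm_minus_commute)
    have yF: "y \<in> F u" using \<xi>(1) by (simp add: D_def e graph_of_def)
    define n where "n = norm (T \<xi>)"
    have n: "norm (u - x) \<le> n" "norm (y - y2) \<le> n" "norm (z - z2) \<le> n"
      unfolding n_def e T_apply by (rule norm_pair_components)+
    have "- c * norm y \<le> s (h u)" by (rule pen[OF yF ux(1)])
    moreover have "s (h u) \<le> s (h x) + ls * L * n"
    proof -
      have "norm (h u - h x) \<le> L * n" using h[OF ux] mult_left_mono[OF n(1) L] by linarith
      then show ?thesis using slip[of "h u" "h x"] mult_left_mono[OF _ ls] by (fastforce simp: mult.assoc)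
    qed
    moreover have "s (h x) \<le> s z2 + ls * norm (z2 - h x)" using slip[of "h x" z2] by (simp add: norm_minus_commute)
    moreover have "s z2 \<le> s z + ls * n" using slip[of z2 z] mult_left_mono[OF n(3) ls] by (simp add: norm_minus_commute)
    moreover have "c * norm y \<le> c * norm y2 + c * n"
      using mult_left_mono[of "norm y" "norm y2 + n" c] c n(2) norm_triangle_ineq2[of y y2] by (simp add: distrib_left)
    ultimately show ?thesis unfolding Gwb n_def[symmetric] by (simp add: G_def e l_def distrib_right)
  qed
  have min: "\<exists>R>0. \<forall>\<xi>\<in>D. norm (\<xi> - wb) < R \<longrightarrow> G wb \<le> G \<xi> + l * norm (T \<xi>) + \<eta> * norm (\<xi> - wb)" if "\<eta> > 0" for \<eta>
    using G0 that R0 by (intro exI[of _ R0]) (auto intro: add_increasing2)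
  have aspE: "asplund TYPE((('x \<times> 'y) \<times> ('x \<times> 'y)) \<times> ('z \<times> 'z))" by (intro asplund_prod asp)
  obtain w \<Lambda> where w: "w \<in> D" "norm (w - wb) < \<epsilon>" "norm (w - wb) < R0" "\<Lambda> \<in> frechet_subgrad D G w"
    "\<forall>h. T h = 0 \<longrightarrow> \<bar>blinfun_apply \<Lambda> h\<bar> \<le> \<epsilon> * norm h"
    by (rule asplund_fuzzy_rule_local[OF aspE T R0 lG G D wb l \<epsilon> min])
  obtain u y x y2 z z2 where we: "w = (((u, y), (x, y2)), (z, z2))" by (metis surj_pair)
  have nw: "norm (u - xb) \<le> norm (w - wb)" "norm y \<le> norm (w - wb)" "norm (x - xb) \<le> norm (w - wb)"
    using norm_pair_components[where a="u - xb" and b=y and c="x - xb" and d=y2 and e=z and f=z2]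
    by (simp_all add: we wb_def)
  have bl: "bounded_linear (\<lambda>a::'x. (((a, 0::'y), (0::'x, 0::'y)), (0::'z, 0::'z)))"
    "bounded_linear (\<lambda>a::'y. (((0::'x, a), (0::'x, 0::'y)), (0::'z, 0::'z)))"
    "bounded_linear (\<lambda>a::'x. (((0::'x, 0::'y), (a, 0::'y)), (0::'z, 0::'z)))"
    "bounded_linear (\<lambda>a::'y. (((0::'x, 0::'y), (0::'x, a)), (0::'z, 0::'z)))"
    "bounded_linear (\<lambda>a::'z. (((0::'x, 0::'y), (0::'x, 0::'y)), (a, 0::'z)))"
    "bounded_linear (\<lambda>a::'z. (((0::'x, 0::'y), (0::'x, 0::'y)), (0::'z, a)))"
    "bounded_linear (\<lambda>a::'x\<times>'y. ((a, (0::'x, 0::'y)), (0::'z, 0::'z)))"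
    by (intro bounded_linear_Pair bounded_linear_zero bounded_linear_ident)+
  obtain us where us: "\<And>a. blinfun_apply us a = \<Lambda> (((a, 0), (0, 0)), (0, 0))" using blinfun_compose_ex[OF bl(1)] by blast
  obtain ys where ys: "\<And>a. blinfun_apply ys a = \<Lambda> (((0, a), (0, 0)), (0, 0))" using blinfun_compose_ex[OF bl(2)] by blast
  obtain xs where xs: "\<And>a. blinfun_apply xs a = \<Lambda> (((0, 0), (a, 0)), (0, 0))" using blinfun_compose_ex[OF bl(3)] by blast
  obtain y2s where y2s: "\<And>a. blinfun_apply y2s a = \<Lambda> (((0, 0), (0, a)), (0, 0))" using blinfun_compose_ex[OF bl(4)] by blast
  obtain zt where zt: "\<And>a. blinfun_apply zt a = \<Lambda> (((0, 0), (0, 0)), (a, 0))" using blinfun_compose_ex[OF bl(5)] by blast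
  obtain z2s where z2s: "\<And>a. blinfun_apply z2s a = \<Lambda> (((0, 0), (0, 0)), (0, a))" using blinfun_compose_ex[OF bl(6)] by blast
  obtain N where N: "\<And>a. blinfun_apply N a = \<Lambda> ((a, (0, 0)), (0, 0))" using blinfun_compose_ex[OF bl(7)] by blast
  \<comment> \<open>Directions with equal \<open>z\<close> and \<open>z2\<close> lie in the kernel
    of \<open>T\<close>, so \<open>zt + z2s\<close> is small; with this sign \<open>zs\<close> is
    close to \<open>zt\<close>.\<close>
  define zs where "zs = - z2s"
  have Ladd: "\<Lambda> (((a1, a2), (a3, a4)), (a5, a6)) = us a1 + ys a2 + xs a3 + y2s a4 + zt a5 + z2s a6" for a1 a2 a3 a4 a5 a6
    unfolding us ys xs y2s zt z2s by (simp flip: blinfun.add_right)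
  have wball: "w \<in> ball wb R0" using w(3) by (simp add: dist_norm norm_minus_commute)
  \<comment> \<open>Only \<open>(u, y)\<close> is restricted by \<open>D\<close>, so every other
    direction is admissible and the Lipschitz constant bounds these components. The component
    \<open>ys\<close> is reached indirectly, through smallness of \<open>ys + y2s\<close>.\<close>
  have free: "\<bar>\<Lambda> (((0, 0), (a3, a4)), (a5, a6))\<bar> \<le> lG * norm (((0::'x, 0::'y), (a3, a4)), (a5, a6))" for a3 a4 a5 a6
  proof -
    have 1: "\<Lambda> v \<le> lG * norm v" if v: "fst (fst v) = 0" for v
    proof (rule frechet_subgrad_directional[OF w(4)])
      define \<tau> where "\<tau> = (R0 - norm (w - wb)) / (norm v + 1)"
      show "\<tau> > 0" using w(3) by (simp add: \<tau>_def add_nonneg_pos)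
      fix t assume t: "0 < t" "t < \<tau>"
      have "t * (norm v + 1) < R0 - norm (w - wb)" using t(2) by (simp add: \<tau>_def pos_less_divide_eq add_nonneg_pos)
      then have "t * norm v < R0 - norm (w - wb)" using t(1) by (simp add: distrib_left)
      moreover have "norm (w + t *\<^sub>R v - wb) \<le> norm (w - wb) + t * norm v"
        using norm_triangle_ineq[of "w - wb" "t *\<^sub>R v"] t(1) by (simp add: algebra_simps)
      ultimately have "w + t *\<^sub>R v \<in> ball wb R0" by (simp add: dist_norm norm_minus_commute)
      then have "G (w + t *\<^sub>R v) - G w \<le> t * (lG * norm v)" using Gle[OF _ wball, of "w + t *\<^sub>R v"] t(1) by (simp add: mult_ac)
      then show "w + t *\<^sub>R v \<in> D \<and> G (w + t *\<^sub>R v) - G w \<le> t * (lG * norm v)" using w(1) v by (simp add: D_def)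
    qed
    show ?thesis
      using 1[of "(((0, 0), (a3, a4)), (a5, a6))"] 1[of "- (((0, 0), (a3, a4)), (a5, a6))"]
      unfolding blinfun.minus_right norm_minus_cancel by (simp add: zero_prod_def abs_le_iff)
  qed
  have ker: "\<bar>\<Lambda> (((a, b), (a, b)), (e, e))\<bar> \<le> \<epsilon> * norm (((a, b), (a, b)), (e, e))" for a b e
    using w(5) by (simp add: T_apply zero_prod_def)
  have n2: "norm (((a, 0::'y), (a, 0::'y)), (0::'z, 0::'z)) \<le> 2 * norm a" for a :: 'x
    using norm_Pair_le[of "(a, 0::'y)" "(a, 0::'y)"] by (simp add: norm_Pair)
  have n3: "norm (((0::'x, b), (0::'x, b)), (0::'z, 0::'z)) \<le> 2 * norm b" for b :: 'y
    using norm_Pair_le[of "(0::'x, b)" "(0::'x, b)"] by (simp add: norm_Pair)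
  have n4: "norm (((0::'x, 0::'y), (0::'x, 0::'y)), (e, e)) \<le> 2 * norm e" for e :: 'z
    using norm_Pair_le[of e e] by (simp add: norm_Pair)
  have b1: "norm (xs + us) \<le> 2 * \<epsilon>"
  proof (rule norm_blinfun_bound)
    fix a
    have "\<bar>us a + xs a\<bar> \<le> \<epsilon> * (2 * norm a)"
      using order_trans[OF ker[of a 0 0] mult_left_mono[OF n2[of a]]] \<epsilon> unfolding Ladd by simp
    then show "norm ((xs + us) a) \<le> 2 * \<epsilon> * norm a" by (simp add: blinfun.add_left add.commute)
  qed (use \<epsilon> in simp)
  have b2: "norm (ys + y2s) \<le> 2 * \<epsilon>"
  proof (rule norm_blinfun_bound)
    fix b
    have "\<bar>ys b + y2s b\<bar> \<le> \<epsilon> * (2 * norm b)"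
      using order_trans[OF ker[of 0 b 0] mult_left_mono[OF n3[of b]]] \<epsilon> unfolding Ladd by simp
    then show "norm ((ys + y2s) b) \<le> 2 * \<epsilon> * norm b" by (simp add: blinfun.add_left)
  qed (use \<epsilon> in simp)
  have b3: "norm (zs - zt) \<le> 2 * \<epsilon>"
  proof (rule norm_blinfun_bound)
    fix e
    have "\<bar>zt e + z2s e\<bar> \<le> \<epsilon> * (2 * norm e)"
      using order_trans[OF ker[of 0 0 e] mult_left_mono[OF n4[of e]]] \<epsilon> unfolding Ladd by simp
    then show "norm ((zs - zt) e) \<le> 2 * \<epsilon> * norm e" by (simp add: zs_def blinfun.diff_left blinfun.minus_left)
  qed (use \<epsilon> in simp)
  have b4: "norm xs \<le> lG"
    using free[of _ 0 0 0] lG by (intro norm_blinfun_bound) (auto simp: xs norm_Pair)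
  have b5: "norm y2s \<le> lG"
    using free[of 0 _ 0 0] lG by (intro norm_blinfun_bound) (auto simp: y2s norm_Pair)
  have b6: "norm ys \<le> lG + 2 * \<epsilon>" using norm_triangle_ineq4[of "ys + y2s" y2s] b2 b5 by simp
  \<comment> \<open>Along \<open>z\<close> the decoupled function varies like the sublinear
    \<open>s\<close> alone.\<close>
  have zts: "blinfun_apply zt e \<le> s e" for e
    unfolding zt
  proof (rule frechet_subgrad_directional[OF w(4) zero_less_one])
    fix t :: real assume t: "0 < t"
    have "s (z + t *\<^sub>R e) \<le> s z + t * s e" using sublinear_add[OF s(1), of z "t *\<^sub>R e"] sublinear_scale[OF s(1), of t e] t by simp
    then show "w + t *\<^sub>R (((0, 0), (0, 0)), (e, 0)) \<in> D \<and> G (w + t *\<^sub>R (((0, 0), (0, 0)), (e, 0))) - G w \<le> t * s e"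
      using w(1) by (simp add: we D_def G_def)
  qed
  have FN: "N \<in> frechet_normal (graph_of F) (u, y)" unfolding frechet_normal_def
  proof (intro CollectI allI impI)
    fix \<eta> :: real assume "\<eta> > 0"
    then obtain t where t: "t > 0" "\<And>\<xi>. \<xi> \<in> D \<Longrightarrow> norm (\<xi> - w) < t \<Longrightarrow> blinfun_apply \<Lambda> (\<xi> - w) \<le> G \<xi> - G w + \<eta> * norm (\<xi> - w)"
      using w(4) unfolding frechet_subgrad_def by blast
    show "\<exists>\<delta>>0. \<forall>p\<in>graph_of F. norm (p - (u, y)) < \<delta> \<longrightarrow> blinfun_apply N (p - (u, y)) \<le> \<eta> * norm (p - (u, y))"
    proof (intro exI[of _ t] conjI t(1) ballI impI)
      fix p assume p: "p \<in> graph_of F" "norm (p - (u, y)) < t"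
      \<comment> \<open>\<open>G\<close> does not depend on \<open>(u, y)\<close>, so varying this
        pair alone exhibits a pure normal to the graph.\<close>
      define \<xi> where "\<xi> = ((p, (x, y2)), (z, z2))"
      have d: "\<xi> - w = ((p - (u, y), (0, 0)), (0, 0))" by (simp add: \<xi>_def we zero_prod_def)
      have nd: "norm (\<xi> - w) = norm (p - (u, y))" unfolding d by (simp add: norm_Pair)
      have "G \<xi> = G w" by (simp add: G_def \<xi>_def we split_beta)
      then show "blinfun_apply N (p - (u, y)) \<le> \<eta> * norm (p - (u, y))"
        using t(2)[of \<xi>] p unfolding nd unfolding d N by (simp add: D_def \<xi>_def)
    qed
  qed
  have xball: "x \<in> ball xb R0" using nw(3) w(3) by (simp add: dist_norm norm_minus_commute)
  have FS: "xs \<in> frechet_subgrad UNIV (\<lambda>x. blinfun_apply zs (h x)) x" unfolding frechet_subgrad_def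
  proof (intro CollectI allI impI)
    fix \<eta> :: real assume \<eta>: "\<eta> > 0"
    have L1: "1 + L > 0" using L by simp
    then have "\<eta> / (1 + L) > 0" using \<eta> by simp
    then obtain t where t: "t > 0" "\<And>\<xi>. \<xi> \<in> D \<Longrightarrow> norm (\<xi> - w) < t \<Longrightarrow> blinfun_apply \<Lambda> (\<xi> - w) \<le> G \<xi> - G w + \<eta> / (1 + L) * norm (\<xi> - w)"
      using w(4) unfolding frechet_subgrad_def by blast
    show "\<exists>t>0. \<forall>\<xi>\<in>UNIV. norm (\<xi> - x) < t \<longrightarrow> blinfun_apply xs (\<xi> - x) \<le> blinfun_apply zs (h \<xi>) - blinfun_apply zs (h x) + \<eta> * norm (\<xi> - x)"
    proof (intro exI[of _ "min (t / (1 + L)) (R0 - norm (x - xb))"] conjI ballI impI)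
      show "0 < min (t / (1 + L)) (R0 - norm (x - xb))" using t L1 xball by (simp add: dist_norm norm_minus_commute)
      fix x' assume x': "norm (x' - x) < min (t / (1 + L)) (R0 - norm (x - xb))"
      have "norm (x' - xb) \<le> norm (x' - x) + norm (x - xb)" using norm_triangle_ineq[of "x' - x" "x - xb"] by simp
      then have x'ball: "x' \<in> ball xb R0" using x' by (simp add: dist_norm norm_minus_commute)
      \<comment> \<open>Shifting \<open>z2\<close> along with \<open>h x'\<close> keeps
        \<open>z2 - h x\<close> constant and hence \<open>G\<close> unchanged. The subgradient
        inequality then relates \<open>xs\<close> to the increments of \<open>zs\<close> composed
        with \<open>h\<close>, whatever the value of \<open>z2 - h x\<close> is.\<close>
      define \<xi> where "\<xi> = (((u, y), (x', y2)), (z, z2 + (h x' - h x)))"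
      have d: "\<xi> - w = (((0, 0), (x' - x, 0)), (0, h x' - h x))" by (simp add: \<xi>_def we zero_prod_def)
      have "norm (\<xi> - w) \<le> norm (x' - x) + norm (h x' - h x)"
        unfolding d using norm_Pair_le[of "((0::'x, 0::'y), (x' - x, 0::'y))" "(0::'z, h x' - h x)"] by (simp add: norm_Pair)
      also have "\<dots> \<le> (1 + L) * norm (x' - x)" using h[OF x'ball xball] by (simp add: distrib_right)
      finally have nd: "norm (\<xi> - w) \<le> (1 + L) * norm (x' - x)" .
      also have "\<dots> < t" using x' L1 by (simp add: field_simps)
      finally have "norm (\<xi> - w) < t" .
      then have "blinfun_apply \<Lambda> (\<xi> - w) \<le> G \<xi> - G w + \<eta> / (1 + L) * norm (\<xi> - w)"
        using t(2)[of \<xi>] w(1) by (simp add: D_def \<xi>_def we)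
      moreover have "G \<xi> = G w" by (simp add: G_def \<xi>_def we)
      moreover have "\<eta> / (1 + L) * norm (\<xi> - w) \<le> \<eta> / (1 + L) * ((1 + L) * norm (x' - x))"
        using nd \<eta> L1 by (intro mult_left_mono) auto
      moreover have "\<eta> / (1 + L) * ((1 + L) * norm (x' - x)) = \<eta> * norm (x' - x)" using L1 by simp
      ultimately have "blinfun_apply \<Lambda> (\<xi> - w) \<le> \<eta> * norm (x' - x)" by linarith
      then show "blinfun_apply xs (x' - x) \<le> blinfun_apply zs (h x') - blinfun_apply zs (h x) + \<eta> * norm (x' - x)"
        unfolding d Ladd by (simp add: zs_def blinfun.minus_left blinfun.diff_right)
    qed
  qed
  show ?thesis
  proof (rule that[of x u y xs zs zt us ys N])
    show "y \<in> F u" using w(1) by (simp add: D_def we graph_of_def)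
    show "\<forall>a b. blinfun_apply N (a, b) = blinfun_apply us a + blinfun_apply ys b"
      unfolding N Ladd by simp
  qed (use nw w(2) xball FS zts b1 b3 b4 b6 FN in \<open>auto simp: lG_def\<close>)
qed

section \<open>Passing to the limit in scalarizations\<close>

lemma blinfun_pair_ex:
  fixes l1 :: "'a::real_normed_vector \<Rightarrow>\<^sub>L real" and l2 :: "'b::real_normed_vector \<Rightarrow>\<^sub>L real"
  obtains m :: "('a \<times> 'b) \<Rightarrow>\<^sub>L real" where "\<And>a b. blinfun_apply m (a, b) = blinfun_apply l1 a + blinfun_apply l2 b"
proof -
  obtain m1 :: "('a \<times> 'b) \<Rightarrow>\<^sub>L real" where m1: "\<And>a. blinfun_apply m1 a = blinfun_apply l1 (fst a)"
    using blinfun_compose_ex[OF bounded_linear_fst] by blast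
  obtain m2 :: "('a \<times> 'b) \<Rightarrow>\<^sub>L real" where m2: "\<And>a. blinfun_apply m2 a = blinfun_apply l2 (snd a)"
    using blinfun_compose_ex[OF bounded_linear_snd] by blast
  show ?thesis by (rule that[of "m1 + m2"]) (simp add: blinfun.add_left m1 m2)
qed

text \<open>Splits the scalarization by \<open>zn\<close> into that by the fixed \<open>z\<close>
  and a remainder by \<open>zn - z\<close>. The former has a subdifferential that no longer varies
  with \<open>n\<close>; the remainder is made to vanish separately.\<close>

lemma fuzzy_sum_scalarization:
  fixes h :: "'x::banach \<Rightarrow> 'z::banach" and z zn :: "'z \<Rightarrow>\<^sub>L real"
  assumes asp: "asplund TYPE('x)"
    and L: "L \<ge> 0" and h: "\<And>x u. x \<in> ball xb R0 \<Longrightarrow> u \<in> ball xb R0 \<Longrightarrow> norm (h x - h u) \<le> L * norm (x - u)"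
    and x: "x \<in> ball xb R0" and xs: "xs \<in> frechet_subgrad UNIV (\<lambda>x. blinfun_apply zn (h x)) x" and \<epsilon>: "\<epsilon> > 0"
  obtains x1 x2 a b where "norm (x1 - x) < \<epsilon>" "norm (x2 - x) < \<epsilon>"
    "a \<in> frechet_subgrad UNIV (\<lambda>x. blinfun_apply z (h x)) x1"
    "b \<in> frechet_subgrad UNIV (\<lambda>x. blinfun_apply (zn - z) (h x)) x2" "norm (a + b - xs) \<le> 2 * \<epsilon>"
proof -
  define T :: "'x \<times> 'x \<Rightarrow> 'x \<times> 'x" where "T = (\<lambda>w. (fst w - snd w, 0))"
  have T: "bounded_linear T" unfolding T_def
    by (intro bounded_linear_Pair bounded_linear_sub bounded_linear_zero bounded_linear_fst bounded_linear_snd)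
  define \<zeta> where "\<zeta> = zn - z"
  \<comment> \<open>Subtracting \<open>xs\<close> turns the subgradient inequality at
    \<open>x\<close> into local minimality of the diagonal point up to \<open>\<eta>\<close>; it is
    added back to the first component at the end.\<close>
  define G where "G = (\<lambda>w. blinfun_apply z (h (fst w)) + blinfun_apply \<zeta> (h (snd w)) - blinfun_apply xs (fst w))"
  define R1 where "R1 = R0 - norm (x - xb)"
  have R1: "R1 > 0" using x by (simp add: R1_def dist_norm norm_minus_commute)
  define lG where "lG = norm z * L + norm \<zeta> * L + norm xs"
  have lG: "lG \<ge> 0" using L by (simp add: lG_def)
  have inball: "fst v \<in> ball xb R0" "snd v \<in> ball xb R0" if v: "v \<in> ball (x, x) R1" for v
  proof -
    have "norm (v - (x, x)) < R1" using v by (simp add: dist_norm norm_minus_commute)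
    moreover have "norm (fst v - x) \<le> norm (v - (x, x))" "norm (snd v - x) \<le> norm (v - (x, x))"
      using norm_fst_le[of "fst v - x" "snd v - x"] norm_snd_le[of "snd v - x" "fst v - x"] by (cases v; simp)+
    moreover have "norm (fst v - xb) \<le> norm (fst v - x) + norm (x - xb)" "norm (snd v - xb) \<le> norm (snd v - x) + norm (x - xb)"
      using norm_triangle_ineq[of "fst v - x" "x - xb"] norm_triangle_ineq[of "snd v - x" "x - xb"] by simp_all
    ultimately show "fst v \<in> ball xb R0" "snd v \<in> ball xb R0"
      by (simp_all add: R1_def dist_norm norm_minus_commute)
  qed
  have lin: "\<bar>blinfun_apply l (h u) - blinfun_apply l (h v)\<bar> \<le> norm l * L * norm (u - v)"
    if "u \<in> ball xb R0" "v \<in> ball xb R0" for l :: "'z \<Rightarrow>\<^sub>L real" and u v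
  proof -
    have "\<bar>blinfun_apply l (h u) - blinfun_apply l (h v)\<bar> \<le> norm l * norm (h u - h v)"
      using norm_blinfun[of l "h u - h v"] by (simp add: blinfun.diff_right)
    also have "\<dots> \<le> norm l * (L * norm (u - v))" using h[OF that] by (intro mult_left_mono) auto
    finally show ?thesis by (simp add: mult.assoc)
  qed
  have G: "\<bar>G u - G v\<bar> \<le> lG * norm (u - v)" if uv: "u \<in> ball (x, x) R1" "v \<in> ball (x, x) R1" for u v
  proof -
    have n: "norm (fst u - fst v) \<le> norm (u - v)" "norm (snd u - snd v) \<le> norm (u - v)"
      using norm_fst_le[of "fst u - fst v" "snd u - snd v"] norm_snd_le[of "snd u - snd v" "fst u - fst v"] by (cases u; cases v; simp)+
    have "\<bar>blinfun_apply z (h (fst u)) - blinfun_apply z (h (fst v))\<bar> \<le> norm z * L * norm (u - v)"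
      using lin[OF inball(1)[OF uv(1)] inball(1)[OF uv(2)], of z] mult_left_mono[OF n(1), of "norm z * L"] L by simp
    moreover have "\<bar>blinfun_apply \<zeta> (h (snd u)) - blinfun_apply \<zeta> (h (snd v))\<bar> \<le> norm \<zeta> * L * norm (u - v)"
      using lin[OF inball(2)[OF uv(1)] inball(2)[OF uv(2)], of \<zeta>] mult_left_mono[OF n(2), of "norm \<zeta> * L"] L by simp
    moreover have "\<bar>blinfun_apply xs (fst u) - blinfun_apply xs (fst v)\<bar> \<le> norm xs * norm (u - v)"
      using norm_blinfun[of xs "fst u - fst v"] mult_left_mono[OF n(1), of "norm xs"] by (simp add: blinfun.diff_right)
    ultimately show ?thesis unfolding G_def lG_def distrib_right by linarith
  qed
  define l where "l = norm \<zeta> * L"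
  have l: "l \<ge> 0" using L by (simp add: l_def)
  have min: "\<exists>R>0. \<forall>\<xi>\<in>UNIV. norm (\<xi> - (x, x)) < R \<longrightarrow> G (x, x) \<le> G \<xi> + l * norm (T \<xi>) + \<eta> * norm (\<xi> - (x, x))" if \<eta>: "\<eta> > 0" for \<eta>
  proof -
    obtain t where t: "t > 0" "\<And>\<xi>. norm (\<xi> - x) < t \<Longrightarrow> blinfun_apply xs (\<xi> - x) \<le> blinfun_apply zn (h \<xi>) - blinfun_apply zn (h x) + \<eta> * norm (\<xi> - x)"
      using xs \<eta> unfolding frechet_subgrad_def by blast
    have "G (x, x) \<le> G \<xi> + l * norm (T \<xi>) + \<eta> * norm (\<xi> - (x, x))" if \<xi>: "norm (\<xi> - (x, x)) < min t R1" for \<xi>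
    proof -
      obtain x1 x2 where e: "\<xi> = (x1, x2)" by (cases \<xi>)
      have n: "norm (x1 - x) \<le> norm (\<xi> - (x, x))" using norm_fst_le[of "x1 - x" "x2 - x"] by (simp add: e)
      have b: "x1 \<in> ball xb R0" "x2 \<in> ball xb R0"
      proof -
        have "\<xi> \<in> ball (x, x) R1" using \<xi> by (simp add: dist_norm norm_minus_commute)
        from inball[OF this] show "x1 \<in> ball xb R0" "x2 \<in> ball xb R0" by (simp_all add: e)
      qed
      have "blinfun_apply xs (x1 - x) \<le> blinfun_apply zn (h x1) - blinfun_apply zn (h x) + \<eta> * norm (x1 - x)"
        using t(2)[of x1] n \<xi> by simp
      moreover have "\<eta> * norm (x1 - x) \<le> \<eta> * norm (\<xi> - (x, x))" using n \<eta> by (intro mult_left_mono) auto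
      moreover have "\<bar>blinfun_apply \<zeta> (h x1) - blinfun_apply \<zeta> (h x2)\<bar> \<le> l * norm (T \<xi>)"
        using lin[OF b, of \<zeta>] by (simp add: l_def T_def e norm_Pair)
      ultimately show ?thesis
        by (simp add: G_def e \<zeta>_def blinfun.diff_left blinfun.diff_right abs_le_iff)
    qed
    then show ?thesis using t R1 by (intro exI[of _ "min t R1"]) auto
  qed
  have T0: "T (x, x) = 0" by (simp add: T_def zero_prod_def)
  have aspE: "asplund TYPE('x \<times> 'x)" by (intro asplund_prod asp)
  obtain w \<Lambda> where w: "w \<in> UNIV" "norm (w - (x, x)) < \<epsilon>" "norm (w - (x, x)) < R1" "\<Lambda> \<in> frechet_subgrad UNIV G w"
    "\<forall>h. T h = 0 \<longrightarrow> \<bar>blinfun_apply \<Lambda> h\<bar> \<le> \<epsilon> * norm h"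
    by (rule asplund_fuzzy_rule_local[OF aspE T R1 lG G closed_UNIV UNIV_I T0 l \<epsilon> min])
  obtain x1 x2 where we: "w = (x1, x2)" by (cases w)
  obtain l1 where l1: "\<And>a. blinfun_apply l1 a = \<Lambda> (a, 0)"
    using blinfun_compose_ex[OF bounded_linear_Pair[OF bounded_linear_ident bounded_linear_zero]] by blast
  obtain l2 where l2: "\<And>a. blinfun_apply l2 a = \<Lambda> (0, a)"
    using blinfun_compose_ex[OF bounded_linear_Pair[OF bounded_linear_zero bounded_linear_ident]] by blast
  show ?thesis
  proof (rule that[of x1 x2 "l1 + xs" l2])
    show "norm (x1 - x) < \<epsilon>" "norm (x2 - x) < \<epsilon>"
      using w(2) norm_fst_le[of "x1 - x" "x2 - x"] norm_snd_le[of "x2 - x" "x1 - x"] by (simp_all add: we)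
    show "l1 + xs \<in> frechet_subgrad UNIV (\<lambda>x. blinfun_apply z (h x)) x1" unfolding frechet_subgrad_def
    proof (intro CollectI allI impI)
      fix \<eta> :: real assume "\<eta> > 0"
      then obtain t where t: "t > 0" "\<And>\<xi>. norm (\<xi> - w) < t \<Longrightarrow> blinfun_apply \<Lambda> (\<xi> - w) \<le> G \<xi> - G w + \<eta> * norm (\<xi> - w)"
        using w(4) unfolding frechet_subgrad_def by blast
      have "blinfun_apply (l1 + xs) (\<xi> - x1) \<le> blinfun_apply z (h \<xi>) - blinfun_apply z (h x1) + \<eta> * norm (\<xi> - x1)" if "norm (\<xi> - x1) < t" for \<xi>
        using t(2)[of "(\<xi>, x2)"] that l1[of "\<xi> - x1"] blinfun.diff_right[of xs \<xi> x1]
        by (simp add: we norm_Pair G_def blinfun.add_left)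
      then show "\<exists>t>0. \<forall>\<xi>\<in>UNIV. norm (\<xi> - x1) < t \<longrightarrow> blinfun_apply (l1 + xs) (\<xi> - x1) \<le> blinfun_apply z (h \<xi>) - blinfun_apply z (h x1) + \<eta> * norm (\<xi> - x1)"
        using t(1) by blast
    qed
    show "l2 \<in> frechet_subgrad UNIV (\<lambda>x. blinfun_apply (zn - z) (h x)) x2" unfolding frechet_subgrad_def
    proof (intro CollectI allI impI)
      fix \<eta> :: real assume "\<eta> > 0"
      then obtain t where t: "t > 0" "\<And>\<xi>. norm (\<xi> - w) < t \<Longrightarrow> blinfun_apply \<Lambda> (\<xi> - w) \<le> G \<xi> - G w + \<eta> * norm (\<xi> - w)"
        using w(4) unfolding frechet_subgrad_def by blast
      have "blinfun_apply l2 (\<xi> - x2) \<le> blinfun_apply (zn - z) (h \<xi>) - blinfun_apply (zn - z) (h x2) + \<eta> * norm (\<xi> - x2)" if "norm (\<xi> - x2) < t" for \<xi>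
        using t(2)[of "(x1, \<xi>)"] that by (simp add: we norm_Pair l2 G_def \<zeta>_def)
      then show "\<exists>t>0. \<forall>\<xi>\<in>UNIV. norm (\<xi> - x2) < t \<longrightarrow> blinfun_apply l2 (\<xi> - x2) \<le> blinfun_apply (zn - z) (h \<xi>) - blinfun_apply (zn - z) (h x2) + \<eta> * norm (\<xi> - x2)"
        using t(1) by blast
    qed
    show "norm (l1 + xs + l2 - xs) \<le> 2 * \<epsilon>"
    proof (rule norm_blinfun_bound)
      fix v
      have "\<bar>blinfun_apply \<Lambda> (v, v)\<bar> \<le> \<epsilon> * norm (v, v)" using w(5) by (simp add: T_def zero_prod_def)
      also have "\<dots> \<le> \<epsilon> * (2 * norm v)" using norm_Pair_le[of v v] \<epsilon> by (intro mult_left_mono) auto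
      also have "blinfun_apply \<Lambda> (v, v) = blinfun_apply l1 v + blinfun_apply l2 v"
        unfolding l1 l2 by (simp flip: blinfun.add_right)
      finally show "norm (blinfun_apply (l1 + xs + l2 - xs) v) \<le> 2 * \<epsilon> * norm v"
        by (simp add: blinfun.add_left blinfun.diff_left)
    qed (use \<epsilon> in simp)
  qed
qed

lemma frechet_subgrad_epigraph:
  fixes a :: "'x::real_normed_vector \<Rightarrow>\<^sub>L real"
  assumes a: "a \<in> frechet_subgrad UNIV \<phi> x" and m: "\<And>u s. blinfun_apply m (u, s) = blinfun_apply a u - s"
  shows "m \<in> frechet_normal (epigraph \<phi>) (x, \<phi> x)"
  unfolding frechet_normal_def
proof (intro CollectI allI impI)
  fix \<eta> :: real assume \<eta>: "\<eta> > 0"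
  then obtain t where t: "t > 0" "\<And>\<xi>. norm (\<xi> - x) < t \<Longrightarrow> blinfun_apply a (\<xi> - x) \<le> \<phi> \<xi> - \<phi> x + \<eta> * norm (\<xi> - x)"
    using a unfolding frechet_subgrad_def by blast
  show "\<exists>\<delta>>0. \<forall>v\<in>epigraph \<phi>. norm (v - (x, \<phi> x)) < \<delta> \<longrightarrow> blinfun_apply m (v - (x, \<phi> x)) \<le> \<eta> * norm (v - (x, \<phi> x))"
  proof (intro exI[of _ t] conjI t(1) ballI impI)
    fix v assume v: "v \<in> epigraph \<phi>" "norm (v - (x, \<phi> x)) < t"
    obtain u s where e: "v = (u, s)" by (cases v)
    have n: "norm (u - x) \<le> norm (v - (x, \<phi> x))" using norm_fst_le[of "u - x" "s - \<phi> x"] by (simp add: e)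
    have "blinfun_apply a (u - x) \<le> \<phi> u - \<phi> x + \<eta> * norm (u - x)" using t(2)[of u] n v by simp
    moreover have "\<eta> * norm (u - x) \<le> \<eta> * norm (v - (x, \<phi> x))" using n \<eta> by (intro mult_left_mono) auto
    ultimately show "blinfun_apply m (v - (x, \<phi> x)) \<le> \<eta> * norm (v - (x, \<phi> x))"
      using v(1) by (simp add: e m epigraph_def)
  qed
qed

text \<open>If \<open>b n v\<close> stayed above \<open>\<eta>\<close>, the subgradient inequality
  would keep \<open>\<zeta> n\<close> above \<open>\<eta> / 2\<close> on difference quotients of
  \<open>h\<close>. By strict Lipschitzness these converge in norm along a subsequence, and there a
  bounded weak* null sequence tends to 0.\<close>

lemma weak_star_vanishing:
  fixes h :: "'x::banach \<Rightarrow> 'z::banach" and \<zeta> :: "nat \<Rightarrow> 'z \<Rightarrow>\<^sub>L real" and b :: "nat \<Rightarrow> 'x \<Rightarrow>\<^sub>L real"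
  assumes h: "strictly_lipschitz_at h xb" and x: "x \<longlonglongrightarrow> xb"
    and B: "\<And>n. norm (\<zeta> n) \<le> B" and \<zeta>: "\<And>z. (\<lambda>n. blinfun_apply (\<zeta> n) z) \<longlonglongrightarrow> 0"
    and b: "\<And>n. b n \<in> frechet_subgrad UNIV (\<lambda>x. blinfun_apply (\<zeta> n) (h x)) (x n)"
  shows "(\<lambda>n. blinfun_apply (b n) v) \<longlonglongrightarrow> 0"
proof -
  obtain V0 where "open V0 \<and> 0 \<in> V0 \<and>
        (\<forall>v\<in>V0. \<forall>xs ts. xs \<longlonglongrightarrow> xb \<and> (\<forall>k. ts k > 0) \<and> ts \<longlonglongrightarrow> 0 \<longrightarrow>
           (\<exists>r l. strict_mono r \<and>
              ((\<lambda>k. (1 / ts (r k)) *\<^sub>R (h (xs (r k) + ts (r k) *\<^sub>R v) - h (xs (r k)))) \<longlonglongrightarrow> l)))"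
    using conjunct2[OF h[unfolded strictly_lipschitz_at_def]] by (elim exE)
  then have V0: "open V0" "0 \<in> V0"
    and V0_lim: "\<forall>v\<in>V0. \<forall>xs ts. xs \<longlonglongrightarrow> xb \<and> (\<forall>k. ts k > 0) \<and> ts \<longlonglongrightarrow> 0 \<longrightarrow>
           (\<exists>r l. strict_mono r \<and>
              ((\<lambda>k. (1 / ts (r k)) *\<^sub>R (h (xs (r k) + ts (r k) *\<^sub>R v) - h (xs (r k)))) \<longlonglongrightarrow> l))"
    by simp_all
  have upper: "\<forall>\<^sub>F n in sequentially. blinfun_apply (b n) v \<le> \<eta>" if v: "v \<in> V0" and \<eta>: "\<eta> > 0" for v \<eta>
  proof (rule ccontr)
    assume "\<not> ?thesis"
    then have "\<exists>\<^sub>F n in sequentially. blinfun_apply (b n) v > \<eta>" by (simp add: frequently_def not_less)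
    then have "infinite {n. blinfun_apply (b n) v > \<eta>}" by (simp add: frequently_cofinite[symmetric] cofinite_eq_sequentially)
    then obtain r where r: "strict_mono (r::nat\<Rightarrow>nat)" "\<And>n. blinfun_apply (b (r n)) v > \<eta>"
      using infinite_enumerate[of "{n. blinfun_apply (b n) v > \<eta>}"] by auto
    define \<eta>' where "\<eta>' = \<eta> / 2 / (norm v + 1)"
    have nv: "norm v + 1 > 0" by (simp add: add_nonneg_pos)
    have \<eta>': "\<eta>' > 0" using \<eta> nv by (simp add: \<eta>'_def)
    have "\<eta>' * norm v \<le> \<eta>' * (norm v + 1)" using \<eta>' by simp
    also have "\<dots> = \<eta> / 2" unfolding \<eta>'_def by (rule nonzero_eq_divide_eq[THEN iffD1, OF _ refl]) (use nv in simp)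
    finally have \<eta>v: "\<eta>' * norm v \<le> \<eta> / 2" .
    have "\<exists>t>0. t < inverse (real (Suc k)) \<and>
        blinfun_apply (b (r k)) v \<le> blinfun_apply (\<zeta> (r k)) ((1 / t) *\<^sub>R (h (x (r k) + t *\<^sub>R v) - h (x (r k)))) + \<eta> / 2" for k
    proof -
      obtain \<tau> where \<tau>: "\<tau> > 0" "\<And>\<xi>. norm (\<xi> - x (r k)) < \<tau> \<Longrightarrow> blinfun_apply (b (r k)) (\<xi> - x (r k)) \<le>
          blinfun_apply (\<zeta> (r k)) (h \<xi>) - blinfun_apply (\<zeta> (r k)) (h (x (r k))) + \<eta>' * norm (\<xi> - x (r k))"
        using b[of "r k"] \<eta>' unfolding frechet_subgrad_def by blast
      \<comment> \<open>The first bound makes the step lengths tend to 0, as strict Lipschitzness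
        requires; the second keeps the step inside the radius \<open>\<tau>\<close>.\<close>
      define t where "t = min (inverse (real (Suc k)) / 2) (\<tau> / (norm v + 1))"
      have t: "t > 0" using \<tau> nv by (simp add: t_def)
      have t2: "t < inverse (real (Suc k))"
      proof -
        have "t \<le> inverse (real (Suc k)) / 2" unfolding t_def by (rule min.cobounded1)
        also have "\<dots> < inverse (real (Suc k))" by simp
        finally show ?thesis .
      qed
      have "t \<le> \<tau> / (norm v + 1)" unfolding t_def by (rule min.cobounded2)
      then have "t * norm v + t \<le> \<tau>" using nv by (simp add: pos_le_divide_eq distrib_left)
      then have "norm (x (r k) + t *\<^sub>R v - x (r k)) < \<tau>" using t by simp
      from \<tau>(2)[OF this] have "t * blinfun_apply (b (r k)) v \<le>
          blinfun_apply (\<zeta> (r k)) (h (x (r k) + t *\<^sub>R v) - h (x (r k))) + \<eta>' * (t * norm v)"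
        using t by (simp add: blinfun.scaleR_right blinfun.diff_right)
      also have "\<eta>' * (t * norm v) \<le> t * (\<eta> / 2)" using mult_left_mono[OF \<eta>v, of t] t by (simp add: mult_ac)
      finally have "blinfun_apply (b (r k)) v \<le>
          (blinfun_apply (\<zeta> (r k)) (h (x (r k) + t *\<^sub>R v) - h (x (r k)))) / t + \<eta> / 2"
        using t by (simp add: field_simps)
      then show ?thesis using t t2 by (intro exI[of _ t]) (simp add: blinfun.scaleR_right)
    qed
    then obtain ts where ts: "\<And>k. ts k > 0" "\<And>k. ts k < inverse (real (Suc k))"
      "\<And>k. blinfun_apply (b (r k)) v \<le> blinfun_apply (\<zeta> (r k)) ((1 / ts k) *\<^sub>R (h (x (r k) + ts k *\<^sub>R v) - h (x (r k)))) + \<eta> / 2"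
      by metis
    have ts0: "ts \<longlonglongrightarrow> 0"
      using ts(1,2) by (intro tendsto_sandwich[OF _ _ tendsto_const LIMSEQ_inverse_real_of_nat]) (auto intro!: always_eventually less_imp_le)
    define q where "q = (\<lambda>k. (1 / ts k) *\<^sub>R (h (x (r k) + ts k *\<^sub>R v) - h (x (r k))))"
    have xr: "(\<lambda>k. x (r k)) \<longlonglongrightarrow> xb" using LIMSEQ_subseq_LIMSEQ[OF x r(1)] by (simp add: o_def)
    obtain r' l where r': "strict_mono (r'::nat\<Rightarrow>nat)" "(\<lambda>k. q (r' k)) \<longlonglongrightarrow> l"
      using V0_lim[rule_format, OF v, of "\<lambda>k. x (r k)" ts] xr ts(1) ts0 unfolding q_def by blast
    have z: "(\<lambda>k. blinfun_apply (\<zeta> (r (r' k))) l) \<longlonglongrightarrow> 0"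
      using LIMSEQ_subseq_LIMSEQ[OF \<zeta>[of l] strict_mono_o[OF r(1) r'(1)]] by (simp add: o_def)
    have "(\<lambda>k. blinfun_apply (\<zeta> (r (r' k))) (q (r' k) - l)) \<longlonglongrightarrow> 0"
    proof (rule Lim_null_comparison)
      show "\<forall>\<^sub>F k in sequentially. norm (blinfun_apply (\<zeta> (r (r' k))) (q (r' k) - l)) \<le> B * norm (q (r' k) - l)"
        by (intro always_eventually allI order_trans[OF norm_blinfun] mult_right_mono B norm_ge_zero)
      have "(\<lambda>k. B * norm (q (r' k) - l)) \<longlonglongrightarrow> B * norm (l - l)" by (intro tendsto_intros r')
      then show "(\<lambda>k. B * norm (q (r' k) - l)) \<longlonglongrightarrow> 0" by simp
    qed
    from tendsto_add[OF this z] have "(\<lambda>k. blinfun_apply (\<zeta> (r (r' k))) (q (r' k))) \<longlonglongrightarrow> 0"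
      by (simp add: blinfun.diff_right)
    then have "\<forall>\<^sub>F k in sequentially. blinfun_apply (\<zeta> (r (r' k))) (q (r' k)) < \<eta> / 2"
      using \<eta> by (intro order_tendstoD(2)) auto
    then obtain k where "blinfun_apply (\<zeta> (r (r' k))) (q (r' k)) < \<eta> / 2" by (auto simp: eventually_sequentially)
    then show False using r(2)[of "r' k"] ts(3)[of "r' k"] by (simp add: q_def)
  qed
  obtain \<rho> where \<rho>: "\<rho> > 0" "ball 0 \<rho> \<subseteq> V0" using V0(1,2) open_contains_ball by blast
  have small: "(\<lambda>n. blinfun_apply (b n) v) \<longlonglongrightarrow> 0" if v: "norm v < \<rho>" for v
  proof (rule tendstoI)
    fix \<eta> :: real assume \<eta>: "\<eta> > 0"
    have "v \<in> V0" "- v \<in> V0" using \<rho>(2) v by (auto simp: subset_iff)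
    then have "\<forall>\<^sub>F n in sequentially. blinfun_apply (b n) v \<le> \<eta> / 2" "\<forall>\<^sub>F n in sequentially. blinfun_apply (b n) (- v) \<le> \<eta> / 2"
      using \<eta> by (intro upper; simp)+
    then show "\<forall>\<^sub>F n in sequentially. dist (blinfun_apply (b n) v) 0 < \<eta>"
      by eventually_elim (use \<eta> in \<open>simp add: blinfun.minus_right abs_less_iff\<close>)
  qed
  \<comment> \<open>A factor that brings \<open>v\<close> into the symmetric ball where the estimate
    is available for both signs.\<close>
  define k where "k = 2 * norm v / \<rho> + 1"
  have k: "k > 0" using \<rho> by (simp add: k_def add_nonneg_pos)
  have "norm v < k * \<rho>" using \<rho>(1) by (simp add: k_def distrib_right add_strict_increasing2)
  then have "norm ((1 / k) *\<^sub>R v) < \<rho>" using k by (simp add: field_simps)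
  from tendsto_mult_left[OF small[OF this], of k] show ?thesis using k by (simp add: blinfun.scaleR_right)
qed

text \<open>The subgradients \<open>al n\<close> of the fixed scalarization differ from
  \<open>xs n\<close> by \<open>b n\<close> up to a norm-null error, and \<open>b n\<close> is weak*
  null, so \<open>al\<close> has the weak* limit \<open>a\<close> and yields epigraph
  normals.\<close>

lemma limiting_subdiff_scalarization:
  fixes h :: "'x::banach \<Rightarrow> 'z::banach"
  assumes asp: "asplund TYPE('x)" and str: "strictly_lipschitz_at h xb" and R0: "R0 > 0"
    and L: "L \<ge> 0" and h: "\<And>x u. x \<in> ball xb R0 \<Longrightarrow> u \<in> ball xb R0 \<Longrightarrow> norm (h x - h u) \<le> L * norm (x - u)"
    and x: "x \<longlonglongrightarrow> xb" "\<And>n. x n \<in> ball xb R0"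
    and B: "\<And>n. norm (\<zeta> n) \<le> B" and \<zeta>: "\<And>z. (\<lambda>n. blinfun_apply (\<zeta> n) z) \<longlonglongrightarrow> blinfun_apply z0 z"
    and xs: "\<And>n. xs n \<in> frechet_subgrad UNIV (\<lambda>x. blinfun_apply (\<zeta> n) (h x)) (x n)"
    and a: "\<And>v. (\<lambda>n. blinfun_apply (xs n) v) \<longlonglongrightarrow> blinfun_apply a v"
  shows "a \<in> limiting_subdiff (\<lambda>x. blinfun_apply z0 (h x)) xb"
proof -
  have "\<exists>x1 x2 a b. norm (x1 - x n) < inverse (real (Suc n)) \<and> norm (x2 - x n) < inverse (real (Suc n)) \<and>
    a \<in> frechet_subgrad UNIV (\<lambda>x. blinfun_apply z0 (h x)) x1 \<and>
    b \<in> frechet_subgrad UNIV (\<lambda>x. blinfun_apply (\<zeta> n - z0) (h x)) x2 \<and> norm (a + b - xs n) \<le> 2 * inverse (real (Suc n))" for n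
  proof -
    have "inverse (real (Suc n)) > 0" by simp
    from fuzzy_sum_scalarization[OF asp L h x(2) xs this, where z=z0] show ?thesis by metis
  qed
  then obtain x1 x2 al b where
    x1: "\<And>n. norm (x1 n - x n) < inverse (real (Suc n))" and x2: "\<And>n. norm (x2 n - x n) < inverse (real (Suc n))" and
    al: "\<And>n. al n \<in> frechet_subgrad UNIV (\<lambda>x. blinfun_apply z0 (h x)) (x1 n)" and
    b: "\<And>n. b n \<in> frechet_subgrad UNIV (\<lambda>x. blinfun_apply (\<zeta> n - z0) (h x)) (x2 n)" and
    ab: "\<And>n. norm (al n + b n - xs n) \<le> 2 * inverse (real (Suc n))" by metis
  have conv: "y \<longlonglongrightarrow> xb" if y: "\<And>n. norm (y n - x n) < inverse (real (Suc n))" for y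
  proof -
    have "(\<lambda>n. y n - x n) \<longlonglongrightarrow> 0"
      using y by (intro Lim_null_comparison[OF _ LIMSEQ_inverse_real_of_nat]) (auto intro!: always_eventually less_imp_le simp del: of_nat_Suc)
    from tendsto_add[OF this x(1)] show ?thesis by simp
  qed
  have b0: "(\<lambda>n. blinfun_apply (b n) v) \<longlonglongrightarrow> 0" for v
  proof (rule weak_star_vanishing[OF str conv[OF x2] _ _ b])
    fix n show "norm (\<zeta> n - z0) \<le> B + norm z0" using norm_triangle_ineq4[of "\<zeta> n" z0] B[of n] by simp
  next
    fix z
    from tendsto_diff[OF \<zeta>[of z] tendsto_const[of "blinfun_apply z0 z"]]
    show "(\<lambda>n. blinfun_apply (\<zeta> n - z0) z) \<longlonglongrightarrow> 0" by (simp add: blinfun.diff_left)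
  qed
  have al_lim: "(\<lambda>n. blinfun_apply (al n) v) \<longlonglongrightarrow> blinfun_apply a v" for v
  proof -
    have "(\<lambda>n. blinfun_apply (al n + b n - xs n) v) \<longlonglongrightarrow> 0"
    proof (rule Lim_null_comparison)
      show "\<forall>\<^sub>F n in sequentially. norm (blinfun_apply (al n + b n - xs n) v) \<le> 2 * inverse (real (Suc n)) * norm v"
        by (intro always_eventually allI order_trans[OF norm_blinfun] mult_right_mono ab norm_ge_zero)
      have "(\<lambda>n. 2 * inverse (real (Suc n)) * norm v) \<longlonglongrightarrow> 2 * 0 * norm v" by (intro tendsto_intros LIMSEQ_inverse_real_of_nat)
      then show "(\<lambda>n. 2 * inverse (real (Suc n)) * norm v) \<longlonglongrightarrow> 0" by simp
    qed
    from tendsto_diff[OF tendsto_add[OF this a[of v]] b0[of v]] show ?thesis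
      by (simp add: blinfun.add_left blinfun.diff_left)
  qed
  \<comment> \<open>Epigraph normals are based at point-value pairs, so the function values must
    converge as well.\<close>
  have hlim: "(\<lambda>n. h (x1 n)) \<longlonglongrightarrow> h xb"
  proof (rule LIM_zero_cancel, rule Lim_null_comparison)
    have "\<forall>\<^sub>F n in sequentially. x1 n \<in> ball xb R0"
      using conv[OF x1] R0 by (intro topological_tendstoD) auto
    then show "\<forall>\<^sub>F n in sequentially. norm (h (x1 n) - h xb) \<le> L * norm (x1 n - xb)"
      by eventually_elim (use h R0 in auto)
    have "(\<lambda>n. L * norm (x1 n - xb)) \<longlonglongrightarrow> L * norm (xb - xb)" by (intro tendsto_intros conv[OF x1])
    then show "(\<lambda>n. L * norm (x1 n - xb)) \<longlonglongrightarrow> 0" by simp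
  qed
  have "\<exists>m :: ('x \<times> real) \<Rightarrow>\<^sub>L real. \<forall>u s. blinfun_apply m (u, s) = blinfun_apply l u - s" for l :: "'x \<Rightarrow>\<^sub>L real"
    using blinfun_pair_ex[of l "- id_blinfun :: real \<Rightarrow>\<^sub>L real"] by (metis add_uminus_conv_diff blinfun.minus_left blinfun_apply_id_blinfun id_apply)
  then obtain m :: "('x \<Rightarrow>\<^sub>L real) \<Rightarrow> ('x \<times> real) \<Rightarrow>\<^sub>L real" where
    m: "\<And>l u s. blinfun_apply (m l) (u, s) = blinfun_apply l u - s" by metis
  have "m a \<in> limiting_normal (epigraph (\<lambda>x. blinfun_apply z0 (h x))) (xb, blinfun_apply z0 (h xb))"
    unfolding limiting_normal_def
  proof (intro CollectI exI[of _ "\<lambda>n. (x1 n, blinfun_apply z0 (h (x1 n)))"] exI[of _ "\<lambda>n. m (al n)"] conjI allI)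
    fix n
    show "(x1 n, blinfun_apply z0 (h (x1 n))) \<in> epigraph (\<lambda>x. blinfun_apply z0 (h x))" by (simp add: epigraph_def)
    show "m (al n) \<in> frechet_normal (epigraph (\<lambda>x. blinfun_apply z0 (h x))) (x1 n, blinfun_apply z0 (h (x1 n)))"
      by (rule frechet_subgrad_epigraph[OF al m])
  next
    show "(\<lambda>n. (x1 n, blinfun_apply z0 (h (x1 n)))) \<longlonglongrightarrow> (xb, blinfun_apply z0 (h xb))"
      by (intro tendsto_Pair conv[OF x1] blinfun.tendsto tendsto_const hlim)
  next
    fix v :: "'x \<times> real"
    show "(\<lambda>n. blinfun_apply (m (al n)) v) \<longlonglongrightarrow> blinfun_apply (m a) v"
      by (cases v) (auto simp: m intro!: tendsto_intros al_lim)
  qed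
  then show ?thesis unfolding limiting_subdiff_def using m by blast
qed

section \<open>The multiplier rule\<close>

text \<open>Often named after Gerstewitz. Testing a functional below \<open>s\<close> at
  \<open>- k\<close> for \<open>k\<close> in \<open>K\<close> shows that it is in the dual cone, and
  testing it at \<open>e\<close> and \<open>- e\<close> normalises it.\<close>

lemma scalarizing_functional:
  fixes K :: "'z::real_normed_vector set"
  assumes K: "convex K" "cone K" and e: "e \<in> interior K" and z0: "0 \<notin> interior K"
  obtains s ls where "sublinear s" "ls \<ge> 0" "\<forall>z. s z \<le> ls * norm z" "\<forall>z. s z < 0 \<longrightarrow> - z \<in> interior K"
    "\<forall>\<zeta>. (\<forall>z. blinfun_apply \<zeta> z \<le> s z) \<longrightarrow> \<zeta> \<in> dual_cone K \<and> blinfun_apply \<zeta> e = 1"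
proof -
  have scale: "c *\<^sub>R x \<in> K" if "x \<in> K" "c \<ge> 0" for c x using K(2) that by (auto simp: cone_def)
  have add: "x + y \<in> K" if "x \<in> K" "y \<in> K" for x y
  proof -
    have "(1/2) *\<^sub>R x + (1/2) *\<^sub>R y \<in> K" using K(1) that by (intro convexD) auto
    from scale[OF this, of 2] show ?thesis by (simp add: scaleR_add_right)
  qed
  obtain \<rho> where \<rho>: "\<rho> > 0" "ball e \<rho> \<subseteq> K" using e mem_interior by blast
  have eK: "e \<in> K" using e interior_subset by blast
  have K0: "0 \<in> K" using scale[OF eK, of 0] by simp
  have int: "k + c *\<^sub>R e \<in> interior K" if k: "k \<in> K" and c: "c > 0" for k c
  proof -
    have "ball (k + c *\<^sub>R e) (c * \<rho>) \<subseteq> K"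
    proof
      fix y assume y: "y \<in> ball (k + c *\<^sub>R e) (c * \<rho>)"
      have "e - (1/c) *\<^sub>R (y - k) = (1/c) *\<^sub>R (k + c *\<^sub>R e - y)" using c by (simp add: algebra_simps)
      then have "norm (e - (1/c) *\<^sub>R (y - k)) = norm (k + c *\<^sub>R e - y) / c" using c by simp
      also have "\<dots> < \<rho>" using y c by (simp add: dist_norm field_simps)
      finally have "(1/c) *\<^sub>R (y - k) \<in> K" using \<rho>(2) by (auto simp: dist_norm)
      from add[OF k scale[OF this, of c]] show "y \<in> K" using c by simp
    qed
    then show ?thesis using c \<rho>(1) by (intro interiorI[of "ball (k + c *\<^sub>R e) (c * \<rho>)"]) auto
  qed
  \<comment> \<open>The factor 2 places \<open>z / (ls * norm z)\<close> at distance
    \<open>\<rho> / 2\<close> from the origin, strictly inside the ball.\<close>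
  define ls where "ls = 2 / \<rho>"
  have ls: "ls > 0" using \<rho> by (simp add: ls_def)
  define S where "S = (\<lambda>z. {t. t *\<^sub>R e - z \<in> K})"
  have lsS: "ls * norm z \<in> S z" for z
  proof (cases "z = 0")
    case True then show ?thesis using K0 by (simp add: S_def)
  next
    case False
    define t where "t = ls * norm z"
    have t: "t > 0" using False ls by (simp add: t_def)
    have "norm ((1/t) *\<^sub>R z) < \<rho>" using t False \<rho>(1) by (simp add: t_def ls_def)
    then have "e - (1/t) *\<^sub>R z \<in> K" using \<rho>(2) by (auto simp: subset_iff dist_norm)
    from scale[OF this, of t] have "t *\<^sub>R e - z \<in> K" using t by (simp add: scaleR_diff_right)
    then show ?thesis by (simp add: S_def t_def)
  qed
  have addS: "t + t' \<in> S (z + z')" if "t \<in> S z" "t' \<in> S z'" for t t' z z'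
    using add[of "t *\<^sub>R e - z" "t' *\<^sub>R e - z'"] that by (simp add: S_def algebra_simps)
  \<comment> \<open>A negative multiple of \<open>e\<close> in \<open>K\<close> would, after adding
    a positive one, put \<open>0\<close> into the interior. This keeps the infimum in
    \<open>s\<close> finite.\<close>
  have nn: "c \<ge> 0" if "c *\<^sub>R e \<in> K" for c
  proof (rule ccontr)
    assume "\<not> c \<ge> 0"
    then have c: "c < 0" by simp
    have "c *\<^sub>R e + (- c) *\<^sub>R e \<in> interior K" using c that by (intro int) auto
    then show False using z0 by simp
  qed
  have lb: "- ls * norm z \<le> t" if "t \<in> S z" for t z
    using nn[of "t + ls * norm (- z)"] addS[OF that lsS[of "- z"]] by (simp add: S_def)
  have bdd: "bdd_below (S z)" for z using lb by (rule bdd_belowI)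
  have ne: "S z \<noteq> {}" for z using lsS by blast
  define s where "s = (\<lambda>z. Inf (S z))"
  have sle: "s z \<le> t" if "t \<in> S z" for z t unfolding s_def using that bdd by (rule cInf_lower)
  have ssub: "s (x + y) \<le> s x + s y" for x y
  proof -
    have "s (x + y) - t' \<le> s x" if "t' \<in> S y" for t'
      unfolding s_def[THEN fun_cong, of x] using sle[OF addS[OF _ that]] by (intro cInf_greatest ne) (simp add: algebra_simps)
    then have "s (x + y) - s x \<le> s y"
      unfolding s_def[THEN fun_cong, of y] by (intro cInf_greatest ne) (simp add: algebra_simps)
    then show ?thesis by simp
  qed
  have "s (t *\<^sub>R x) = t * s x" if "t \<ge> 0" for t x
  proof (rule sublinear_scaleI[OF _ _ that])
    fix t :: real and x assume t: "t > 0"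
    have "s (t *\<^sub>R x) / t \<le> s x" unfolding s_def[THEN fun_cong, of x]
    proof (rule cInf_greatest[OF ne])
      fix t' assume "t' \<in> S x"
      then have "t * t' \<in> S (t *\<^sub>R x)" using scale[of "t' *\<^sub>R e - x" t] t by (simp add: S_def scaleR_diff_right)
      then show "s (t *\<^sub>R x) / t \<le> t'" using sle t by (simp add: field_simps)
    qed
    then show "s (t *\<^sub>R x) \<le> t * s x" using t by (simp add: field_simps)
  next
    have "0 \<in> S 0" using lsS[of 0] by simp
    then have "s 0 \<le> 0" by (rule sle)
    moreover have "0 \<le> s 0" unfolding s_def using lb[of _ 0] by (intro cInf_greatest ne) simp
    ultimately show "s 0 = 0" by simp
  qed
  with ssub have sub: "sublinear s" by (auto simp: sublinear_def)
  have neg: "- z \<in> interior K" if sz: "s z < 0" for z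
  proof -
    obtain t where t: "t \<in> S z" "t < 0" using cInf_lessD[OF ne sz[unfolded s_def]] by blast
    then have "(t *\<^sub>R e - z) + (- t) *\<^sub>R e \<in> interior K" by (intro int) (auto simp: S_def)
    then show ?thesis by simp
  qed
  have dual: "\<zeta> \<in> dual_cone K \<and> blinfun_apply \<zeta> e = 1" if \<zeta>: "\<forall>z. blinfun_apply \<zeta> z \<le> s z" for \<zeta> :: "'z \<Rightarrow>\<^sub>L real"
  proof
    show "\<zeta> \<in> dual_cone K" unfolding dual_cone_def
    proof (intro CollectI ballI)
      fix k assume "k \<in> K"
      then have "s (- k) \<le> 0" by (intro sle) (simp add: S_def)
      then show "0 \<le> blinfun_apply \<zeta> k" using \<zeta>[rule_format, of "- k"] by (simp add: blinfun.minus_right)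
    qed
    have "s e \<le> 1" "s (- e) \<le> - 1" using K0 by (auto intro!: sle simp: S_def)
    then show "blinfun_apply \<zeta> e = 1"
      using \<zeta>[rule_format, of e] \<zeta>[rule_format, of "- e"] by (simp add: blinfun.minus_right)
  qed
  show ?thesis using sub ls sle lsS neg dual by (intro that[of s ls]) auto
qed

text \<open>Compare \<open>x\<close> with an almost nearest feasible point \<open>u\<close>:
  \<open>f u\<close> is nonnegative, and \<open>f\<close> can change between them by at most
  \<open>l\<close> times a distance that the regularity estimate bounds through
  \<open>norm y\<close>.\<close>

lemma exact_penalization:
  fixes f :: "'x::real_normed_vector \<Rightarrow> real" and F :: "'x \<Rightarrow> 'y::real_normed_vector set"
  assumes S: "S = {x. 0 \<in> F x}" and xb: "xb \<in> S" and R: "R > 0" and l: "l \<ge> 0" and r: "r > 0"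
    and f: "\<And>x u. x \<in> ball xb (3 * R) \<Longrightarrow> u \<in> ball xb (3 * R) \<Longrightarrow> f u \<le> f x + l * norm (x - u)"
    and min: "\<And>x. x \<in> ball xb (3 * R) \<Longrightarrow> x \<in> S \<Longrightarrow> 0 \<le> f x"
    and reg: "\<And>x. x \<in> ball xb (3 * R) \<Longrightarrow> edist_set x S \<le> ereal r * edist_set 0 (F x)"
    and x: "x \<in> ball xb R" and y: "y \<in> F x"
  shows "- (l * r) * norm y \<le> f x"
proof -
  have x3: "x \<in> ball xb (3 * R)" using x R by simp
  \<comment> \<open>Excludes the infinite default of \<open>edist_set\<close> on both sides.\<close>
  have "S \<noteq> {}" "F x \<noteq> {}" using xb y by auto
  then have "infdist x S \<le> r * infdist 0 (F x)" using reg[OF x3] by (simp add: edist_set_def)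
  also have "\<dots> \<le> r * norm y" using infdist_le[OF y, of 0] r by (intro mult_left_mono) auto
  finally have d: "infdist x S \<le> r * norm y" .
  have "- (f x) \<le> l * r * norm y"
  proof (rule field_le_epsilon)
    fix e :: real assume e: "e > 0"
    \<comment> \<open>The feasible \<open>u\<close> lies within \<open>R + \<tau>\<close>, at most
      \<open>2 * R\<close>, of \<open>x\<close> and therefore in the ball of radius
      \<open>3 * R\<close>; the other bound makes the extra cost at most \<open>e\<close>.\<close>
    define \<tau> where "\<tau> = min R (e / (l + 1))"
    have \<tau>: "\<tau> > 0" "\<tau> \<le> R" using R e l by (auto simp: \<tau>_def)
    have "l * \<tau> \<le> l * (e / (l + 1))" using l by (intro mult_left_mono) (auto simp: \<tau>_def)
    also have "\<dots> \<le> e" using l e by (simp add: field_simps)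
    finally have l\<tau>: "l * \<tau> \<le> e" .
    have "Inf (dist x ` S) < infdist x S + \<tau>" using \<tau> \<open>S \<noteq> {}\<close> by (simp add: infdist_notempty)
    then obtain u where u: "u \<in> S" "dist x u < infdist x S + \<tau>"
      using cInf_lessD[of "dist x ` S" "infdist x S + \<tau>"] \<open>S \<noteq> {}\<close> by blast
    have "dist xb u \<le> dist xb x + dist x u" by (rule dist_triangle)
    moreover have "infdist x S \<le> dist x xb" by (rule infdist_le[OF xb])
    ultimately have u3: "u \<in> ball xb (3 * R)" using u(2) \<tau> x by (simp add: dist_commute)
    have "0 \<le> f u" by (rule min[OF u3 u(1)])
    also have "\<dots> \<le> f x + l * norm (x - u)" by (rule f[OF x3 u3])
    finally have "- (f x) \<le> l * norm (x - u)" by simp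
    also have "\<dots> \<le> l * (r * norm y + \<tau>)" using u(2) d l by (intro mult_left_mono) (auto simp: dist_norm)
    finally show "- (f x) \<le> l * r * norm y + e" using l\<tau> by (simp add: algebra_simps)
  qed
  then show ?thesis by simp
qed

lemma frechet_subgrad_shift:
  "frechet_subgrad D (\<lambda>x. blinfun_apply z (h x - c)) w = frechet_subgrad D (\<lambda>x. blinfun_apply z (h x)) w"
  by (simp add: frechet_subgrad_def blinfun.diff_right)

text \<open>Three nested extractions give limits of \<open>zt\<close>, \<open>xs\<close> and
  \<open>ys\<close>. The limits of \<open>zs\<close> and \<open>us\<close> follow, because
  \<open>zs - zt\<close> and \<open>xs + us\<close> tend to 0 in norm; in particular
  \<open>us\<close> tends to \<open>- a\<close>, which produces the exact sum 0.\<close>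

lemma multiplier_rule:
  fixes h :: "'x::banach \<Rightarrow> 'z::banach" and F :: "'x \<Rightarrow> 'y::banach set" and s :: "'z \<Rightarrow> real"
  assumes asp: "asplund TYPE('x)" "asplund TYPE('y)" "asplund TYPE('z)"
    and s: "sublinear s" "\<And>z. s z \<le> ls * norm z" and ls: "ls \<ge> 0"
    and str: "strictly_lipschitz_at h xb"
    and R0: "R0 > 0" and L: "L \<ge> 0" and h: "\<And>x u. x \<in> ball xb R0 \<Longrightarrow> u \<in> ball xb R0 \<Longrightarrow> norm (h x - h u) \<le> L * norm (x - u)"
    and F: "closed (graph_of F)" "0 \<in> F xb" and c: "c \<ge> 0"
    and pen: "\<And>x y. y \<in> F x \<Longrightarrow> x \<in> ball xb R0 \<Longrightarrow> - c * norm y \<le> s (h x - h xb)"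
  obtains z ys a b where "\<forall>v. blinfun_apply z v \<le> s v"
    "a \<in> limiting_subdiff (\<lambda>x. blinfun_apply z (h x)) xb" "b \<in> normal_coderiv F xb 0 ys" "a + b = 0"
proof -
  define C where "C = 2 * ls + ls * L + c"
  have "\<exists>x u y zs zt xs us ys N. norm (x - xb) < inverse (real (Suc n)) \<and> x \<in> ball xb R0 \<and> norm (u - xb) < inverse (real (Suc n)) \<and>
    norm y < inverse (real (Suc n)) \<and> y \<in> F u \<and> xs \<in> frechet_subgrad UNIV (\<lambda>x. blinfun_apply zs (h x)) x \<and>
    (\<forall>z. blinfun_apply zt z \<le> s z) \<and> norm (zs - zt) \<le> 2 * inverse (real (Suc n)) \<and>
    norm (xs + us) \<le> 2 * inverse (real (Suc n)) \<and> norm xs \<le> C \<and> norm ys \<le> C + 2 * inverse (real (Suc n)) \<and>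
    N \<in> frechet_normal (graph_of F) (u, y) \<and> (\<forall>a b. blinfun_apply N (a, b) = blinfun_apply us a + blinfun_apply ys b)" for n
  proof -
    have pos: "inverse (real (Suc n)) > 0" by simp
    have h': "norm ((h x - h xb) - (h u - h xb)) \<le> L * norm (x - u)" if "x \<in> ball xb R0" "u \<in> ball xb R0" for x u
      using h[OF that] by simp
    have h0: "h xb - h xb = 0" by simp
    obtain x u y zs zt xs us ys N where
      "norm (x - xb) < inverse (real (Suc n))" "x \<in> ball xb R0" "norm (u - xb) < inverse (real (Suc n))"
      "norm y < inverse (real (Suc n))" "y \<in> F u"
      "xs \<in> frechet_subgrad UNIV (\<lambda>x. blinfun_apply zs (h x - h xb)) x"
      "\<forall>z. blinfun_apply zt z \<le> s z" "norm (zs - zt) \<le> 2 * inverse (real (Suc n))"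
      "norm (xs + us) \<le> 2 * inverse (real (Suc n))" "norm xs \<le> 2 * ls + ls * L + c"
      "norm ys \<le> 2 * ls + ls * L + c + 2 * inverse (real (Suc n))"
      "N \<in> frechet_normal (graph_of F) (u, y)" "\<forall>a b. blinfun_apply N (a, b) = blinfun_apply us a + blinfun_apply ys b"
      by (rule fuzzy_multipliers[where h="\<lambda>x. h x - h xb", OF asp s ls R0 L h' h0 F c pen pos])
    then show ?thesis unfolding frechet_subgrad_shift C_def[symmetric] by (intro exI conjI)
  qed
  then obtain x u y zs zt xs us ys N where
    x: "\<And>n. norm (x n - xb) < inverse (real (Suc n))" "\<And>n. x n \<in> ball xb R0" and
    u: "\<And>n. norm (u n - xb) < inverse (real (Suc n))" and
    y: "\<And>n. norm (y n) < inverse (real (Suc n))" "\<And>n. y n \<in> F (u n)" and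
    xs: "\<And>n. xs n \<in> frechet_subgrad UNIV (\<lambda>x. blinfun_apply (zs n) (h x)) (x n)" and
    zt: "\<And>n z. blinfun_apply (zt n) z \<le> s z" and zz: "\<And>n. norm (zs n - zt n) \<le> 2 * inverse (real (Suc n))" and
    xu: "\<And>n. norm (xs n + us n) \<le> 2 * inverse (real (Suc n))" and xsC: "\<And>n. norm (xs n) \<le> C" and
    ysC: "\<And>n. norm (ys n) \<le> C + 2 * inverse (real (Suc n))" and
    N: "\<And>n. N n \<in> frechet_normal (graph_of F) (u n, y n)"
       "\<And>n a b. blinfun_apply (N n) (a, b) = blinfun_apply (us n) a + blinfun_apply (ys n) b"
    by metis
  have inv1: "inverse (real (Suc n)) \<le> 1" for n by (simp add: field_simps)
  have inv0: "(\<lambda>n. k * inverse (real (Suc n))) \<longlonglongrightarrow> 0" for k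
    using tendsto_mult_left[OF LIMSEQ_inverse_real_of_nat, of k] by simp
  have ztB: "norm (zt n) \<le> ls" for n
  proof (rule norm_blinfun_bound[OF ls])
    fix z
    have "blinfun_apply (zt n) z \<le> ls * norm z" "blinfun_apply (zt n) (- z) \<le> ls * norm (- z)"
      using zt s(2) order_trans by blast+
    then show "norm (blinfun_apply (zt n) z) \<le> ls * norm z" by (simp add: blinfun.minus_right abs_le_iff)
  qed
  have zsB: "norm (zs n) \<le> ls + 2" for n
    using norm_triangle_ineq[of "zs n - zt n" "zt n"] ztB[of n] zz[of n] inv1[of n] by simp
  have ysB: "norm (ys n) \<le> C + 2" for n using ysC[of n] inv1[of n] by linarith
  obtain r1 z where r1: "strict_mono (r1::nat\<Rightarrow>nat)" "norm z \<le> ls"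
      "\<forall>v. (\<lambda>n. blinfun_apply (zt (r1 n)) v) \<longlonglongrightarrow> blinfun_apply z v"
    by (rule asplund_weak_star_sequentially_compact[OF asp(3) ztB])
  obtain r2 a where r2: "strict_mono (r2::nat\<Rightarrow>nat)" "norm a \<le> C"
      "\<forall>v. (\<lambda>n. blinfun_apply (xs (r1 (r2 n))) v) \<longlonglongrightarrow> blinfun_apply a v"
    by (rule asplund_weak_star_sequentially_compact[OF asp(1), of "\<lambda>n. xs (r1 n)", OF xsC])
  obtain r3 \<eta> where r3: "strict_mono (r3::nat\<Rightarrow>nat)" "norm \<eta> \<le> C + 2"
      "\<forall>v. (\<lambda>n. blinfun_apply (ys (r1 (r2 (r3 n)))) v) \<longlonglongrightarrow> blinfun_apply \<eta> v"
    by (rule asplund_weak_star_sequentially_compact[OF asp(2), of "\<lambda>n. ys (r1 (r2 n))", OF ysB])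
  define r where "r = (\<lambda>n. r1 (r2 (r3 n)))"
  have r: "strict_mono r" using r1(1) r2(1) r3(1) by (auto simp: r_def strict_mono_def)
  have null: "(\<lambda>n. f (r n)) \<longlonglongrightarrow> (0::'w::real_normed_vector)"
    if "\<And>n. norm (f n) \<le> k * inverse (real (Suc n))" for f k
  proof -
    have "f \<longlonglongrightarrow> 0" using that by (intro Lim_null_comparison[OF _ inv0[of k]] always_eventually allI)
    from LIMSEQ_subseq_LIMSEQ[OF this r] show ?thesis by (simp add: o_def)
  qed
  have blim: "(\<lambda>n. blinfun_apply (f (r n)) v) \<longlonglongrightarrow> 0"
    if f: "\<And>n. norm (f n) \<le> k * inverse (real (Suc n))" for f :: "nat \<Rightarrow> 'w::real_normed_vector \<Rightarrow>\<^sub>L real" and k v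
    using blinfun.tendsto[OF null[of f k, OF f] tendsto_const[of v]] by simp
  have xlim: "(\<lambda>n. x (r n)) \<longlonglongrightarrow> xb" and ulim: "(\<lambda>n. u (r n)) \<longlonglongrightarrow> xb" and ylim: "(\<lambda>n. y (r n)) \<longlonglongrightarrow> 0"
    using null[of "\<lambda>n. x n - xb" 1] null[of "\<lambda>n. u n - xb" 1] null[of y 1] x(1) u y(1)
    by (auto intro: less_imp_le LIM_zero_cancel simp del: of_nat_Suc)
  have ztlim: "(\<lambda>n. blinfun_apply (zt (r n)) v) \<longlonglongrightarrow> blinfun_apply z v" for v
    using LIMSEQ_subseq_LIMSEQ[OF r1(3)[rule_format, of v] strict_mono_o[OF r2(1) r3(1)]] by (simp add: o_def r_def)
  have zslim: "(\<lambda>n. blinfun_apply (zs (r n)) v) \<longlonglongrightarrow> blinfun_apply z v" for v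
    using tendsto_add[OF blim[of "\<lambda>n. zs n - zt n" 2 v, OF zz] ztlim[of v]] by (simp add: blinfun.diff_left)
  have xslim: "(\<lambda>n. blinfun_apply (xs (r n)) v) \<longlonglongrightarrow> blinfun_apply a v" for v
    using LIMSEQ_subseq_LIMSEQ[OF r2(3)[rule_format, of v] r3(1)] by (simp add: o_def r_def)
  have uslim: "(\<lambda>n. blinfun_apply (us (r n)) v) \<longlonglongrightarrow> - blinfun_apply a v" for v
    using tendsto_diff[OF blim[of "\<lambda>n. xs n + us n" 2 v, OF xu] xslim[of v]] by (simp add: blinfun.add_left)
  have yslim: "(\<lambda>n. blinfun_apply (ys (r n)) v) \<longlonglongrightarrow> blinfun_apply \<eta> v" for v using r3(3) by (simp add: r_def)
  have zle: "blinfun_apply z v \<le> s v" for v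
    using zt by (intro LIMSEQ_le_const2[OF ztlim]) blast
  have aS: "a \<in> limiting_subdiff (\<lambda>x. blinfun_apply z (h x)) xb"
    by (rule limiting_subdiff_scalarization[OF asp(1) str R0 L h xlim x(2) zsB zslim xs xslim])
  obtain m where m: "\<And>p q. blinfun_apply m (p, q) = blinfun_apply (- a) p + blinfun_apply \<eta> q"
    using blinfun_pair_ex[of "- a" \<eta>] by blast
  have "m \<in> limiting_normal (graph_of F) (xb, 0)" unfolding limiting_normal_def
  proof (intro CollectI exI[of _ "\<lambda>n. (u (r n), y (r n))"] exI[of _ "\<lambda>n. N (r n)"] conjI allI)
    fix n
    show "(u (r n), y (r n)) \<in> graph_of F" using y(2) by (simp add: graph_of_def)
    show "N (r n) \<in> frechet_normal (graph_of F) (u (r n), y (r n))" by (rule N(1))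
  next
    show "(\<lambda>n. (u (r n), y (r n))) \<longlonglongrightarrow> (xb, 0)" by (intro tendsto_Pair ulim ylim)
  next
    fix v :: "'x \<times> 'y"
    show "(\<lambda>n. blinfun_apply (N (r n)) v) \<longlonglongrightarrow> blinfun_apply m v"
      using tendsto_add[OF uslim[of "fst v"] yslim[of "snd v"]] N(2)[of _ "fst v" "snd v"] m[of "fst v" "snd v"]
      by (simp add: blinfun.minus_left)
  qed
  \<comment> \<open>The coderivative is defined with a minus sign on the second component, hence the
    multiplier \<open>- \<eta>\<close>.\<close>
  then have "- a \<in> normal_coderiv F xb 0 (- \<eta>)" unfolding normal_coderiv_def
    using m by (auto simp: blinfun.minus_left)
  then show ?thesis using zle aS by (intro that[of z a "- a" "- \<eta>"]) auto
qed

theorem theorem4p2: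
  fixes g :: "'x::banach \<times> 'p::banach \<Rightarrow> 'z::banach"
    and H :: "'x \<times> 'p \<Rightarrow> 'y::banach set"
    and K :: "'z set" and M :: "'p set" and xb :: 'x and L :: real
    and S :: "'p \<Rightarrow> 'x set"
  assumes asp: "asplund TYPE('x)" "asplund TYPE('y)" "asplund TYPE('z)" "asplund TYPE('p)"
    and K_cone: "closed K" "convex K" "cone K" "K \<inter> uminus ` K = {0}" "interior K \<noteq> {}"
    and S_def: "\<And>p. S p = {x. 0 \<in> H (x, p)}"
    and M_ne: "M \<noteq> {}"
    and L_pos: "L > 0"
    and H1: "\<forall>p\<in>M. strictly_lipschitz_at (\<lambda>x. g (x, p)) xb \<and>
               (\<exists>U. open U \<and> xb \<in> U \<and>
                  (\<forall>x\<in>U. \<forall>u\<in>U. norm (g (x, p) - g (u, p)) \<le> L * norm (x - u)))"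
    and H2: "xb \<in> (\<Inter>p\<in>M. S p)"
            "\<forall>p\<in>M. \<exists>\<epsilon>>0. \<forall>x \<in> ball xb \<epsilon> \<inter> S p. g (x, p) - g (xb, p) \<notin> uminus ` interior K"
    and H3: "\<exists>r>0. \<exists>V. open V \<and> xb \<in> V \<and>
               (\<forall>p\<in>M. \<forall>x\<in>V. edist_set x (S p) \<le> ereal r * edist_set 0 (H (x, p)))"
    and H4: "\<forall>p\<in>M. closed (graph_of (\<lambda>x. H (x, p))) \<and> lipschitz_like H (xb, p) 0"
  shows "\<forall>e \<in> interior K. \<forall>p\<in>M. \<exists>zs \<in> dual_cone K. blinfun_apply zs e = 1 \<and>
           (\<exists>ys :: 'y \<Rightarrow>\<^sub>L real.
              \<exists>a \<in> limiting_subdiff (\<lambda>x. blinfun_apply zs (g (x, p))) xb.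
              \<exists>b \<in> normal_coderiv (\<lambda>x. H (x, p)) xb 0 ys. a + b = 0)"
proof (intro ballI)
  fix e p assume e: "e \<in> interior K" and p: "p \<in> M"
  define h where "h = (\<lambda>x. g (x, p))"
  define F where "F = (\<lambda>x. H (x, p))"
  have xbS: "xb \<in> S p" using H2(1) p by blast
  obtain \<epsilon> where \<epsilon>: "\<epsilon> > 0" "\<And>x. x \<in> ball xb \<epsilon> \<Longrightarrow> x \<in> S p \<Longrightarrow> h x - h xb \<notin> uminus ` interior K"
    using H2(2) p unfolding h_def by blast
  \<comment> \<open>Weak minimality tested at \<open>xb\<close> itself: the difference is 0, which
    therefore is not in the negative interior.\<close>
  have z0: "0 \<notin> interior K" using \<epsilon>(2)[OF centre_in_ball[THEN iffD2, OF \<epsilon>(1)] xbS] by force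
  obtain s ls where s: "sublinear s" "ls \<ge> 0" "\<forall>z. s z \<le> ls * norm z" "\<forall>z. s z < 0 \<longrightarrow> - z \<in> interior K"
    "\<forall>\<zeta>. (\<forall>z. blinfun_apply \<zeta> z \<le> s z) \<longrightarrow> \<zeta> \<in> dual_cone K \<and> blinfun_apply \<zeta> e = 1"
    by (rule scalarizing_functional[OF K_cone(2,3) e z0])
  have str: "strictly_lipschitz_at h xb" unfolding h_def by (rule conjunct1[OF bspec[OF H1 p]])
  obtain U where "open U \<and> xb \<in> U \<and> (\<forall>x\<in>U. \<forall>u\<in>U. norm (g (x, p) - g (u, p)) \<le> L * norm (x - u))"
    using conjunct2[OF bspec[OF H1 p]] by (elim exE)
  then have U: "open U" "xb \<in> U" "\<And>x u. x \<in> U \<Longrightarrow> u \<in> U \<Longrightarrow> norm (h x - h u) \<le> L * norm (x - u)"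
    by (simp_all add: h_def)
  obtain r V where r: "r > 0" and V: "open V" "xb \<in> V" "\<And>x. x \<in> V \<Longrightarrow> edist_set x (S p) \<le> ereal r * edist_set 0 (F x)"
    using H3 p unfolding F_def by blast
  have "open (U \<inter> V)" "xb \<in> U \<inter> V" using U V by auto
  then obtain R' where R': "R' > 0" "ball xb R' \<subseteq> U \<inter> V" using open_contains_ball by blast
  \<comment> \<open>\<open>exact_penalization\<close> needs its hypotheses on the ball of radius
    \<open>3 * R\<close>, which must fit into all three neighbourhoods.\<close>
  define R where "R = min R' \<epsilon> / 3"
  have R: "R > 0" using R' \<epsilon> by (simp add: R_def)
  have R3: "ball xb (3 * R) \<subseteq> U" "ball xb (3 * R) \<subseteq> V" "ball xb (3 * R) \<subseteq> ball xb \<epsilon>"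
    using R'(2) by (auto simp: R_def)
  have R1: "ball xb R \<subseteq> U" using R3(1) R by auto
  have flip: "s (h u - h xb) \<le> s (h x - h xb) + ls * L * norm (x - u)" if "x \<in> ball xb (3 * R)" "u \<in> ball xb (3 * R)" for x u
  proof -
    have "s (h u - h xb) \<le> s (h x - h xb) + s (h u - h x)" using sublinear_add[OF s(1), of "h x - h xb" "h u - h x"] by simp
    also have "s (h u - h x) \<le> ls * norm (h u - h x)" by (rule s(3)[rule_format])
    also have "\<dots> \<le> ls * (L * norm (x - u))"
      using U(3)[OF subsetD[OF R3(1) that(2)] subsetD[OF R3(1) that(1)]] s(2)
      by (intro mult_left_mono) (simp_all add: norm_minus_commute)
    finally show ?thesis by (simp add: mult.assoc)
  qed
  \<comment> \<open>A negative value of \<open>s\<close> would place the decrease in the interior of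
    \<open>K\<close> and contradict weak minimality.\<close>
  have fmin: "0 \<le> s (h x - h xb)" if x: "x \<in> ball xb (3 * R)" "x \<in> S p" for x
  proof (rule ccontr)
    assume "\<not> ?thesis"
    then have "- (h x - h xb) \<in> interior K" by (intro s(4)[rule_format]) simp
    then have "h x - h xb \<in> uminus ` interior K" by (metis imageI minus_minus)
    then show False using \<epsilon>(2) x R3(3) by blast
  qed
  have pen: "- (ls * L * r) * norm y \<le> s (h x - h xb)" if "y \<in> F x" "x \<in> ball xb R" for x y
  proof (rule exact_penalization[where f="\<lambda>x. s (h x - h xb)" and F=F, OF _ xbS R _ r flip fmin _ that(2,1)])
    show "S p = {x. 0 \<in> F x}" by (simp add: S_def F_def)
    show "0 \<le> ls * L" using s(2) L_pos by simp
    show "edist_set x (S p) \<le> ereal r * edist_set 0 (F x)" if "x \<in> ball xb (3 * R)" for x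
      using V(3) R3(2) that by blast
  qed
  have hL: "norm (h x - h u) \<le> L * norm (x - u)" if "x \<in> ball xb R" "u \<in> ball xb R" for x u
    using U(3) R1 that by blast
  have F: "closed (graph_of F)" "0 \<in> F xb" using H4 p xbS by (auto simp: F_def S_def)
  have c: "ls * L * r \<ge> 0" using s(2) L_pos r by simp
  obtain z ys a b where z: "\<forall>v. blinfun_apply z v \<le> s v"
    and ab: "a \<in> limiting_subdiff (\<lambda>x. blinfun_apply z (h x)) xb" "b \<in> normal_coderiv F xb 0 ys" "a + b = 0"
    by (rule multiplier_rule[OF asp(1-3) s(1) s(3)[rule_format] s(2) str R less_imp_le[OF L_pos] hL F c pen])
  show "\<exists>zs \<in> dual_cone K. blinfun_apply zs e = 1 \<and>
           (\<exists>ys :: 'y \<Rightarrow>\<^sub>L real.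
              \<exists>a \<in> limiting_subdiff (\<lambda>x. blinfun_apply zs (g (x, p))) xb.
              \<exists>b \<in> normal_coderiv (\<lambda>x. H (x, p)) xb 0 ys. a + b = 0)"
    using s(5)[rule_format, OF z[rule_format]] ab unfolding h_def F_def by blast
qed

end
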